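(* For every $d \geq 3$ there exist positive reals $(\epsilon_n)_{n \geq 3}$ with $\epsilon_n = (1/2)^{o(n)}$ (that is, $\log_2(1/\epsilon_n) = o(n)$ as $n \to \infty$) such that for every $n \geq 3$ the following holds: every finite set $\mathcal{X} \subset \mathbb{R}^d$ in general position with $|\mathcal{X}| \geq ES_3(8n)$ contains a collection of $n$ subsets $X_1, \ldots, X_n \subset \mathcal{X}$ which is in convex position and satisfies $|X_i| \geq \epsilon_n |\mathcal{X}|$ for all $i = 1, \ldots, n$.
   Context: A set $X \subset \mathbb{R}^d$ with $|X| \geq d+1$ is in general position if no $d+1$ points of $X$ lie on a common affine hyperplane. A finite point set is in convex position if its points are the vertices of a convex polytope. $ES_d(n)$ denotes the smallest integer $N$ such that every set of $N$ points in general position in $\mathbb{R}^d$ contains $n$ points in convex position. A collection of sets $X_1, \ldots, X_n \subset \mathbb{R}^d$ is in convex position if for every $i = 1, \ldots, n$ the convex hulls $\mathrm{conv}(X_i)$ and $\mathrm{conv}(\bigcup_{j \neq i} X_j)$ are disjoint. *)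

theory Defs
  imports "HOL-Analysis.Analysis" "HOL-Library.Landau_Symbols"
begin

(* The size condition belongs to the notion: without it every set of at most DIM('a) points
   (three collinear points in dimension 3, say) would vacuously be in general position. *)
definition general_position :: "'a::euclidean_space set \<Rightarrow> bool" where
  "general_position X \<longleftrightarrow>
     (finite X \<longrightarrow> card X \<ge> DIM('a) + 1) \<and>
     \<not> (\<exists>S a b. S \<subseteq> X \<and> card S = DIM('a) + 1 \<and> a \<noteq> 0 \<and> S \<subseteq> {x. a \<bullet> x = b})"

definition convex_position :: "'a::euclidean_space set \<Rightarrow> bool" where
  "convex_position P \<longleftrightarrow> (\<exists>K. polytope K \<and> P = {v. v extreme_point_of K})"

(* The dimension d is the dimension of the type 'a.  Since sets of at most d points are never
   in general position, N ranges over N >= d + 1; otherwise N = 0 would qualify vacuously. *)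
definition ES :: "'a::euclidean_space itself \<Rightarrow> nat \<Rightarrow> nat" where
  "ES _ n = (LEAST N. N \<ge> DIM('a) + 1 \<and>
     (\<forall>X::'a set. finite X \<and> card X = N \<and> general_position X \<longrightarrow>
        (\<exists>P\<subseteq>X. card P = n \<and> convex_position P)))"

definition family_convex_position :: "'i set \<Rightarrow> ('i \<Rightarrow> 'a::euclidean_space set) \<Rightarrow> bool" where
  "family_convex_position I X \<longleftrightarrow>
     (\<forall>i\<in>I. convex hull (X i) \<inter> convex hull (\<Union>j\<in>I - {i}. X j) = {})"

end

theory Submission
  imports "HOL-Library.Ramsey" "HOL-Real_Asymp.Real_Asymp" Defs
begin

text \<open>
  A generic projection reduces everything to \<open>\<real>\<^sup>3\<close>. There, the main point is that for every
  \<open>\<delta> > 0\<close> and large \<open>n\<close>, any \<open>2\<^bsup>\<delta>n\<^esup>\<close> points in general position contain \<open>n\<close> points each of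
  which is cut off from the others by a plane through three points of the set.

  By Ramsey's theorem and a counting argument there are boundedly many clusters, each of them a
  constant fraction of the set, which lie like points on the moment curve with respect to boundedly
  many single points between them. If, in a projection from a single point \<open>q\<close>, the lines through
  two points of a cluster leave all other clusters on one side, then by the cups-caps theorem this
  cluster contributes a convex chain of linear length bulging away from the others (or already \<open>n\<close>
  points bulging towards them), and the chains of different clusters combine. As boundedly many
  clusters, independent of \<open>n\<close>, suffice, it remains to find enough clusters with such a \<open>q\<close>. For a pair
  of points in a cluster, \<open>q\<close> exists unless the direction of the pair lies in the cone spanned by the
  clusters under consideration; whether it does depends only on the signs of the pair with respect
  to two axes through single points, one joining the first point to the right neighbour and one
  joining the left neighbour to the last point. Each such sign is a total order on the cluster, so
  it can be made to agree with another one, or to disagree, on a large part of the cluster. Asking for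
  agreement with unbalanced sizes, either enough clusters succeed at once, or a whole group of
  clusters fails at almost no cost; iterating inside such groups leaves a chain of clusters which
  succeed for the opposite reason.

  The positive fraction version follows by counting: fixing the points that span the planes, the cut
  off points may vary independently within large sets.
\<close>

section \<open>Combinatorial tools\<close>

text \<open>The unbalanced sizes are forced. A final chain of \<open>R\<close> clusters needs about
  \<open>n div R\<close> cut off points from each, hence parts of size 2^(c n) with \<open>c\<close>
  of order (log R)/R. Even splits would halve the exponent in each of \<open>R\<close> rounds and
  leave a share of 2^(-R), which is too little. Instead, the branch that succeeds at once may use
  \<open>k\<close> clusters with \<open>k\<close> much larger than \<open>R\<close>, so tiny parts
  suffice there, and the other branch loses only a factor of that tiny size per round. This is
  consistent because \<open>R\<close> is fixed first, from the target exponent alone, and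
  \<open>k\<close> afterwards, depending on \<open>R\<close>.

  One exponent \<open>t\<close> serves both as size threshold and as fraction:
  \<open>\<epsilon> n\<close> is 2^(-t). Below 2^t points singletons are large enough, and only
  there the bound by \<open>ES\<close> is used to find them. That \<open>ES\<close> is attained at
  all is itself drawn from the positive fraction statement.\<close>

lemma chain_or_antichain:
  assumes "finite Z" "s * t \<le> card Z" "transp_on Z P" "asymp_on Z P"
  shows "(\<exists>C\<subseteq>Z. card C = s \<and> (\<forall>x\<in>C. \<forall>y\<in>C. x \<noteq> y \<longrightarrow> P x y \<or> P y x)) \<or>
         (\<exists>C\<subseteq>Z. card C = t \<and> (\<forall>x\<in>C. \<forall>y\<in>C. \<not> P x y))"
  using assms
proof (induction s arbitrary: Z)
  case 0
  then show ?case by (intro disjI1 exI[of _ "{}"]) auto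
next
  case (Suc s)
  \<comment> \<open>The minimal elements form an antichain. If there are fewer than \<open>t\<close>
    of them, removing them leaves \<open>s * t\<close> elements, and the least element of a chain
    found there has an element of \<open>Z\<close> below it, so the chain grows by one.\<close>
  define A where "A = {z\<in>Z. \<forall>y\<in>Z. \<not> P y z}"
  have AZ: "A \<subseteq> Z" and finA: "finite A"
    using Suc.prems(1) by (auto simp: A_def)
  show ?case
  proof (cases "t \<le> card A")
    case True
    then obtain C where "C \<subseteq> A" "card C = t" by (meson obtain_subset_with_card_n)
    then show ?thesis by (intro disjI2 exI[of _ C]) (auto simp: A_def)
  next
    case False
    have "card (Z - A) = card Z - card A" using AZ finA by (simp add: card_Diff_subset)
    then have "s * t \<le> card (Z - A)" using Suc.prems(2) False by simp
    then have "(\<exists>C\<subseteq>Z - A. card C = s \<and> (\<forall>x\<in>C. \<forall>y\<in>C. x \<noteq> y \<longrightarrow> P x y \<or> P y x)) \<or>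
         (\<exists>C\<subseteq>Z - A. card C = t \<and> (\<forall>x\<in>C. \<forall>y\<in>C. \<not> P x y))"
      using Suc.prems by (intro Suc.IH) (auto intro: transp_on_subset asymp_on_subset)
    then show ?thesis
    proof
      assume "\<exists>C\<subseteq>Z - A. card C = t \<and> (\<forall>x\<in>C. \<forall>y\<in>C. \<not> P x y)"
      then show ?thesis by blast
    next
      assume "\<exists>C\<subseteq>Z - A. card C = s \<and> (\<forall>x\<in>C. \<forall>y\<in>C. x \<noteq> y \<longrightarrow> P x y \<or> P y x)"
      then obtain C where C: "C \<subseteq> Z - A" "card C = s"
        "\<forall>x\<in>C. \<forall>y\<in>C. x \<noteq> y \<longrightarrow> P x y \<or> P y x" by blast
      have finC: "finite C" using C(1) Suc.prems(1) finite_subset by blast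
      show ?thesis
      proof (cases "C = {}")
        case True
        then have "s = 0" using C by simp
        moreover obtain z where "z \<in> Z" using False Suc.prems(2) by (cases "Z = {}") auto
        ultimately show ?thesis by (intro disjI1 exI[of _ "{z}"]) auto
      next
        case ne: False
        have tC: "transp_on C P" "asymp_on C P"
          using C(1) Suc.prems by (auto intro: transp_on_subset asymp_on_subset)
        obtain c where c: "c \<in> C" "\<forall>x\<in>C. x \<noteq> c \<longrightarrow> \<not> P x c"
          using Finite_Set.bex_min_element[OF finC tC(2,1) ne] by blast
        have ncc: "\<not> P c c" using tC(2) c(1) by (metis asymp_onD)
        obtain y where y: "y \<in> Z" "P y c"
          using c(1) C(1) by (auto simp: A_def)
        have ynC: "y \<notin> C" using y c ncc by auto
        have Py: "P y z" if "z \<in> C" for z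
        proof (cases "z = c")
          case False
          then have "P c z" using C(3) c that by blast
          then show ?thesis using y that c(1) C(1) Suc.prems(3) by (auto dest: transp_onD)
        qed (use y in simp)
        have "card (insert y C) = Suc s" using ynC finC C(2) by simp
        moreover have "\<forall>x\<in>insert y C. \<forall>z\<in>insert y C. x \<noteq> z \<longrightarrow> P x z \<or> P z x"
          using C(3) Py by auto
        ultimately show ?thesis using y(1) C(1) by (intro disjI1 exI[of _ "insert y C"]) auto
      qed
    qed
  qed
qed

lemma finite_strict_total_enumeration:
  assumes "finite Z" "transp_on Z lt" "asymp_on Z lt" "totalp_on Z lt"
  shows "\<exists>e. bij_betw e {..<card Z} Z \<and> (\<forall>i j. i < j \<longrightarrow> j < card Z \<longrightarrow> lt (e i) (e j))"
  using assms
proof (induction "card Z" arbitrary: Z)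
  case 0
  then show ?case by (auto simp: bij_betw_def)
next
  case (Suc n)
  have ne: "Z \<noteq> {}" using Suc.hyps by auto
  obtain c where c: "c \<in> Z" "\<forall>x\<in>Z. x \<noteq> c \<longrightarrow> \<not> lt c x"
    using Finite_Set.bex_max_element[OF Suc.prems(1,3,2) ne] by blast
  have lt: "lt x c" if "x \<in> Z - {c}" for x
    using that c Suc.prems(4) by (auto simp: totalp_on_def)
  have cd: "n = card (Z - {c})" using Suc.hyps(2) c by simp
  have "\<exists>e. bij_betw e {..<card (Z - {c})} (Z - {c}) \<and>
     (\<forall>i j. i < j \<longrightarrow> j < card (Z - {c}) \<longrightarrow> lt (e i) (e j))"
    using Suc.prems by (intro Suc.hyps(1)[OF cd])
      (auto intro: transp_on_subset asymp_on_subset totalp_on_subset)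
  then obtain e where e: "bij_betw e {..<n} (Z - {c})" "\<forall>i j. i < j \<longrightarrow> j < n \<longrightarrow> lt (e i) (e j)"
    using cd by auto
  define e' where "e' = e(n := c)"
  have "bij_betw e' {..<n} (Z - {c})"
    using e(1) by (rule bij_betw_cong[THEN iffD1, rotated]) (auto simp: e'_def)
  then have "bij_betw e' ({..<n} \<union> {n}) (Z - {c} \<union> {c})"
    by (intro bij_betw_combine) (auto simp: bij_betw_def e'_def)
  moreover have "{..<n} \<union> {n} = {..<card Z}" "Z - {c} \<union> {c} = Z"
    using Suc.hyps(2) c by auto
  moreover have "\<forall>i j. i < j \<longrightarrow> j < card Z \<longrightarrow> lt (e' i) (e' j)"
  proof (intro allI impI)
    fix i j assume ij: "i < j" "j < card Z"
    show "lt (e' i) (e' j)"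
    proof (cases "j = n")
      case True
      then have "e i \<in> Z - {c}" using e(1) ij by (auto simp: bij_betw_def)
      then show ?thesis using True ij lt by (auto simp: e'_def)
    next
      case False
      then show ?thesis using ij e(2) Suc.hyps(2) by (auto simp: e'_def)
    qed
  qed
  ultimately show ?case by auto
qed

section \<open>Transitive colourings of triples and the cups-caps theorem\<close>

definition monochromatic_triples :: "(nat \<Rightarrow> nat \<Rightarrow> nat \<Rightarrow> bool) \<Rightarrow> nat set \<Rightarrow> bool" where
  "monochromatic_triples P C \<longleftrightarrow> (\<forall>a\<in>C. \<forall>b\<in>C. \<forall>c\<in>C. a < b \<longrightarrow> b < c \<longrightarrow> P a b c)"

text \<open>The only feature of slopes that the cups-caps argument uses: two overlapping triples of
  one kind on four sorted points force the other two. Assuming it for \<open>P\<close> and for its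
  negation covers cups and caps without coordinates.\<close>

definition transitive_triples :: "(nat \<Rightarrow> nat \<Rightarrow> nat \<Rightarrow> bool) \<Rightarrow> nat set \<Rightarrow> bool" where
  "transitive_triples P S \<longleftrightarrow> (\<forall>a\<in>S. \<forall>b\<in>S. \<forall>c\<in>S. \<forall>d\<in>S. a < b \<longrightarrow> b < c \<longrightarrow> c < d \<longrightarrow>
     P a b c \<longrightarrow> P b c d \<longrightarrow> P a b d \<and> P a c d)"

lemma transitive_triples_subset: "transitive_triples P S \<Longrightarrow> S' \<subseteq> S \<Longrightarrow> transitive_triples P S'"
  unfolding transitive_triples_def by blast

text \<open>Only the triple of the last two elements \<open>a\<close>, \<open>b\<close> of
  \<open>C\<close> and the new \<open>c\<close> is tested. Transitivity on
  \<open>x < a < b < c\<close> yields the triples \<open>x b c\<close>, and then on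
  \<open>x < y < b < c\<close> all triples \<open>x y c\<close>.\<close>

lemma monochromatic_triples_insert_right:
  assumes tr: "transitive_triples P S" and C: "monochromatic_triples P C" "C \<subseteq> S"
    and ab: "a \<in> C" "b \<in> C" "a < b" "\<forall>x\<in>C. x \<le> b" "\<forall>x\<in>C. x \<noteq> b \<longrightarrow> x \<le> a"
    and c: "c \<in> S" "b < c" "P a b c"
  shows "monochromatic_triples P (insert c C)"
proof -
  have xb: "P x b c" if "x \<in> C" "x < b" for x
  proof (cases "x = a")
    case False
    then have "x < a" using that ab by force
    then have "P x a b" using C(1) that ab by (auto simp: monochromatic_triples_def)
    then show ?thesis
      using tr c that ab C(2) \<open>x < a\<close> unfolding transitive_triples_def by (meson subsetD)
  qed (use c in simp)
  have xy: "P x y c" if "x \<in> C" "y \<in> C" "x < y" for x y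
  proof (cases "y = b")
    case False
    then have yb: "y < b" using that ab by force
    then have "P x y b" using C(1) that ab by (auto simp: monochromatic_triples_def)
    moreover have "P y b c" using xb that yb by blast
    ultimately show ?thesis
      using tr c that ab C(2) yb unfolding transitive_triples_def by (meson subsetD)
  qed (use that xb in simp)
  have "x < c" if "x \<in> C" for x using that ab c by force
  then show ?thesis
    using C(1) xy unfolding monochromatic_triples_def by (metis insert_iff less_asym)
qed

lemma monochromatic_triples_insert_left:
  assumes tr: "transitive_triples P S" and C: "monochromatic_triples P C" "C \<subseteq> S"
    and ab: "b \<in> C" "c \<in> C" "b < c" "\<forall>x\<in>C. b \<le> x" "\<forall>x\<in>C. x \<noteq> b \<longrightarrow> c \<le> x"
    and c: "a \<in> S" "a < b" "P a b c"
  shows "monochromatic_triples P (insert a C)"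
proof -
  have xb: "P a b x" if "x \<in> C" "b < x" for x
  proof (cases "x = c")
    case False
    then have "c < x" using that ab by force
    then have "P b c x" using C(1) that ab by (auto simp: monochromatic_triples_def)
    then show ?thesis
      using tr c that ab C(2) \<open>c < x\<close> unfolding transitive_triples_def by (meson subsetD)
  qed (use c in simp)
  have xy: "P a x y" if "x \<in> C" "y \<in> C" "x < y" for x y
  proof (cases "x = b")
    case False
    then have yb: "b < x" using that ab by force
    then have "P b x y" using C(1) that ab by (auto simp: monochromatic_triples_def)
    moreover have "P a b x" using xb that yb by blast
    ultimately show ?thesis
      using tr c that ab C(2) yb unfolding transitive_triples_def by (meson subsetD)
  qed (use that xb in simp)
  have "a < x" if "x \<in> C" for x using that ab c by force
  then show ?thesis
    using C(1) xy unfolding monochromatic_triples_def by (metis insert_iff less_asym)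
qed

text \<open>Pascal's rule: \<open>A\<close> collects the last points of \<open>P\<close>-chains with
  \<open>k + 1\<close> elements. Outside \<open>A\<close> there is no such chain; inside
  \<open>A\<close>, a long chain for the negation starts where a \<open>P\<close>-chain ends, and
  the triple around the junction prolongs one of the two.\<close>

lemma cups_caps:
  assumes "finite S" "transitive_triples P S" "transitive_triples (\<lambda>a b c. \<not> P a b c) S"
    and "(k + l) choose k < card S"
  shows "(\<exists>C\<subseteq>S. card C = k + 2 \<and> monochromatic_triples P C) \<or>
         (\<exists>C\<subseteq>S. card C = l + 2 \<and> monochromatic_triples (\<lambda>a b c. \<not> P a b c) C)"
  using assms
proof (induction "k + l" arbitrary: k l S rule: less_induct)
  case less
  let ?Q = "\<lambda>a b c. \<not> P a b c"
  show ?case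
  proof (cases "k = 0 \<or> l = 0")
    case True
    \<comment> \<open>A two-element set contains no triple, so it is a cup and a cap at
      once.\<close>
    then have "2 \<le> card S" using less.prems(4) by auto
    then obtain C where C: "C \<subseteq> S" "card C = 2" by (meson obtain_subset_with_card_n)
    then obtain x y where "C = {x, y}" by (meson card_2_iff)
    then have "monochromatic_triples R C" for R
      by (auto simp: monochromatic_triples_def)
    then show ?thesis using C True by auto
  next
    case False
    then obtain k' l' where kl: "k = Suc k'" "l = Suc l'" by (meson not0_implies_Suc)
    define A where "A = {b\<in>S. \<exists>C\<subseteq>S. card C = k + 1 \<and> monochromatic_triples P C \<and> b \<in> C \<and> (\<forall>x\<in>C. x \<le> b)}"
    have AS: "A \<subseteq> S" by (auto simp: A_def)
    have finA: "finite A" using AS less.prems(1) finite_subset by blast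
    have pas: "(k + l) choose k = (k' + l choose k') + (k + l' choose k)"
      using kl by simp
    have cS: "card S = card (S - A) + card A"
      using AS less.prems(1) by (metis card_Diff_subset card_mono finA le_add_diff_inverse2)
    consider "(k' + l) choose k' < card (S - A)" | "(k + l') choose k < card A"
      using less.prems(4) pas cS by linarith
    then show ?thesis
    proof cases
      case 1
      have "(\<exists>C\<subseteq>S - A. card C = k' + 2 \<and> monochromatic_triples P C) \<or>
         (\<exists>C\<subseteq>S - A. card C = l + 2 \<and> monochromatic_triples ?Q C)"
        using less.prems 1 kl by (intro less.hyps) (auto intro: transitive_triples_subset)
      then show ?thesis
      proof
        assume "\<exists>C\<subseteq>S - A. card C = k' + 2 \<and> monochromatic_triples P C"
        then obtain C where C: "C \<subseteq> S - A" "card C = k + 1" "monochromatic_triples P C"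
          using kl by auto
        have finC: "finite C" "C \<noteq> {}" using C(2) card.infinite by fastforce+
        then have "Max C \<in> C" by simp
        moreover have "C \<subseteq> S" "\<forall>x\<in>C. x \<le> Max C" using C finC by auto
        ultimately have "Max C \<in> A" using C unfolding A_def by blast
        then show ?thesis using \<open>Max C \<in> C\<close> C by blast
      qed blast
    next
      case 2
      have "(\<exists>C\<subseteq>A. card C = k + 2 \<and> monochromatic_triples P C) \<or>
         (\<exists>C\<subseteq>A. card C = l' + 2 \<and> monochromatic_triples ?Q C)"
        using less.prems 2 kl finA AS by (intro less.hyps) (auto intro: transitive_triples_subset)
      then show ?thesis
      proof
        assume "\<exists>C\<subseteq>A. card C = l' + 2 \<and> monochromatic_triples ?Q C"
        then obtain D where D: "D \<subseteq> A" "card D = l + 1" "monochromatic_triples ?Q D"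
          using kl by auto
        have finD: "finite D" using D(1) finA finite_subset by blast
        define b where "b = Min D"
        have bD: "b \<in> D" using finD D(2) unfolding b_def by (intro Min_in) auto
        obtain C where C: "C \<subseteq> S" "card C = k + 1" "monochromatic_triples P C" "b \<in> C" "\<forall>x\<in>C. x \<le> b"
          using bD D(1) unfolding A_def by auto
        have finC: "finite C" using C(1) less.prems(1) finite_subset by blast
        have C'ne: "C - {b} \<noteq> {}" and D'ne: "D - {b} \<noteq> {}"
        proof -
          have "card (C - {b}) > 0" "card (D - {b}) > 0" using C D bD kl finC finD by auto
          then show "C - {b} \<noteq> {}" "D - {b} \<noteq> {}" by (metis card.empty less_irrefl)+
        qed
        define a where "a = Max (C - {b})"
        define c where "c = Min (D - {b})"
        have a: "a \<in> C - {b}" unfolding a_def using finC C'ne by (intro Max_in) auto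
        have c: "c \<in> D - {b}" unfolding c_def using finD D'ne by (intro Min_in) auto
        have ab: "a < b" using a C(5) by force
        have bmin: "\<forall>x\<in>D. b \<le> x" using finD unfolding b_def by simp
        have bc: "b < c" using c bmin by force
        show ?thesis
        \<comment> \<open>\<open>a\<close>, \<open>b\<close> end the \<open>P\<close>-chain and
          \<open>b\<close>, \<open>c\<close> begin the other one; whichever way the triple is
          coloured, one of the chains gains a point.\<close>
        proof (cases "P a b c")
          case True
          have "monochromatic_triples P (insert c C)"
            using monochromatic_triples_insert_right[OF less.prems(2) C(3,1), of a b c]
              a c C ab bc True D(1) AS finC by (auto simp: a_def)
          moreover have "card (insert c C) = k + 2" using C bc finC by (subst card_insert_disjoint) auto
          ultimately show ?thesis using C(1) c D(1) AS by (intro disjI1 exI[of _ "insert c C"]) auto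
        next
          case False
          have "monochromatic_triples ?Q (insert a D)"
            using monochromatic_triples_insert_left[OF less.prems(3) D(3), of b c a]
              a c C ab bc False D(1) AS finD bmin bD by (auto simp: c_def)
          moreover have "card (insert a D) = l + 2" using D bmin ab finD by (subst card_insert_disjoint) auto
          ultimately show ?thesis using C(1) a D(1) AS by (intro disjI2 exI[of _ "insert a D"]) auto
        qed
      qed (use AS in blast)
    qed
  qed
qed

section \<open>Counting in product sets\<close>

lemma pigeonhole_sum_card:
  assumes "finite T" "T \<noteq> {}" "finite S" "S \<subseteq> (\<Union>t\<in>T. B t)"
  shows "\<exists>t\<in>T. card S \<le> card T * card (S \<inter> B t)"
proof (rule ccontr)
  assume "\<not> ?thesis"
  then have lt: "card T * card (S \<inter> B t) < card S" if "t \<in> T" for t using that by force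
  have "S = (\<Union>t\<in>T. S \<inter> B t)" using assms by auto
  then have "card S \<le> (\<Sum>t\<in>T. card (S \<inter> B t))"
    by (metis assms(1) card_UN_le)
  then have "card T * card S \<le> (\<Sum>t\<in>T. card T * card (S \<inter> B t))"
    by (simp add: sum_distrib_left[symmetric])
  also have "\<dots> < (\<Sum>t\<in>T. card S)" using assms lt by (intro sum_strict_mono) auto
  finally show False by simp
qed

text \<open>Pigeonhole twice: a most frequent type \<open>t\<close> and then a most frequent choice
  \<open>g\<close> outside \<open>V t\<close> leave at least \<open>s ^ m / card T\<close>
  functions. Each is determined by its values on \<open>V t\<close>, so the product of the numbers
  of attained values is at least as large. Values at different coordinates may stem from different
  functions; applications therefore evaluate conditions with one free coordinate at a time.\<close>

lemma product_pigeonhole: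
  fixes A :: "'i \<Rightarrow> 'a set" and V :: "'t \<Rightarrow> 'i set"
  assumes I: "finite I" and A: "\<And>i. i \<in> I \<Longrightarrow> finite (A i) \<and> card (A i) = s" and s: "s > 0"
    and T: "finite T" and P: "\<And>f. f \<in> PiE I A \<Longrightarrow> \<exists>t\<in>T. P t f"
    and V: "\<And>t. t \<in> T \<Longrightarrow> V t \<subseteq> I \<and> card (V t) = m"
  shows "\<exists>t\<in>T. \<exists>g\<in>PiE (I - V t) A. s ^ m \<le> card T *
    (\<Prod>v\<in>V t. card {f v |f. f \<in> PiE I A \<and> P t f \<and> (\<forall>i\<in>I - V t. f i = g i)})"
proof -
  let ?\<Omega> = "PiE I A"
  have fin\<Omega>: "finite ?\<Omega>" using I A by (intro finite_PiE) auto
  have card\<Omega>: "card ?\<Omega> = s ^ card I" using I A by (simp add: card_PiE)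
  have "?\<Omega> \<noteq> {}" using card\<Omega> s by (metis card.empty less_irrefl zero_less_power)
  then have Tne: "T \<noteq> {}" using P by blast
  obtain t where t: "t \<in> T" "card ?\<Omega> \<le> card T * card (?\<Omega> \<inter> {f. P t f})"
    using pigeonhole_sum_card[OF T Tne fin\<Omega>, of "\<lambda>t. {f. P t f}"] P by blast
  let ?G = "PiE (I - V t) A" and ?S = "?\<Omega> \<inter> {f. P t f}"
  have VI: "V t \<subseteq> I" "card (V t) = m" using V t by auto
  have finV: "finite (V t)" using VI I finite_subset by blast
  have finG: "finite ?G" using I A by (intro finite_PiE) auto
  have mI: "m \<le> card I" using VI card_mono I by metis
  have cIV: "card (I - V t) = card I - m" using VI finV by (simp add: card_Diff_subset)
  have cardG: "card ?G = s ^ (card I - m)"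
    using I A cIV by (simp add: card_PiE)
  have Gne: "?G \<noteq> {}" using cardG s by (metis card.empty less_irrefl zero_less_power)
  have cov: "?S \<subseteq> (\<Union>g\<in>?G. {f. \<forall>i\<in>I - V t. f i = g i})"
  proof
    fix f assume "f \<in> ?S"
    then have "restrict f (I - V t) \<in> ?G" by auto
    then show "f \<in> (\<Union>g\<in>?G. {f. \<forall>i\<in>I - V t. f i = g i})"
      by (intro UN_I[of "restrict f (I - V t)"]) auto
  qed
  obtain g where g: "g \<in> ?G" "card ?S \<le> card ?G * card (?S \<inter> {f. \<forall>i\<in>I - V t. f i = g i})"
    using pigeonhole_sum_card[OF finG Gne _ cov] fin\<Omega> by blast
  let ?F = "?S \<inter> {f. \<forall>i\<in>I - V t. f i = g i}"
  let ?B = "\<lambda>v. {f v |f. f \<in> PiE I A \<and> P t f \<and> (\<forall>i\<in>I - V t. f i = g i)}"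
  have finB: "finite (?B v)" if "v \<in> V t" for v
  proof -
    have "?B v \<subseteq> A v" using that VI by auto
    then show ?thesis using A that VI finite_subset by blast
  qed
  have "card ?F \<le> card (PiE (V t) ?B)"
  proof (rule card_inj_on_le[where f = "\<lambda>f. restrict f (V t)"])
    show "inj_on (\<lambda>f. restrict f (V t)) ?F"
    proof (rule inj_onI)
      fix f f' assume ff: "f \<in> ?F" "f' \<in> ?F" "restrict f (V t) = restrict f' (V t)"
      show "f = f'"
      proof
        fix i
        consider "i \<in> V t" | "i \<in> I - V t" | "i \<notin> I" by blast
        then show "f i = f' i"
        proof cases
          case 1
          then show ?thesis using ff(3) by (metis restrict_apply')
        next
          case 2
          then show ?thesis using ff by auto
        next
          case 3
          then have "f i = undefined" "f' i = undefined" using ff PiE_arb by fastforce+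
          then show ?thesis by simp
        qed
      qed
    qed
    show "(\<lambda>f. restrict f (V t)) ` ?F \<subseteq> PiE (V t) ?B" by auto
    show "finite (PiE (V t) ?B)" using finV finB by (intro finite_PiE) auto
  qed
  also have "\<dots> = (\<Prod>v\<in>V t. card (?B v))" using finV by (simp add: card_PiE)
  finally have F: "card ?F \<le> (\<Prod>v\<in>V t. card (?B v))" .
  have "s ^ (card I - m) * s ^ m = card ?\<Omega>"
    using card\<Omega> mI by (simp flip: power_add)
  also have "\<dots> \<le> card T * (card ?G * card ?F)"
    using t(2) g(2) by (meson dual_order.trans mult_le_mono2)
  also have "\<dots> \<le> card T * (card ?G * (\<Prod>v\<in>V t. card (?B v)))"
    using F by (intro mult_le_mono2) auto
  also have "\<dots> = s ^ (card I - m) * (card T * (\<Prod>v\<in>V t. card (?B v)))"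
    using cardG by simp
  finally have "s ^ m \<le> card T * (\<Prod>v\<in>V t. card (?B v))"
    using s by (simp add: mult_le_cancel1)
  then show ?thesis using t(1) g(1) by blast
qed


text \<open>Indices consumed by \<open>s\<close> rounds: a leading index, followed by
  \<open>k\<close> consecutive groups, each long enough for the remaining rounds. Which group is
  entered depends on the answers, so all of them must be reserved.\<close>

fun stage_size :: "nat \<Rightarrow> nat \<Rightarrow> nat" where
  "stage_size k 0 = 1"
| "stage_size k (Suc s) = Suc (k * stage_size k s)"

lemma interval_groups:
  fixes \<alpha> c :: nat
  shows "(\<exists>f. \<forall>i<k. \<alpha> + i * c \<le> f i \<and> f i < \<alpha> + Suc i * c \<and> Q i (f i)) \<or>
    (\<exists>i<k. \<forall>j. \<alpha> + i * c \<le> j \<longrightarrow> j < \<alpha> + Suc i * c \<longrightarrow> \<not> Q i j)"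
  by metis

text \<open>A query splits a cluster into a small part answering \<open>minus\<close> or a large part answering \<open>plus\<close>,
  so that a cluster survives \<open>s\<close> answers \<open>plus\<close> at the cost of a factor \<open>c ^ s\<close> only.\<close>
lemma query_game:
  fixes plus minus :: "nat \<Rightarrow> nat \<Rightarrow> nat \<Rightarrow> 'p set \<Rightarrow> bool"
  assumes plus_mono: "\<And>j a b Z Z'. plus j a b Z \<Longrightarrow> Z' \<subseteq> Z \<Longrightarrow> plus j a b Z'"
    and c: "c > 0"
    and split: "\<And>j a b Z t. a \<le> j \<Longrightarrow> j < b \<Longrightarrow> b \<le> K \<Longrightarrow> Z \<subseteq> Z0 j \<Longrightarrow> c * t \<le> card Z \<Longrightarrow>
      (\<exists>Z'\<subseteq>Z. card Z' = c \<and> minus j a b Z') \<or> (\<exists>Z'\<subseteq>Z. card Z' = t \<and> plus j a b Z')"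
    and "\<alpha> + stage_size k s \<le> K"
    and "\<And>j. \<alpha> \<le> j \<Longrightarrow> j < \<alpha> + stage_size k s \<Longrightarrow> Z j \<subseteq> Z0 j \<and> c ^ s * e \<le> card (Z j)"
  shows "(\<exists>F a W. finite F \<and> card F = k \<and> (\<forall>j\<in>F. a \<le> j \<and> W j \<subseteq> Z0 j \<and> card (W j) = c \<and>
        (\<exists>b. j < b \<and> b \<le> K \<and> (\<forall>i\<in>F. j < i \<longrightarrow> b \<le> i) \<and> minus j a b (W j)))) \<or>
    (\<exists>F W. F \<subseteq> {\<alpha>..<\<alpha> + stage_size k s} \<and> card F = Suc s \<and>
      (\<forall>j\<in>F. W j \<subseteq> Z j \<and> e \<le> card (W j) \<and>
        ((\<forall>i\<in>F. j \<le> i) \<or> (\<exists>u b. (\<forall>i\<in>F. i < j \<longrightarrow> i < u) \<and> u \<le> j \<and> (\<forall>i\<in>F. i < b) \<and> b \<le> K \<and> plus j u b (W j)))))"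
  using assms(4,5)
proof (induction s arbitrary: \<alpha> Z)
  case 0
  then show ?case by (intro disjI2 exI[of _ "{\<alpha>}"] exI[of _ Z]) auto
next
  case (Suc s)
  let ?\<kappa> = "stage_size k s"
  \<comment> \<open>Right end of the \<open>i\<close>-th group behind the leading index
    \<open>\<alpha>\<close>. Every query of this round starts at \<open>Suc \<alpha>\<close> and
    ends at the right end of the group of the queried index.\<close>
  define b where "b i = Suc \<alpha> + Suc i * ?\<kappa>" for i
  have b_le: "b i \<le> K" if "i < k" for i
  proof -
    have "Suc i * ?\<kappa> \<le> k * ?\<kappa>" using that by (intro mult_le_mono1) auto
    then show ?thesis using Suc.prems(1) by (simp add: b_def)
  qed
  have inJ: "\<alpha> \<le> j \<and> j < \<alpha> + stage_size k (Suc s)" if "i < k" "Suc \<alpha> \<le> j" "j < b i" for i j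
  proof -
    have "Suc i * ?\<kappa> \<le> k * ?\<kappa>" using that by (intro mult_le_mono1) auto
    then show ?thesis using that by (auto simp: b_def)
  qed
  define Q where "Q i j \<longleftrightarrow> (\<exists>Z'\<subseteq>Z j. card Z' = c \<and> minus j (Suc \<alpha>) (b i) Z')" for i j
  consider (minus) f where "\<forall>i<k. Suc \<alpha> + i * ?\<kappa> \<le> f i \<and> f i < Suc \<alpha> + Suc i * ?\<kappa> \<and> Q i (f i)"
    | (plus) i where "i < k" "\<forall>j. Suc \<alpha> + i * ?\<kappa> \<le> j \<longrightarrow> j < Suc \<alpha> + Suc i * ?\<kappa> \<longrightarrow> \<not> Q i j"
    using interval_groups[of k "Suc \<alpha>" ?\<kappa> Q] by blast
  then show ?case
  proof cases
    case minus
    have fb: "f i < b i" "Suc \<alpha> \<le> f i" if "i < k" for i using minus that by (auto simp: b_def)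
    have bf: "b i \<le> f i'" if "i < i'" "i' < k" for i i'
    proof -
      have "Suc i * ?\<kappa> \<le> i' * ?\<kappa>" using that by (intro mult_le_mono1) auto
      then show ?thesis using minus that by (fastforce simp: b_def)
    qed
    have fmono: "f i < f i'" if "i < i'" "i' < k" for i i'
      using fb[of i] bf[OF that] that by linarith
    have finj: "inj_on f {..<k}"
      by (rule inj_onI) (metis fmono lessThan_iff less_irrefl linorder_neqE_nat)
    have "\<forall>i\<in>{..<k}. \<exists>Z'. Z' \<subseteq> Z (f i) \<and> card Z' = c \<and> minus (f i) (Suc \<alpha>) (b i) Z'"
      using minus by (auto simp: Q_def)
    then obtain W0 where W0: "\<forall>i\<in>{..<k}. W0 i \<subseteq> Z (f i) \<and> card (W0 i) = c \<and> minus (f i) (Suc \<alpha>) (b i) (W0 i)"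
      by metis
    define W where "W j = W0 (the_inv_into {..<k} f j)" for j
    have Wf: "W (f i) = W0 i" if "i < k" for i
      using that finj by (simp add: W_def the_inv_into_f_f)
    have ZZ0: "Z (f i) \<subseteq> Z0 (f i)" if "i < k" for i
      using Suc.prems(2) inJ[OF that fb(2,1)[OF that]] by blast
    have "\<forall>j\<in>f ` {..<k}. Suc \<alpha> \<le> j \<and> W j \<subseteq> Z0 j \<and> card (W j) = c \<and>
        (\<exists>b. j < b \<and> b \<le> K \<and> (\<forall>i\<in>f ` {..<k}. j < i \<longrightarrow> b \<le> i) \<and> minus j (Suc \<alpha>) b (W j))"
    proof
      fix j assume "j \<in> f ` {..<k}"
      then obtain i where i: "i < k" "j = f i" by auto
      have "b i \<le> f i'" if "f i < f i'" "i' < k" for i'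
      proof -
        have "i < i'" using fmono[of i' i] that i by (metis less_asym linorder_neqE_nat)
        then show ?thesis using bf that by blast
      qed
      then have 1: "\<forall>i'\<in>f ` {..<k}. j < i' \<longrightarrow> b i \<le> i'" using i(2) by blast
      have Wj: "W j = W0 i" using Wf i by simp
      have W0i: "W0 i \<subseteq> Z (f i)" "card (W0 i) = c" "minus (f i) (Suc \<alpha>) (b i) (W0 i)"
        using W0 i(1) by simp_all
      have 2: "W j \<subseteq> Z0 j" using W0i(1) ZZ0[OF i(1)] Wj i(2) by simp
      have 3: "Suc \<alpha> \<le> j" "j < b i" "b i \<le> K" using fb[OF i(1)] b_le[OF i(1)] i(2) by simp_all
      have 4: "card (W j) = c" "minus j (Suc \<alpha>) (b i) (W j)" using W0i Wj i(2) by simp_all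
      have "\<exists>b. j < b \<and> b \<le> K \<and> (\<forall>i\<in>f ` {..<k}. j < i \<longrightarrow> b \<le> i) \<and> minus j (Suc \<alpha>) b (W j)"
        by (rule exI[of _ "b i"], intro conjI) (fact 3 1 4)+
      then show "Suc \<alpha> \<le> j \<and> W j \<subseteq> Z0 j \<and> card (W j) = c \<and>
        (\<exists>b. j < b \<and> b \<le> K \<and> (\<forall>i\<in>f ` {..<k}. j < i \<longrightarrow> b \<le> i) \<and> minus j (Suc \<alpha>) b (W j))"
        by (intro conjI 2 3(1) 4(1))
    qed
    moreover have "card (f ` {..<k}) = k" using finj by (simp add: card_image)
    ultimately show ?thesis
      by (intro disjI1 exI[of _ "f ` {..<k}"] exI[of _ "Suc \<alpha>"] exI[of _ W]) simp
  next
    case plus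
    let ?\<alpha>' = "Suc \<alpha> + i * ?\<kappa>"
    have bi: "b i = ?\<alpha>' + ?\<kappa>" by (simp add: b_def)
    \<comment> \<open>A group without small \<open>minus\<close> parts answers \<open>plus\<close>
      throughout, and each of its indices loses only the factor \<open>c\<close>.\<close>
    have "\<exists>Z'. Z' \<subseteq> Z j \<and> card Z' = c ^ s * e \<and> plus j (Suc \<alpha>) (b i) Z'"
      if "?\<alpha>' \<le> j" "j < b i" for j
    proof -
      have j: "Z j \<subseteq> Z0 j \<and> c ^ Suc s * e \<le> card (Z j)"
        using Suc.prems(2) inJ[OF plus(1), of j] that by auto
      then have "c * (c ^ s * e) \<le> card (Z j)" by (simp add: mult.assoc)
      moreover have "Suc \<alpha> \<le> j" using that by simp
      moreover have "\<not> Q i j" using plus that bi by (auto simp: add.assoc)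
      ultimately show ?thesis
        using split[of "Suc \<alpha>" j "b i" "Z j" "c ^ s * e"] j that b_le[OF plus(1)]
        unfolding Q_def by blast
    qed
    then obtain Z' where Z': "\<And>j. ?\<alpha>' \<le> j \<Longrightarrow> j < b i \<Longrightarrow>
      Z' j \<subseteq> Z j \<and> card (Z' j) = c ^ s * e \<and> plus j (Suc \<alpha>) (b i) (Z' j)"
      by metis
    have 1: "?\<alpha>' + ?\<kappa> \<le> K" using b_le[OF plus(1)] bi by simp
    have 2: "Z' j \<subseteq> Z0 j \<and> c ^ s * e \<le> card (Z' j)" if "?\<alpha>' \<le> j" "j < ?\<alpha>' + ?\<kappa>" for j
    proof -
      have j: "j < b i" "Suc \<alpha> \<le> j" using that bi by auto
      have "Z j \<subseteq> Z0 j" using Suc.prems(2) inJ[OF plus(1) j(2,1)] by blast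
      then show ?thesis using Z'[OF that(1) j(1)] by auto
    qed
    show ?thesis
    proof (rule disjE[OF Suc.IH[of ?\<alpha>' Z', OF 1]])
      show "Z' j \<subseteq> Z0 j \<and> c ^ s * e \<le> card (Z' j)" if "?\<alpha>' \<le> j" "j < ?\<alpha>' + ?\<kappa>" for j
        by (rule 2[OF that])
    next
      assume "\<exists>F W. F \<subseteq> {?\<alpha>'..<?\<alpha>' + ?\<kappa>} \<and> card F = Suc s \<and>
      (\<forall>j\<in>F. W j \<subseteq> Z' j \<and> e \<le> card (W j) \<and>
        ((\<forall>i\<in>F. j \<le> i) \<or> (\<exists>u b. (\<forall>i\<in>F. i < j \<longrightarrow> i < u) \<and> u \<le> j \<and> (\<forall>i\<in>F. i < b) \<and> b \<le> K \<and> plus j u b (W j))))"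
      then obtain F W where F: "F \<subseteq> {?\<alpha>'..<?\<alpha>' + ?\<kappa>}" "card F = Suc s" and
        W: "\<forall>j\<in>F. W j \<subseteq> Z' j \<and> e \<le> card (W j) \<and>
        ((\<forall>i\<in>F. j \<le> i) \<or> (\<exists>u b. (\<forall>i\<in>F. i < j \<longrightarrow> i < u) \<and> u \<le> j \<and> (\<forall>i\<in>F. i < b) \<and> b \<le> K \<and> plus j u b (W j)))"
        by (elim exE conjE) (rule that)
      note W = bspec[OF W]
      \<comment> \<open>The leading index joins the chain found inside the group, with its set
        unchanged. It is the new minimum, of which no answer is demanded.\<close>
      let ?F = "insert \<alpha> F" and ?W = "W(\<alpha> := Z \<alpha>)"
      have Fb: "Suc \<alpha> \<le> j \<and> ?\<alpha>' \<le> j \<and> j < b i" if "j \<in> F" for j using F(1) that bi by auto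
      then have \<alpha>F: "\<alpha> \<notin> F" using not_less_eq_eq by blast
      have finF: "finite F" using F finite_subset by blast
      have J: "?F \<subseteq> {\<alpha>..<\<alpha> + stage_size k (Suc s)}"
      proof
        fix x assume "x \<in> ?F"
        then show "x \<in> {\<alpha>..<\<alpha> + stage_size k (Suc s)}"
          using Fb[of x] inJ[OF plus(1), of x] by (cases "x = \<alpha>") auto
      qed
      have cF: "card ?F = Suc (Suc s)" using \<alpha>F finF F(2) by simp
      have "?W j \<subseteq> Z j \<and> e \<le> card (?W j) \<and>
        ((\<forall>i\<in>?F. j \<le> i) \<or> (\<exists>u b. (\<forall>i\<in>?F. i < j \<longrightarrow> i < u) \<and> u \<le> j \<and> (\<forall>i\<in>?F. i < b) \<and> b \<le> K \<and> plus j u b (?W j)))"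
        if "j \<in> ?F" for j
      proof (cases "j = \<alpha>")
        case True
        have "c ^ Suc s * e \<le> card (Z \<alpha>)" using Suc.prems(2)[of \<alpha>] by simp
        moreover have "e \<le> c ^ Suc s * e" using c by simp
        ultimately have "e \<le> card (Z \<alpha>)" by linarith
        moreover have "\<forall>i\<in>?F. j \<le> i" using True Fb by (auto dest: Suc_leD)
        ultimately show ?thesis using True by simp
      next
        case False
        then have jF: "j \<in> F" using that by simp
        have "\<exists>u b. (\<forall>i\<in>?F. i < j \<longrightarrow> i < u) \<and> u \<le> j \<and> (\<forall>i\<in>?F. i < b) \<and> b \<le> K \<and> plus j u b (W j)"
        \<comment> \<open>The old minimum of \<open>F\<close> now has only \<open>\<alpha>\<close>
          before it, and this round's answer supplies \<open>u = Suc \<alpha>\<close> and the end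
          \<open>b i\<close>. All other indices keep the answer of their own round.\<close>
        proof (cases "\<forall>i\<in>F. j \<le> i")
          case True
          have jb: "?\<alpha>' \<le> j" "j < b i" "Suc \<alpha> \<le> j" using Fb[OF jF] by simp_all
          have "plus j (Suc \<alpha>) (b i) (W j)"
            using plus_mono[of j "Suc \<alpha>" "b i" "Z' j" "W j"] W[OF jF] Z'[OF jb(1,2)] by simp
          moreover have "\<forall>i\<in>?F. i < j \<longrightarrow> i < Suc \<alpha>" using True by (auto simp: not_less)
          moreover have "\<forall>i'\<in>?F. i' < b i" using Fb jb by (metis Suc_le_lessD insert_iff order_le_less_trans less_imp_le)
          ultimately show ?thesis using jb(3) b_le[OF plus(1)] by metis
        next
          case nmin: False
          then obtain u b' where ub: "\<forall>i\<in>F. i < j \<longrightarrow> i < u" "u \<le> j" "\<forall>i\<in>F. i < b'" "b' \<le> K" "plus j u b' (W j)"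
            using W[OF jF] by blast
          obtain i' where "i' \<in> F" "i' < j" using nmin by force
          then have "i' < u" "\<alpha> < i'" using ub(1) Fb[of i'] by auto
          moreover have "\<alpha> < b'" using ub(3) jF Fb[OF jF] by fastforce
          ultimately have "\<forall>i\<in>?F. i < j \<longrightarrow> i < u" "\<forall>i\<in>?F. i < b'" using ub by auto
          then show ?thesis using ub by metis
        qed
        moreover have "W j \<subseteq> Z j" using W[OF jF] Z'[of j] Fb[OF jF] by auto
        ultimately show ?thesis using W[OF jF] False by simp
      qed
      then have "\<forall>j\<in>?F. ?W j \<subseteq> Z j \<and> e \<le> card (?W j) \<and>
        ((\<forall>i\<in>?F. j \<le> i) \<or> (\<exists>u b. (\<forall>i\<in>?F. i < j \<longrightarrow> i < u) \<and> u \<le> j \<and> (\<forall>i\<in>?F. i < b) \<and> b \<le> K \<and> plus j u b (?W j)))"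
        by (rule ballI)
      then show ?thesis by (intro disjI2 exI[of _ ?F] exI[of _ ?W] conjI J cF)
    qed (rule disjI1)
  qed
qed

section \<open>Abstract orientations of points in space\<close>

text \<open>The sign of \<open>ori a b c d\<close> tells on which side of the plane through \<open>a\<close>, \<open>b\<close>, \<open>c\<close> the point \<open>d\<close> lies.
  Reversing all signs preserves the axioms, so one may normalise the sign of a homogeneous family.\<close>
locale chirotope =
  fixes ori :: "'p \<Rightarrow> 'p \<Rightarrow> 'p \<Rightarrow> 'p \<Rightarrow> real"
  assumes swap12: "ori b a c d = - ori a b c d"
    and swap23: "ori a c b d = - ori a b c d"
    and swap34: "ori a b d c = - ori a b c d"
    and grassmann_pluecker:
      "ori a b c d * ori a b e f - ori a b c e * ori a b d f + ori a b c f * ori a b d e = 0"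
begin

lemma ori_self34 [simp]: "ori a b c c = 0"
  using swap34[of a b c c] by simp

lemma cycle234: "ori a b c d = ori a c d b"
  using swap34[of a c b d] swap23[of a b c d] by simp

lemma cycle234': "ori a b c d = ori a d b c"
  using cycle234[of a d b c] by simp

section \<open>Angular orders about an axis\<close>

definition axis_less :: "'p \<Rightarrow> 'p \<Rightarrow> 'p \<Rightarrow> 'p \<Rightarrow> bool" where
  "axis_less a b y z \<longleftrightarrow> ori a b y z > 0"

text \<open>The points lie strictly on one side of the plane through \<open>a\<close>,
  \<open>b\<close>, \<open>r\<close>, so they span less than a half-turn about the line
  \<open>a b\<close>. Divided by \<open>ori a b r z\<close>, the three-term relation exhibits
  \<open>ori a b y w\<close> as a positive combination of the two given signs.\<close>

lemma axis_less_trans: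
  assumes r: "ori a b r y * ori a b r z > 0" "ori a b r z * ori a b r w > 0"
    and "axis_less a b y z" "axis_less a b z w"
  shows "axis_less a b y w"
proof -
  have eq: "ori a b r z * ori a b y w = ori a b r y * ori a b z w + ori a b r w * ori a b y z"
    using grassmann_pluecker[of a b r y z w] by simp
  show ?thesis
  proof (cases "ori a b r z > 0")
    case True
    then have "ori a b r y > 0" "ori a b r w > 0" using r by (auto simp: zero_less_mult_iff)
    then have "ori a b r z * ori a b y w > 0"
      unfolding eq using assms(3,4) by (auto simp: axis_less_def intro: add_pos_pos)
    then show ?thesis using True by (simp add: axis_less_def zero_less_mult_iff)
  next
    case False
    then have *: "ori a b r z < 0" "ori a b r y < 0" "ori a b r w < 0" using r by (auto simp: zero_less_mult_iff)
    then have "ori a b r z * ori a b y w < 0"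
      unfolding eq using assms(3,4) by (auto simp: axis_less_def intro!: add_neg_neg mult_neg_pos)
    then show ?thesis using * by (simp add: axis_less_def mult_less_0_iff)
  qed
qed

definition strict_axis_order :: "'p \<Rightarrow> 'p \<Rightarrow> 'p set \<Rightarrow> bool" where
  "strict_axis_order a b Z \<longleftrightarrow> transp_on Z (axis_less a b) \<and> totalp_on Z (axis_less a b)"

lemma strict_axis_order_subset:
  "strict_axis_order a b Z \<Longrightarrow> Z' \<subseteq> Z \<Longrightarrow> strict_axis_order a b Z'"
  unfolding strict_axis_order_def using transp_on_subset totalp_on_subset by blast

lemma axis_less_asym: "asymp_on Z (axis_less a b)"
  unfolding asymp_on_def axis_less_def
proof (intro ballI impI)
  show "\<not> 0 < ori a b z y" if "0 < ori a b y z" for y z using swap34[of a b z y] that by simp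
qed

lemma strict_axis_orderI:
  assumes "\<And>y z. y \<in> Z \<Longrightarrow> z \<in> Z \<Longrightarrow> ori a b r y * ori a b r z > 0"
    and "\<And>y z. y \<in> Z \<Longrightarrow> z \<in> Z \<Longrightarrow> y \<noteq> z \<Longrightarrow> ori a b y z \<noteq> 0"
  shows "strict_axis_order a b Z"
proof -
  have "transp_on Z (axis_less a b)"
    using axis_less_trans assms(1) unfolding transp_on_def by metis
  moreover have "totalp_on Z (axis_less a b)"
    unfolding totalp_on_def axis_less_def
  proof (intro ballI impI)
    show "0 < ori a b y z \<or> 0 < ori a b z y" if "y \<in> Z" "z \<in> Z" "y \<noteq> z" for y z
      using swap34[of a b z y] assms(2)[OF that] by auto
  qed
  ultimately show ?thesis by (simp add: strict_axis_order_def)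
qed

text \<open>The intersection of the two total orders is a partial order: its chains are the sets on
  which they agree, its antichains those on which they are opposite.\<close>

lemma axis_orders_split:
  assumes "finite Z" "s * t \<le> card Z" "strict_axis_order a b Z" "strict_axis_order c d Z"
  shows "(\<exists>Z'\<subseteq>Z. card Z' = s \<and> (\<forall>y\<in>Z'. \<forall>z\<in>Z'. y \<noteq> z \<longrightarrow> ori a b y z * ori c d y z > 0)) \<or>
         (\<exists>Z'\<subseteq>Z. card Z' = t \<and> (\<forall>y\<in>Z'. \<forall>z\<in>Z'. y \<noteq> z \<longrightarrow> ori a b y z * ori c d y z < 0))"
proof -
  let ?P = "\<lambda>y z. axis_less a b y z \<and> axis_less c d y z"
  have tr: "transp_on Z ?P"
    using assms(3,4) unfolding strict_axis_order_def transp_on_def by blast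
  have asy: "asymp_on Z ?P"
    using axis_less_asym[of Z a b] unfolding asymp_on_def by blast
  have pos: "ori a b y z * ori c d y z > 0" if "?P y z \<or> ?P z y" for y z
    using that swap34[of a b y z] swap34[of c d y z] by (auto simp: axis_less_def zero_less_mult_iff)
  have neg: "ori a b y z * ori c d y z < 0" if "\<not> ?P y z" "\<not> ?P z y" "y \<in> Z" "z \<in> Z" "y \<noteq> z" for y z
  proof -
    have "axis_less a b y z \<or> axis_less a b z y" "axis_less c d y z \<or> axis_less c d z y"
      using assms(3,4) that(3-5) unfolding strict_axis_order_def totalp_on_def by blast+
    then show ?thesis using that(1,2) swap34[of a b y z] swap34[of c d y z]
      by (auto simp: axis_less_def mult_less_0_iff)
  qed
  from chain_or_antichain[OF assms(1,2) tr asy] show ?thesis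
  proof
    assume "\<exists>C\<subseteq>Z. card C = s \<and> (\<forall>x\<in>C. \<forall>y\<in>C. x \<noteq> y \<longrightarrow> ?P x y \<or> ?P y x)"
    then show ?thesis using pos by blast
  next
    assume "\<exists>C\<subseteq>Z. card C = t \<and> (\<forall>x\<in>C. \<forall>y\<in>C. \<not> ?P x y)"
    then obtain C where "C\<subseteq>Z" "card C = t" "\<forall>x\<in>C. \<forall>y\<in>C. \<not> ?P x y" by blast
    then show ?thesis using neg by (intro disjI2 exI[of _ C]) blast
  qed
qed

text \<open>Seen from \<open>q\<close>, with \<open>r\<close> sent to infinity, the axis order is
  the order by abscissa and the sign of a triple tells cups from caps. Both claims are three-term
  relations about the lines \<open>q b\<close> and \<open>q c\<close>, with positive
  coefficients.\<close>

lemma triples_transitive: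
  assumes ord: "axis_less q r a b" "axis_less q r b c" "axis_less q r c d" "axis_less q r b d" "axis_less q r a c"
    and s: "s = 1 \<or> s = -1" and pos: "s * ori q a b c > 0" "s * ori q b c d > 0"
  shows "s * ori q a b d > 0" "s * ori q a c d > 0"
proof -
  have 1: "ori q b r a * ori q b c d = ori q b r c * ori q b a d - ori q b r d * ori q b a c"
    using grassmann_pluecker[of q b r a c d] by simp
  have e: "ori q b r a = ori q r a b" "ori q b r c = - ori q r b c" "ori q b r d = - ori q r b d"
    "ori q b a d = - ori q a b d" "ori q b a c = - ori q a b c"
    by (rule cycle234'[symmetric] swap23)+
  have "ori q r b c * (s * ori q a b d) = ori q r a b * (s * ori q b c d) + ori q r b d * (s * ori q a b c)"
    using arg_cong[OF 1, of "(*) s"] unfolding e by (simp add: algebra_simps)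
  also have "\<dots> > 0" using ord pos by (auto simp: axis_less_def intro!: add_pos_pos mult_pos_pos)
  finally show "s * ori q a b d > 0" using ord by (simp add: axis_less_def zero_less_mult_iff)
  have 2: "ori q c r a * ori q c b d = ori q c r b * ori q c a d - ori q c r d * ori q c a b"
    using grassmann_pluecker[of q c r a b d] by simp
  have e: "ori q c r a = ori q r a c" "ori q c r b = ori q r b c" "ori q c r d = - ori q r c d"
    "ori q c b d = - ori q b c d" "ori q c a d = - ori q a c d" "ori q c a b = ori q a b c"
    by (rule cycle234'[symmetric] swap23)+
  have "ori q r b c * (s * ori q a c d) = ori q r a c * (s * ori q b c d) + ori q r c d * (s * ori q a b c)"
    using arg_cong[OF 2, of "(*) s"] unfolding e by (simp add: algebra_simps)
  also have "\<dots> > 0" using ord pos by (auto simp: axis_less_def intro!: add_pos_pos mult_pos_pos)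
  finally show "s * ori q a c d > 0" using ord by (simp add: axis_less_def zero_less_mult_iff)
qed

text \<open>In the projection from \<open>q\<close>, the points \<open>y 0, \<dots>, y (N - 1)\<close> form a convex chain bulging away
  from \<open>r\<close> if \<open>s = 1\<close>, and towards \<open>r\<close> if \<open>s = -1\<close>.\<close>
definition bulge :: "real \<Rightarrow> 'p \<Rightarrow> 'p \<Rightarrow> 'p set \<Rightarrow> (nat \<Rightarrow> 'p) \<Rightarrow> nat \<Rightarrow> bool" where
  "bulge s q r Z y N \<longleftrightarrow> (\<forall>i<N. y i \<in> Z) \<and> (\<forall>i j. i < j \<longrightarrow> j < N \<longrightarrow> axis_less q r (y i) (y j)) \<and>
     (\<forall>i j k. i < j \<longrightarrow> j < k \<longrightarrow> k < N \<longrightarrow> s * ori q (y i) (y j) (y k) > 0)"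

lemma bulge_exists:
  assumes fin: "finite Z" and ord: "strict_axis_order q r Z"
    and nz: "\<And>x y z. x \<in> Z \<Longrightarrow> y \<in> Z \<Longrightarrow> z \<in> Z \<Longrightarrow> x \<noteq> y \<Longrightarrow> y \<noteq> z \<Longrightarrow> x \<noteq> z \<Longrightarrow> ori q x y z \<noteq> 0"
    and card: "(k + l) choose k < card Z"
  shows "(\<exists>y. bulge (-1) q r Z y (k + 2)) \<or> (\<exists>y. bulge 1 q r Z y (l + 2))"
proof -
  obtain e where e: "bij_betw e {..<card Z} Z" "\<And>i j. i < j \<Longrightarrow> j < card Z \<Longrightarrow> axis_less q r (e i) (e j)"
    using finite_strict_total_enumeration[OF fin _ axis_less_asym[of Z q r]] ord
    unfolding strict_axis_order_def by blast
  define P where "P i j k \<longleftrightarrow> ori q (e i) (e j) (e k) < 0" for i j k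
  let ?S = "{..<card Z}"
  have nzS: "ori q (e i) (e j) (e k) \<noteq> 0" if "i < j" "j < k" "k < card Z" for i j k
  proof (rule nz)
    have "i \<in> ?S" "j \<in> ?S" "k \<in> ?S" "i \<noteq> j" "j \<noteq> k" "i \<noteq> k" using that by auto
    then show "e i \<in> Z" "e j \<in> Z" "e k \<in> Z" "e i \<noteq> e j" "e j \<noteq> e k" "e i \<noteq> e k"
      using e(1) unfolding bij_betw_def inj_on_def by blast+
  qed
  have T: "s * ori q (e a) (e b) (e d) > 0 \<and> s * ori q (e a) (e c) (e d) > 0"
    if "a < b" "b < c" "c < d" "d < card Z" "s = 1 \<or> s = -1"
      "s * ori q (e a) (e b) (e c) > 0" "s * ori q (e b) (e c) (e d) > 0" for a b c d s
    by (intro conjI triples_transitive[of q r "e a" "e b" "e c" "e d" s]) (use e(2) that in auto)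
  have tP: "transitive_triples P ?S" unfolding transitive_triples_def P_def
  proof (intro ballI impI)
    show "ori q (e a) (e b) (e d) < 0 \<and> ori q (e a) (e c) (e d) < 0"
      if "d \<in> ?S" "a < b" "b < c" "c < d" "ori q (e a) (e b) (e c) < 0" "ori q (e b) (e c) (e d) < 0" for a b c d
      using T[of a b c d "-1"] that by simp
  qed
  have nP: "(\<not> P i j k) = (ori q (e i) (e j) (e k) > 0)" if "i < j" "j < k" "k < card Z" for i j k
    using nzS[OF that] by (auto simp: P_def)
  have tQ: "transitive_triples (\<lambda>a b c. \<not> P a b c) ?S" unfolding transitive_triples_def
  proof (intro ballI impI)
    show "\<not> P a b d \<and> \<not> P a c d"
      if "d \<in> ?S" "a < b" "b < c" "c < d" "\<not> P a b c" "\<not> P b c d" for a b c d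
      using T[of a b c d 1] that by (simp add: nP)
  qed
  have *: "\<exists>y. bulge s q r Z y N" if C: "C \<subseteq> ?S" "card C = N" "monochromatic_triples Q C"
    and Q: "\<And>i j k. i < j \<Longrightarrow> j < k \<Longrightarrow> k < card Z \<Longrightarrow> Q i j k \<Longrightarrow> s * ori q (e i) (e j) (e k) > 0"
    for C N s Q
  proof -
    have finC: "finite C" using C finite_subset by blast
    define f where "f = enumerate C"
    have f: "f i \<in> C" if "i < N" for i unfolding f_def using that C finC by (simp add: finite_enumerate_in_set)
    have fm: "f i < f j" if "i < j" "j < N" for i j
      unfolding f_def using that C finC by (simp add: finite_enumerate_mono)
    have fS: "f i < card Z" if "i < N" for i using f[OF that] C by auto
    have "bulge s q r Z (\<lambda>i. e (f i)) N"
      unfolding bulge_def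
    proof (intro conjI allI impI)
      show "e (f i) \<in> Z" if "i < N" for i using fS[OF that] e(1) by (auto simp: bij_betw_def)
      show "axis_less q r (e (f i)) (e (f j))" if "i < j" "j < N" for i j
        using e(2) fm fS that by simp
      show "0 < s * ori q (e (f i)) (e (f j)) (e (f k))" if "i < j" "j < k" "k < N" for i j k
        using that fm fS f C(3) by (intro Q) (auto simp: monochromatic_triples_def)
    qed
    then show ?thesis by blast
  qed
  have "(\<exists>C\<subseteq>?S. card C = k + 2 \<and> monochromatic_triples P C) \<or>
         (\<exists>C\<subseteq>?S. card C = l + 2 \<and> monochromatic_triples (\<lambda>a b c. \<not> P a b c) C)"
    using cups_caps[OF _ tP tQ] card by simp
  then show ?thesis
  proof
    assume "\<exists>C\<subseteq>?S. card C = k + 2 \<and> monochromatic_triples P C"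
    then obtain C where "C \<subseteq> ?S" "card C = k + 2" "monochromatic_triples P C" by blast
    from *[OF this, of "-1"] show ?thesis by (auto simp: P_def)
  next
    assume "\<exists>C\<subseteq>?S. card C = l + 2 \<and> monochromatic_triples (\<lambda>a b c. \<not> P a b c) C"
    then obtain C where "C \<subseteq> ?S" "card C = l + 2" "monochromatic_triples (\<lambda>a b c. \<not> P a b c) C" by blast
    from *[OF this, of "1"] show ?thesis by (auto simp: nP)
  qed
qed

text \<open>Strict signs keep every \<open>v j\<close> apart from all supporting points
  \<open>a i\<close>, \<open>b i\<close>, \<open>c i\<close>, so that later the supports can be
  frozen while the \<open>v j\<close> move. Taking the supports from \<open>X\<close> lets finitely
  many indices describe a whole configuration.\<close>

definition cut_off_points :: "'p set \<Rightarrow> nat \<Rightarrow> bool" where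
  "cut_off_points X n \<longleftrightarrow> (\<exists>v a b c. \<forall>i<n. v i \<in> X \<and> a i \<in> X \<and> b i \<in> X \<and> c i \<in> X \<and>
     ori (a i) (b i) (c i) (v i) > 0 \<and> (\<forall>j<n. j \<noteq> i \<longrightarrow> ori (a i) (b i) (c i) (v j) < 0))"

lemma cut_off_pointsI:
  assumes I: "finite I" "n \<le> card I"
    and v: "\<And>i. i \<in> I \<Longrightarrow> v i \<in> X \<and> a i \<in> X \<and> b i \<in> X \<and> c i \<in> X \<and> ori (a i) (b i) (c i) (v i) > 0"
    and w: "\<And>i j. i \<in> I \<Longrightarrow> j \<in> I \<Longrightarrow> j \<noteq> i \<Longrightarrow> ori (a i) (b i) (c i) (v j) < 0"
  shows "cut_off_points X n"
proof -
  obtain f where f: "bij_betw f {..<card I} I"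
    using ex_bij_betw_nat_finite[OF I(1)] by (auto simp: atLeast0LessThan)
  have fI: "f i \<in> I" if "i < n" for i using f that I(2) by (auto simp: bij_betw_def)
  have inj: "f i \<noteq> f j" if "i < n" "j < n" "i \<noteq> j" for i j
    using f that I(2) by (auto simp: bij_betw_def inj_on_def)
  have "\<forall>i<n. v (f i) \<in> X \<and> a (f i) \<in> X \<and> b (f i) \<in> X \<and> c (f i) \<in> X \<and>
     ori (a (f i)) (b (f i)) (c (f i)) (v (f i)) > 0 \<and>
     (\<forall>j<n. j \<noteq> i \<longrightarrow> ori (a (f i)) (b (f i)) (c (f i)) (v (f j)) < 0)"
    using v[OF fI] w[OF fI fI] inj by simp
  then show ?thesis unfolding cut_off_points_def by (intro exI)
qed

text \<open>In a convex chain, the line through two vertices that enclose a single third one cuts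
  off just that one. Odd vertices are cut off and even ones are supports, so \<open>l\<close> cut
  off points cost about \<open>2 * l\<close> chain points.\<close>

lemma bulge_cuts:
  assumes b: "bulge s q r Z y N" and i: "2 * i + 2 < N" and s: "s = 1 \<or> s = -1"
  shows "s * ori q (y (2*i+2)) (y (2*i)) (y (2*i+1)) > 0"
    and "2 * j + 2 < N \<Longrightarrow> j \<noteq> i \<Longrightarrow> s * ori q (y (2*i+2)) (y (2*i)) (y (2*j+1)) < 0"
proof -
  have tri: "s * ori q (y i) (y j) (y k) > 0" if "i < j" "j < k" "k < N" for i j k
    using b that by (auto simp: bulge_def)
  have "s * ori q (y (2*i)) (y (2*i+1)) (y (2*i+2)) > 0" using tri i by simp
  then show "s * ori q (y (2*i+2)) (y (2*i)) (y (2*i+1)) > 0"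
    using cycle234'[of q "y (2*i)" "y (2*i+1)" "y (2*i+2)"] by simp
  assume j: "2 * j + 2 < N" "j \<noteq> i"
  show "s * ori q (y (2*i+2)) (y (2*i)) (y (2*j+1)) < 0"
  proof (cases "j < i")
    case True
    then have "s * ori q (y (2*j+1)) (y (2*i)) (y (2*i+2)) > 0" using tri i by simp
    moreover have "ori q (y (2*i+2)) (y (2*i)) (y (2*j+1)) = - ori q (y (2*j+1)) (y (2*i)) (y (2*i+2))"
      using swap23[of q "y (2*i)" "y (2*i+2)" "y (2*j+1)"] cycle234'[of q "y (2*i)" "y (2*i+2)" "y (2*j+1)"] by simp
    ultimately show ?thesis by simp
  next
    case False
    then have "s * ori q (y (2*i)) (y (2*i+2)) (y (2*j+1)) > 0" using tri i j by simp
    then show ?thesis using swap23[of q "y (2*i)" "y (2*i+2)" "y (2*j+1)"] by simp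
  qed
qed

lemma bulge_neg_cut_off_points:
  assumes b: "bulge (-1) q r Z y (2 * n + 1)" and "Z \<subseteq> X" "q \<in> X"
  shows "cut_off_points X n"
proof (rule cut_off_pointsI[where I = "{..<n}"])
  have y: "y i \<in> X" if "i < 2 * n + 1" for i using b that assms(2) by (auto simp: bulge_def)
  fix i assume i: "i \<in> {..<n}"
  have e: "ori q (y (2*i)) (y (2*i+2)) z = - ori q (y (2*i+2)) (y (2*i)) z" for z
    by (rule swap23)
  show "y (2*i+1) \<in> X \<and> q \<in> X \<and> y (2*i) \<in> X \<and> y (2*i+2) \<in> X \<and> ori q (y (2*i)) (y (2*i+2)) (y (2*i+1)) > 0"
    using bulge_cuts(1)[OF b, of i] i y assms(3) unfolding e by auto
  fix j assume "j \<in> {..<n}" "j \<noteq> i"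
  then show "ori q (y (2*i)) (y (2*i+2)) (y (2*j+1)) < 0"
    using bulge_cuts(2)[OF b, of i j] i unfolding e by auto
qed auto

text \<open>Seen from \<open>q\<close>, every line through two points of \<open>Z\<close> leaves \<open>r\<close> and all of \<open>U\<close> on the same side.\<close>
definition sees_one_sided :: "'p set \<Rightarrow> 'p \<Rightarrow> 'p \<Rightarrow> 'p set \<Rightarrow> 'p set \<Rightarrow> bool" where
  "sees_one_sided X q r Z U \<longleftrightarrow> q \<in> X \<and> strict_axis_order q r Z \<and>
     (\<forall>x\<in>Z. \<forall>y\<in>Z. \<forall>z\<in>Z. x \<noteq> y \<longrightarrow> y \<noteq> z \<longrightarrow> x \<noteq> z \<longrightarrow> ori q x y z \<noteq> 0) \<and>
     (\<forall>y\<in>Z. \<forall>z\<in>Z. axis_less q r y z \<longrightarrow> (\<forall>x\<in>U. ori q x y z > 0))"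

lemma sees_one_sidedD:
  "sees_one_sided X q r Z U \<Longrightarrow> y \<in> Z \<Longrightarrow> z \<in> Z \<Longrightarrow> axis_less q r y z \<Longrightarrow> x \<in> U \<Longrightarrow> ori q x y z > 0"
  by (simp add: sees_one_sided_def)

lemma sees_one_sided_mono: "sees_one_sided X q r Z U \<Longrightarrow> V \<subseteq> U \<Longrightarrow> sees_one_sided X q r Z V"
  by (auto simp: sees_one_sided_def)

text \<open>A long chain bulging towards \<open>r\<close> suffices alone. Otherwise every cluster
  has a chain bulging away, and its cutting lines leave all other clusters on the side opposite to
  the cut off vertex. The binomial coefficient is unbalanced because a chain of the first kind must
  have length about \<open>2 * n\<close>, one of the second only about \<open>2 * l\<close>.\<close>

lemma combine_bulges:
  assumes F: "finite F" "n \<le> card F * l"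
    and Z: "\<And>j. j \<in> F \<Longrightarrow> Z j \<subseteq> X \<and> finite (Z j) \<and> (2 * n + 2 * l choose (2 * l)) < card (Z j) \<and>
       (\<exists>q r. sees_one_sided X q r (Z j) (\<Union>i\<in>F - {j}. Z i))"
  shows "cut_off_points X n"
proof (cases "\<exists>j\<in>F. \<exists>q r y. q \<in> X \<and> bulge (-1) q r (Z j) y (2 * n + 2)")
  case True
  then obtain j q r y where j: "j \<in> F" "q \<in> X" "bulge (-1) q r (Z j) y (2 * n + 2)" by blast
  then have "bulge (-1) q r (Z j) y (2 * n + 1)" by (auto simp: bulge_def)
  then show ?thesis using bulge_neg_cut_off_points j Z by blast
next
  case False
  have "\<exists>q r y. sees_one_sided X q r (Z j) (\<Union>i\<in>F - {j}. Z i) \<and> bulge 1 q r (Z j) y (2 * l + 2)"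
    if j: "j \<in> F" for j
  proof -
    obtain q r where qr: "sees_one_sided X q r (Z j) (\<Union>i\<in>F - {j}. Z i)" using Z[OF j] by blast
    have "(2 * n + 2 * l choose (2 * n)) = (2 * n + 2 * l choose (2 * l))"
      by (subst binomial_symmetric) auto
    then have "(\<exists>y. bulge (-1) q r (Z j) y (2 * n + 2)) \<or> (\<exists>y. bulge 1 q r (Z j) y (2 * l + 2))"
      using Z[OF j] qr unfolding sees_one_sided_def by (intro bulge_exists) auto
    moreover have "q \<in> X" using qr by (simp add: sees_one_sided_def)
    ultimately obtain y where "bulge 1 q r (Z j) y (2 * l + 2)" using False j by blast
    then show ?thesis using qr by blast
  qed
  then obtain q r y where qry: "\<And>j. j \<in> F \<Longrightarrow> sees_one_sided X (q j) (r j) (Z j) (\<Union>i\<in>F - {j}. Z i) \<and>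
      bulge 1 (q j) (r j) (Z j) (y j) (2 * l + 2)" by metis
  show ?thesis
  proof (rule cut_off_pointsI[where I = "F \<times> {..<l}"])
    show "finite (F \<times> {..<l})" "n \<le> card (F \<times> {..<l})" using F by auto
    let ?v = "\<lambda>(j,i). y j (2*i+1)" and ?a = "\<lambda>(j,i). q j" and ?b = "\<lambda>(j,i). y j (2*i+2)"
      and ?c = "\<lambda>(j,i). y j (2*i)"
    fix p assume p: "p \<in> F \<times> {..<l}"
    obtain j i where ji: "p = (j,i)" "j \<in> F" "i < l" using p by auto
    have yZ: "y j' i' \<in> Z j'" if "j' \<in> F" "i' < 2*l+2" for i' j'
      using qry[OF that(1)] that by (auto simp: bulge_def)
    have b: "bulge 1 (q j) (r j) (Z j) (y j) (2 * l + 2)" using qry ji by blast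
    show "?v p \<in> X \<and> ?a p \<in> X \<and> ?b p \<in> X \<and> ?c p \<in> X \<and> ori (?a p) (?b p) (?c p) (?v p) > 0"
      using yZ[OF ji(2)] Z[OF ji(2)] qry[OF ji(2)] ji bulge_cuts(1)[OF b, of i]
      by (auto simp: sees_one_sided_def)
    fix p' assume p': "p' \<in> F \<times> {..<l}" "p' \<noteq> p"
    obtain j' i' where ji': "p' = (j',i')" "j' \<in> F" "i' < l" using p' by auto
    show "ori (?a p) (?b p) (?c p) (?v p') < 0"
    proof (cases "j' = j")
      case True
      then show ?thesis using bulge_cuts(2)[OF b, of i i'] ji ji' p' by auto
    next
      case False
      have 1: "axis_less (q j) (r j) (y j (2*i)) (y j (2*i+2))" using b ji by (simp add: bulge_def)
      have "y j' (2*i'+1) \<in> Z j'" using yZ ji' by simp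
      then have 2: "y j' (2*i'+1) \<in> (\<Union>i\<in>F - {j}. Z i)" using ji'(2) False by blast
      have 3: "y j (2*i) \<in> Z j" "y j (2*i+2) \<in> Z j" using yZ ji by simp_all
      have "ori (q j) (y j' (2*i'+1)) (y j (2*i)) (y j (2*i+2)) > 0"
        using sees_one_sidedD[OF conjunct1[OF qry[OF ji(2)]] 3 1 2] .
      moreover have "ori (q j) (y j (2*i+2)) (y j (2*i)) (y j' (2*i'+1)) =
          - ori (q j) (y j' (2*i'+1)) (y j (2*i)) (y j (2*i+2))"
        using swap23[of "q j" "y j (2*i)" "y j (2*i+2)" "y j' (2*i'+1)"]
          cycle234'[of "q j" "y j (2*i)" "y j (2*i+2)" "y j' (2*i'+1)"] by simp
      ultimately show ?thesis using ji ji' by simp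
    qed
  qed
qed

end

section \<open>Clusters along the moment curve\<close>

text \<open>The sign of the Vandermonde determinant, that is, the orientation of the points with
  parameters \<open>a\<close>, \<open>b\<close>, \<open>c\<close>, \<open>d\<close> on the moment
  curve \<open>(t, t^2, t^3)\<close>.\<close>

definition position_sign :: "nat \<Rightarrow> nat \<Rightarrow> nat \<Rightarrow> nat \<Rightarrow> real" where
  "position_sign a b c d = sgn (real b - real a) * sgn (real c - real a) * sgn (real d - real a) *
     sgn (real c - real b) * sgn (real d - real b) * sgn (real d - real c)"

lemma sgn_diff_less [simp]: "a < b \<Longrightarrow> sgn (real b - real a) = 1" "b < a \<Longrightarrow> sgn (real b - real a) = -1"
  by auto

lemma sgn_diff_Suc: "a \<noteq> t \<Longrightarrow> a \<noteq> Suc t \<Longrightarrow> sgn (real (Suc t) - real a) = sgn (real t - real a)"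
  by (cases "a < t") auto

lemma sgn_diff_commute: "sgn (real a - real b) = - sgn (real b - real a)"
  by (simp flip: sgn_minus)

lemma position_sign_swap:
  "position_sign b a c d = - position_sign a b c d"
  "position_sign a c b d = - position_sign a b c d"
  "position_sign a b d c = - position_sign a b c d"
  by (simp_all add: position_sign_def sgn_diff_commute[of a b] sgn_diff_commute[of b c] sgn_diff_commute[of c d])

lemma position_sign_sorted: "a < b \<Longrightarrow> b < c \<Longrightarrow> c < d \<Longrightarrow> position_sign a b c d = 1"
  by (simp add: position_sign_def)

text \<open>The three equal signs say that, among the planes through the line from \<open>m\<close>
  to \<open>j\<close>, position \<open>t\<close> lies in the sector between \<open>u\<close> and
  \<open>w\<close>. The next lemma is the counterpart for the line from \<open>u\<close> to
  \<open>j\<close> and the sector between \<open>m\<close> and \<open>M\<close>.\<close>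

lemma position_sign_left:
  assumes "m < u" "u < j" "j < w" "m < t \<and> t < u \<or> w < t"
  shows "position_sign m j u t = position_sign m j u w \<and> position_sign m j t w = position_sign m j u w"
  using assms(4)
proof
  assume "m < t \<and> t < u"
  then show ?thesis using assms(1-3) by (simp add: position_sign_def)
next
  assume "w < t"
  then show ?thesis using assms(1-3) by (simp add: position_sign_def)
qed

lemma position_sign_right:
  assumes "m < u" "u < j" "j < M" "m < t \<and> t < u \<or> j < t \<and> t < M"
  shows "position_sign u j m t = position_sign u j m M \<and> position_sign u j t M = position_sign u j m M"
  using assms(4)
proof
  assume "m < t \<and> t < u"
  then show ?thesis using assms(1-3) by (simp add: position_sign_def)
next
  assume "j < t \<and> t < M"
  then show ?thesis using assms(1-3) by (simp add: position_sign_def)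
qed

text \<open>Interpolation: \<open>xr / lr\<close> and \<open>lx / lr\<close> are the positive
  coefficients that express \<open>x\<close> by \<open>l\<close> and \<open>r\<close>, so
  \<open>x\<close> compares with \<open>y\<close> as both \<open>l\<close> and \<open>r\<close>
  do.\<close>

lemma pluecker_sign:
  fixes lr :: real
  assumes "lr * xy = lx * ry + ly * xr" "lr \<noteq> 0" "sgn lx = sgn lr" "sgn xr = sgn lr" "sgn ry = sgn ly"
  shows "sgn xy = sgn ly"
proof -
  have lx: "lx / lr > 0" and xr: "xr / lr > 0"
    using assms(2-4) by (auto simp: sgn_if zero_less_divide_iff split: if_splits)
  have xy: "xy = (lx / lr) * ry + (xr / lr) * ly" using assms(1,2) by (simp add: field_simps)
  consider "ly > 0" "ry > 0" | "ly < 0" "ry < 0" | "ly = 0" "ry = 0"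
    using assms(5) by (auto simp: sgn_if split: if_splits)
  then show ?thesis
  proof cases
    case 1
    then have "xy > 0" unfolding xy using lx xr by (intro add_pos_pos mult_pos_pos)
    then show ?thesis using 1 by simp
  next
    case 2
    then have "xy < 0" unfolding xy using lx xr by (intro add_neg_neg mult_pos_neg)
    then show ?thesis using 2 by simp
  next
    case 3
    then show ?thesis by (simp add: xy)
  qed
qed

context chirotope
begin

text \<open>Both sides are alternating, so it suffices to sort: starting from a sorted pair, the
  third and then the fourth position is inserted by adjacent swaps.\<close>

lemma sorted_positive_imp_sgn:
  assumes sorted: "\<And>a b c d. a \<in> S \<Longrightarrow> b \<in> S \<Longrightarrow> c \<in> S \<Longrightarrow> d \<in> S \<Longrightarrow> a < b \<Longrightarrow> b < c \<Longrightarrow> c < d \<Longrightarrow>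
      ori (f a) (f b) (f c) (f d) > 0"
    and "a \<in> S" "b \<in> S" "c \<in> S" "d \<in> S" "distinct [a, b, c, d]"
  shows "sgn (ori (f a) (f b) (f c) (f d)) = position_sign a b c d"
proof -
  let ?G = "\<lambda>a b c d. sgn (ori (f a) (f b) (f c) (f d)) = position_sign a b c d"
  have s12: "?G a b c d" if "?G b a c d" for a b c d
    using that swap12[of "f a" "f b" "f c" "f d"] position_sign_swap(1)[of a b c d] by (simp add: sgn_minus)
  have s23: "?G a b c d" if "?G a c b d" for a b c d
    using that swap23[of "f a" "f b" "f c" "f d"] position_sign_swap(2)[of a b c d] by (simp add: sgn_minus)
  have s34: "?G a b c d" if "?G a b d c" for a b c d
    using that swap34[of "f a" "f b" "f c" "f d"] position_sign_swap(3)[of a b c d] by (simp add: sgn_minus)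
  have 0: "?G a b c d" if "a \<in> S" "b \<in> S" "c \<in> S" "d \<in> S" "a < b" "b < c" "c < d" for a b c d
    using sorted[OF that] position_sign_sorted that by simp
  have ins4: "?G a b c d" if t: "a \<in> S" "b \<in> S" "c \<in> S" "d \<in> S" "a < b" "b < c" "d \<notin> {a,b,c}" for a b c d
  proof -
    consider "d < a" | "a < d" "d < b" | "b < d" "d < c" | "c < d" using t(7) by fastforce
    then show ?thesis
    proof cases
      case 1
      then have "?G d a b c" using 0 t by blast
      then show ?thesis by (rule s34[OF s23[OF s12]])
    next
      case 2
      then have "?G a d b c" using 0 t by blast
      then show ?thesis by (rule s34[OF s23])
    next
      case 3
      then have "?G a b d c" using 0 t by blast
      then show ?thesis by (rule s34)
    next
      case 4
      then show ?thesis using 0 t by blast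
    qed
  qed
  have ins3: "?G a b c d" if t: "a \<in> S" "b \<in> S" "c \<in> S" "d \<in> S" "a < b" "c \<notin> {a,b}" "d \<notin> {a,b,c}" for a b c d
  proof -
    consider "c < a" | "a < c" "c < b" | "b < c" using t(6) by fastforce
    then show ?thesis
    proof cases
      case 1
      then have "?G c a b d" using ins4[of c a b d] t by auto
      then show ?thesis by (rule s23[OF s12])
    next
      case 2
      then have "?G a c b d" using ins4[of a c b d] t by auto
      then show ?thesis by (rule s23)
    next
      case 3
      then show ?thesis using ins4[of a b c d] t by auto
    qed
  qed
  show ?thesis
  proof (cases "a < b")
    case True
    then show ?thesis using ins3[of a b c d] assms(2-6) by auto
  next
    case False
    then have "?G b a c d" using ins3[of b a c d] assms(2-6) by auto
    then show ?thesis by (rule s12)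
  qed
qed

end

text \<open>The positions \<open>0, \<dots>, 4 * K\<close> carry points that are ordered like points on the moment curve:
  position \<open>4 * j + 2\<close> carries all points of the cluster \<open>C j\<close>, any other position \<open>t\<close> the single
  point \<open>p t\<close>. Only quadruples with at most one cluster point are assumed to be positive.\<close>
locale moment_clusters = chirotope ori
  for ori :: "'p \<Rightarrow> 'p \<Rightarrow> 'p \<Rightarrow> 'p \<Rightarrow> real" +
  fixes X :: "'p set" and K :: nat and p :: "nat \<Rightarrow> 'p" and C :: "nat \<Rightarrow> 'p set"
  assumes finite_X: "finite X"
    and ori_nonzero: "\<And>a b c d. {a, b, c, d} \<subseteq> X \<Longrightarrow> distinct [a, b, c, d] \<Longrightarrow> ori a b c d \<noteq> 0"
    and p_in_X: "\<And>t. t \<le> 4 * K \<Longrightarrow> t mod 4 \<noteq> 2 \<Longrightarrow> p t \<in> X"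
    and C_subset_X: "\<And>j. j < K \<Longrightarrow> C j \<subseteq> X"
    and positive: "\<And>j y a b c d. j < K \<Longrightarrow> y \<in> C j \<Longrightarrow> a < b \<Longrightarrow> b < c \<Longrightarrow> c < d \<Longrightarrow> d \<le> 4 * K \<Longrightarrow>
      \<forall>t\<in>{a, b, c, d}. t mod 4 = 2 \<longrightarrow> t = 4 * j + 2 \<Longrightarrow>
      0 < ori ((p(4 * j + 2 := y)) a) ((p(4 * j + 2 := y)) b) ((p(4 * j + 2 := y)) c) ((p(4 * j + 2 := y)) d)"
begin

text \<open>Residues 1 and 3 modulo 4 are the two private neighbours of a cluster; multiples of 4
  are walls before, between and behind the clusters and serve as ends of axes.\<close>

definition single :: "nat \<Rightarrow> bool" where
  "single t \<longleftrightarrow> t \<le> 4 * K \<and> t mod 4 \<noteq> 2"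

lemma single_neq_cluster: "single t \<Longrightarrow> t \<noteq> 4 * j + 2"
  unfolding single_def by presburger

lemma sgn_one_cluster:
  assumes "j < K" "y \<in> C j" "\<forall>t\<in>{a, b, c, d}. single t \<or> t = 4 * j + 2" "distinct [a, b, c, d]"
  shows "sgn (ori ((p(4 * j + 2 := y)) a) ((p(4 * j + 2 := y)) b) ((p(4 * j + 2 := y)) c) ((p(4 * j + 2 := y)) d))
    = position_sign a b c d"
proof (rule sorted_positive_imp_sgn[where S = "{t. single t \<or> t = 4 * j + 2}"])
  fix a b c d assume S: "a \<in> {t. single t \<or> t = 4 * j + 2}" "b \<in> {t. single t \<or> t = 4 * j + 2}"
    "c \<in> {t. single t \<or> t = 4 * j + 2}" "d \<in> {t. single t \<or> t = 4 * j + 2}" and lt: "a < b" "b < c" "c < d"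
  have "d \<le> 4 * K" using S(4) assms(1) by (auto simp: single_def)
  then show "0 < ori ((p(4 * j + 2 := y)) a) ((p(4 * j + 2 := y)) b) ((p(4 * j + 2 := y)) c) ((p(4 * j + 2 := y)) d)"
    using S by (intro positive assms lt) (auto simp: single_def)
qed (use assms in auto)

lemma sgn_cluster_second:
  assumes "j < K" "y \<in> C j" "single a" "single b" "single c" "distinct [a, b, c]"
  shows "sgn (ori (p a) y (p b) (p c)) = position_sign a (4 * j + 2) b c"
  using sgn_one_cluster[OF assms(1,2), of a "4*j+2" b c] assms(3-6) single_neq_cluster[of _ j] by auto

lemma sgn_cluster_third:
  assumes "j < K" "y \<in> C j" "single a" "single b" "single c" "distinct [a, b, c]"
  shows "sgn (ori (p a) (p b) y (p c)) = position_sign a b (4 * j + 2) c"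
  using sgn_one_cluster[OF assms(1,2), of a b "4*j+2" c] assms(3-6) single_neq_cluster[of _ j] by auto

lemma sgn_cluster_fourth:
  assumes "j < K" "y \<in> C j" "single a" "single b" "single c" "distinct [a, b, c]"
  shows "sgn (ori (p a) (p b) (p c) y) = position_sign a b c (4 * j + 2)"
  using sgn_one_cluster[OF assms(1,2), of a b c "4*j+2"] assms(3-6) single_neq_cluster[of _ j] by auto

lemma sgn_singles:
  assumes "0 < K" "C 0 \<noteq> {}" "single a" "single b" "single c" "single d" "distinct [a, b, c, d]"
  shows "sgn (ori (p a) (p b) (p c) (p d)) = position_sign a b c d"
proof -
  obtain y where "y \<in> C 0" using assms(2) by blast
  then show ?thesis
    using sgn_one_cluster[OF assms(1), of y a b c d] assms(3-7) single_neq_cluster[OF assms(3), of 0]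
      single_neq_cluster[OF assms(4), of 0] single_neq_cluster[OF assms(5), of 0]
      single_neq_cluster[OF assms(6), of 0] by simp
qed

lemma position_sign_nonzero: "distinct [a, b, c, d] \<Longrightarrow> position_sign a b c d \<noteq> 0"
  by (auto simp: position_sign_def sgn_zero_iff)

text \<open>The two single points adjacent to a cluster span a line that its points cross, so the sign of a
  quadruple with two cluster points is interpolated from those with one.\<close>
lemma sgn_two_clusters:
  assumes ij: "i < K" "j < K" "i \<noteq> j" "x \<in> C i" "y \<in> C j" and ne: "C 0 \<noteq> {}"
    and ab: "single a" "single b" "a \<noteq> b" "{a, b} \<inter> {4 * i + 1, 4 * i + 3} = {}"
  shows "sgn (ori (p a) y (p b) x) = position_sign a (4 * j + 2) b (4 * i + 2)"
    and "sgn (ori (p a) y x (p b)) = position_sign a (4 * j + 2) (4 * i + 2) b"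
proof -
  let ?l = "4 * i + 1" and ?r = "4 * i + 3" and ?t = "4 * i + 2" and ?s = "4 * j + 2"
  have sl: "single ?l" "single ?r" using ij by (simp_all add: single_def)
  have K: "0 < K" using ij by simp
  have d: "distinct [a, b, ?l]" "distinct [a, b, ?r]" "distinct [a, b, ?l, ?r]" "a \<noteq> ?t" "b \<noteq> ?t"
    using ab single_neq_cluster[OF ab(1), of i] single_neq_cluster[OF ab(2), of i] by auto
  \<comment> \<open>The three positions around cluster \<open>i\<close> are consecutive, so any
    other position compares alike with all of them.\<close>
  have sh: "sgn (real ?t - real e) = sgn (real ?l - real e)" "sgn (real ?r - real e) = sgn (real ?l - real e)"
    if "e \<noteq> ?l" "e \<noteq> ?t" "e \<noteq> ?r" for e
    using sgn_diff_Suc[of e ?l] sgn_diff_Suc[of e ?t] that by (simp_all add: numeral_eq_Suc)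
  have shs: "sgn (real ?t - real ?s) = sgn (real ?l - real ?s)" "sgn (real ?r - real ?s) = sgn (real ?l - real ?s)"
    using ij(3) by (intro sh; presburger)+
  have shs': "sgn (real ?s - real ?t) = sgn (real ?s - real ?l)" "sgn (real ?s - real ?r) = sgn (real ?s - real ?l)"
    using shs sgn_diff_commute by metis+
  have na: "a \<noteq> ?l" "a \<noteq> ?t" "a \<noteq> ?r" and nb: "b \<noteq> ?l" "b \<noteq> ?t" "b \<noteq> ?r" using d by simp_all
  note sha = sh[OF na] and shb = sh[OF nb]
  have lr: "sgn (ori (p a) (p b) (p ?l) (p ?r)) = position_sign a b ?l ?r"
    using sgn_singles[OF K ne] ab sl d by blast
  have "sgn (ori (p a) (p b) x y) = sgn (ori (p a) (p b) (p ?l) y)"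
  proof (rule pluecker_sign)
    show "ori (p a) (p b) (p ?l) (p ?r) * ori (p a) (p b) x y =
      ori (p a) (p b) (p ?l) x * ori (p a) (p b) (p ?r) y + ori (p a) (p b) (p ?l) y * ori (p a) (p b) x (p ?r)"
      using grassmann_pluecker[of "p a" "p b" "p ?l" "p ?r" x y] swap34[of "p a" "p b" x "p ?r"] by simp
    show "ori (p a) (p b) (p ?l) (p ?r) \<noteq> 0"
      using lr position_sign_nonzero[OF d(3)] by (metis sgn_0)
    show "sgn (ori (p a) (p b) (p ?l) x) = sgn (ori (p a) (p b) (p ?l) (p ?r))"
      unfolding lr sgn_cluster_fourth[OF ij(1,4) ab(1,2) sl(1) d(1)]
      using sha shb by (simp add: position_sign_def)
    show "sgn (ori (p a) (p b) x (p ?r)) = sgn (ori (p a) (p b) (p ?l) (p ?r))"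
      unfolding lr sgn_cluster_third[OF ij(1,4) ab(1,2) sl(2) d(2)]
      using sha shb by (simp add: position_sign_def)
    show "sgn (ori (p a) (p b) (p ?r) y) = sgn (ori (p a) (p b) (p ?l) y)"
      unfolding sgn_cluster_fourth[OF ij(2,5) ab(1,2) sl(1) d(1)] sgn_cluster_fourth[OF ij(2,5) ab(1,2) sl(2) d(2)]
      using sha shb shs' by (simp add: position_sign_def)
  qed
  also have "\<dots> = position_sign a b ?t ?s"
    unfolding sgn_cluster_fourth[OF ij(2,5) ab(1,2) sl(1) d(1)]
    using sha shb shs' by (simp add: position_sign_def)
  finally have *: "sgn (ori (p a) (p b) x y) = position_sign a b ?t ?s" .
  have "ori (p a) y (p b) x = ori (p a) (p b) x y" by (rule cycle234)
  moreover have "position_sign a ?s b ?t = position_sign a b ?t ?s"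
    using position_sign_swap(2)[of a ?s b ?t] position_sign_swap(3)[of a b ?s ?t] by simp
  ultimately show 1: "sgn (ori (p a) y (p b) x) = position_sign a ?s b ?t" using * by simp
  show "sgn (ori (p a) y x (p b)) = position_sign a ?s ?t b"
    using 1 swap34[of "p a" y x "p b"] position_sign_swap(3)[of a ?s ?t b] by (simp add: sgn_minus)
qed

text \<open>Otherwise a quadruple with a repeated point would have a non-zero sign.\<close>

lemma single_notin_cluster:
  assumes "j < K" "y \<in> C j" "single a"
  shows "p a \<noteq> y"
proof
  assume eq: "p a = y"
  obtain b c where bc: "single b" "single c" "distinct [a, b, c]"
  proof (cases "a \<in> {0, 1}")
    case True
    then show ?thesis using that[of 3 4] assms(1) by (auto simp: single_def)
  next
    case False
    then show ?thesis using that[of 0 1] assms(1) by (auto simp: single_def)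
  qed
  have "sgn (ori (p b) (p c) (p a) y) = position_sign b c a (4 * j + 2)"
    using sgn_cluster_fourth[OF assms(1,2) bc(1,2) assms(3)] bc(3) by auto
  moreover have "position_sign b c a (4 * j + 2) \<noteq> 0"
    using bc assms(3) single_neq_cluster by (intro position_sign_nonzero) auto
  ultimately show False using eq by simp
qed

lemma single_points_neq:
  assumes "0 < K" "C 0 \<noteq> {}" "single a" "single b" "a \<noteq> b"
  shows "p a \<noteq> p b"
proof
  assume eq: "p a = p b"
  obtain y where y: "y \<in> C 0" using assms by blast
  obtain c where c: "single c" "distinct [a, b, c]"
  proof (cases "0 \<in> {a, b}")
    case False
    then show ?thesis using that[of 0] assms(5) by (auto simp: single_def)
  next
    case True
    then show ?thesis
      using that[of 1] that[of 3] assms(1,5) by (cases "1 \<in> {a, b}") (auto simp: single_def)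
  qed
  have "sgn (ori (p c) y (p a) (p b)) = position_sign c (4 * 0 + 2) a b"
    using sgn_cluster_second[OF assms(1) y c(1) assms(3,4)] c(2) by auto
  moreover have "position_sign c (4 * 0 + 2) a b \<noteq> 0"
    using c assms(3-5) single_neq_cluster[of _ 0] by (intro position_sign_nonzero) force
  ultimately show False using eq by simp
qed

text \<open>A third single point serves as reference: the whole cluster lies on one side of the
  plane through it and the axis.\<close>

lemma strict_axis_order_cluster:
  assumes "j < K" "single a" "single b" "a \<noteq> b" "C 0 \<noteq> {}"
  shows "strict_axis_order (p a) (p b) (C j)"
proof -
  obtain c where c: "single c" "distinct [a, b, c]"
  proof (cases "0 \<in> {a, b}")
    case False
    then show ?thesis using that[of 0] assms(4) by (auto simp: single_def)
  next
    case True
    then show ?thesis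
      using that[of 1] that[of 3] assms(1,4) by (cases "1 \<in> {a, b}") (auto simp: single_def)
  qed
  show ?thesis
  proof (rule strict_axis_orderI[where r = "p c"])
    fix y z assume yz: "y \<in> C j" "z \<in> C j"
    have eq: "sgn (ori (p a) (p b) (p c) y) = sgn (ori (p a) (p b) (p c) z)"
      and nz: "sgn (ori (p a) (p b) (p c) y) \<noteq> 0"
      using sgn_cluster_fourth[OF assms(1) _ assms(2,3) c(1,2)] yz
        position_sign_nonzero[of a b c "4*j+2"] c single_neq_cluster[of _ j] assms(2,3) by auto
    show "0 < ori (p a) (p b) (p c) y * ori (p a) (p b) (p c) z"
      using eq nz by (auto simp: sgn_if zero_less_mult_iff split: if_splits)
    assume "y \<noteq> z"
    then show "ori (p a) (p b) y z \<noteq> 0"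
      using single_notin_cluster[OF assms(1)] single_points_neq[of a b] assms yz C_subset_X p_in_X
      by (intro ori_nonzero) (auto simp: single_def)
  qed
qed

text \<open>Consider the planes through the line from \<open>p q\<close> to \<open>y\<close>. By the
  sign conditions on \<open>F\<close>, each foreign point \<open>x\<close> lies in the sector
  between \<open>p l\<close> and \<open>p r\<close>; by \<open>agree\<close>, these two lie on the
  same side of the plane through \<open>z\<close>. Interpolation puts \<open>x\<close> on that side
  too.\<close>

lemma one_sided_from:
  assumes j: "j < K" "Z \<subseteq> C j" "C 0 \<noteq> {}"
    and q: "single q" "single l" "single r" "distinct [q, l, r]"
    and agree: "\<And>y z. y \<in> Z \<Longrightarrow> z \<in> Z \<Longrightarrow> y \<noteq> z \<Longrightarrow> sgn (ori (p q) (p l) y z) = sgn (ori (p q) (p r) y z)"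
    and F: "\<And>i. i \<in> F \<Longrightarrow> i < K \<and> i \<noteq> j \<and> {q, l, r} \<inter> {4 * i + 1, 4 * i + 3} = {} \<and>
      position_sign q (4 * j + 2) l (4 * i + 2) = position_sign q (4 * j + 2) l r \<and>
      position_sign q (4 * j + 2) (4 * i + 2) r = position_sign q (4 * j + 2) l r"
  shows "sees_one_sided X (p q) (p l) Z (\<Union>i\<in>F. C i)"
  unfolding sees_one_sided_def
proof (intro conjI ballI impI)
  show qX: "p q \<in> X" using p_in_X q by (simp add: single_def)
  show "strict_axis_order (p q) (p l) Z"
    using strict_axis_order_cluster[OF j(1) q(1,2) _ j(3)] q(4) j(2) strict_axis_order_subset by auto
  show "ori (p q) x y z \<noteq> 0" if "x \<in> Z" "y \<in> Z" "z \<in> Z" "x \<noteq> y" "y \<noteq> z" "x \<noteq> z" for x y z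
    using that single_notin_cluster[OF j(1) _ q(1)] j(2) C_subset_X[OF j(1)] qX
    by (intro ori_nonzero) auto
  fix y z x assume yz: "y \<in> Z" "z \<in> Z" "axis_less (p q) (p l) y z" and "x \<in> (\<Union>i\<in>F. C i)"
  then obtain i where i: "i \<in> F" "x \<in> C i" by blast
  note Fi = F[OF i(1)]
  have yC: "y \<in> C j" using yz j by blast
  have yz': "y \<noteq> z" using yz(3) by (auto simp: axis_less_def)
  have lr: "sgn (ori (p q) y (p l) (p r)) = position_sign q (4 * j + 2) l r"
    by (rule sgn_cluster_second[OF j(1) yC q])
  have "sgn (ori (p q) y x z) = sgn (ori (p q) y (p l) z)"
  proof (rule pluecker_sign)
    show "ori (p q) y (p l) (p r) * ori (p q) y x z =
      ori (p q) y (p l) x * ori (p q) y (p r) z + ori (p q) y (p l) z * ori (p q) y x (p r)"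
      using grassmann_pluecker[of "p q" y "p l" "p r" x z] swap34[of "p q" y x "p r"] by simp
    show "ori (p q) y (p l) (p r) \<noteq> 0"
      using lr position_sign_nonzero[of q "4*j+2" l r] q(4) single_neq_cluster[OF q(1), of j]
        single_neq_cluster[OF q(2), of j] single_neq_cluster[OF q(3), of j] by (metis distinct_length_2_or_more distinct_singleton sgn_0)
    show "sgn (ori (p q) y (p l) x) = sgn (ori (p q) y (p l) (p r))"
      unfolding lr using sgn_two_clusters(1)[of i j x y q l] Fi i yC j q by auto
    show "sgn (ori (p q) y x (p r)) = sgn (ori (p q) y (p l) (p r))"
      unfolding lr using sgn_two_clusters(2)[of i j x y q r] Fi i yC j q by auto
    show "sgn (ori (p q) y (p r) z) = sgn (ori (p q) y (p l) z)"
      using agree[OF yz(1,2) yz'] swap23[of "p q" "p l" y z] swap23[of "p q" "p r" y z] by (simp add: sgn_minus)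
  qed
  then have "sgn (ori (p q) x y z) = sgn (ori (p q) (p l) y z)"
    using swap23[of "p q" x y z] swap23[of "p q" "p l" y z] by (simp add: sgn_minus)
  then show "0 < ori (p q) x y z" using yz(3) by (simp add: axis_less_def sgn_if split: if_splits)
qed

text \<open>By the agreement assumption, the direction of any two points of \<open>Z\<close> avoids the cone spanned by
  \<open>m\<close>, \<open>u\<close>, \<open>w\<close>, \<open>M\<close>, which contains all other clusters. The sign with respect to the axis \<open>m u\<close> decides
  whether the separating planes pass through \<open>m\<close> or through \<open>u\<close>.\<close>
lemma one_sided_subcluster:
  assumes j: "j < K" "Z \<subseteq> C j" "C 0 \<noteq> {}" "s * s \<le> card Z"
    and pos: "single m" "single u" "single w" "single M" "m < u" "u < 4 * j + 2" "4 * j + 2 < w" "w \<le> M"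
    and agree: "\<And>y z. y \<in> Z \<Longrightarrow> z \<in> Z \<Longrightarrow> y \<noteq> z \<Longrightarrow> 0 < ori (p u) (p M) y z * ori (p m) (p w) y z"
    and F: "\<And>i. i \<in> F \<Longrightarrow> i < K \<and> i \<noteq> j \<and> {m, u, w, M} \<inter> {4 * i + 1, 4 * i + 3} = {} \<and>
      (m < 4 * i + 2 \<and> 4 * i + 2 < u \<or> w < 4 * i + 2 \<and> 4 * i + 2 < M)"
  shows "\<exists>Z'\<subseteq>Z. card Z' = s \<and> (\<exists>q r. sees_one_sided X q r Z' (\<Union>i\<in>F. C i))"
proof -
  have finZ: "finite Z" using finite_X C_subset_X j finite_subset by meson
  have ord: "strict_axis_order (p m) (p u) Z" "strict_axis_order (p m) (p w) Z"
    using strict_axis_order_cluster[OF j(1) _ _ _ j(3)] strict_axis_order_subset[OF _ j(2)] pos by auto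
  from axis_orders_split[OF finZ j(4) ord] show ?thesis
  proof
    assume "\<exists>Z'\<subseteq>Z. card Z' = s \<and> (\<forall>y\<in>Z'. \<forall>z\<in>Z'. y \<noteq> z \<longrightarrow> 0 < ori (p m) (p u) y z * ori (p m) (p w) y z)"
    then obtain Z' where Z': "Z' \<subseteq> Z" "card Z' = s"
      "\<And>y z. y \<in> Z' \<Longrightarrow> z \<in> Z' \<Longrightarrow> y \<noteq> z \<Longrightarrow> 0 < ori (p m) (p u) y z * ori (p m) (p w) y z" by blast
    have "sees_one_sided X (p m) (p u) Z' (\<Union>i\<in>F. C i)"
    proof (rule one_sided_from[where j = j and r = w])
      show "sgn (ori (p m) (p u) y z) = sgn (ori (p m) (p w) y z)" if "y \<in> Z'" "z \<in> Z'" "y \<noteq> z" for y z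
        using Z'(3)[OF that] by (auto simp: sgn_if zero_less_mult_iff)
      fix i assume i: "i \<in> F"
      show "i < K \<and> i \<noteq> j \<and> {m, u, w} \<inter> {4 * i + 1, 4 * i + 3} = {} \<and>
        position_sign m (4 * j + 2) u (4 * i + 2) = position_sign m (4 * j + 2) u w \<and>
        position_sign m (4 * j + 2) (4 * i + 2) w = position_sign m (4 * j + 2) u w"
        using F[OF i] position_sign_left[OF pos(5-7), of "4 * i + 2"] by blast
    qed (use j Z' pos in auto)
    then show ?thesis using Z' by blast
  next
    assume "\<exists>Z'\<subseteq>Z. card Z' = s \<and> (\<forall>y\<in>Z'. \<forall>z\<in>Z'. y \<noteq> z \<longrightarrow> ori (p m) (p u) y z * ori (p m) (p w) y z < 0)"
    then obtain Z' where Z': "Z' \<subseteq> Z" "card Z' = s"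
      "\<And>y z. y \<in> Z' \<Longrightarrow> z \<in> Z' \<Longrightarrow> y \<noteq> z \<Longrightarrow> ori (p m) (p u) y z * ori (p m) (p w) y z < 0" by blast
    \<comment> \<open>Opposite signs for the axes \<open>m u\<close> and \<open>m w\<close> are
      equal signs for \<open>u m\<close> and \<open>m w\<close>, hence by \<open>agree\<close> for
      \<open>u m\<close> and \<open>u M\<close>. So the planes can pass through \<open>u\<close>,
      with the sector between \<open>m\<close> and \<open>M\<close>.\<close>
    have "sees_one_sided X (p u) (p m) Z' (\<Union>i\<in>F. C i)"
    proof (rule one_sided_from[where j = j and r = M])
      show "sgn (ori (p u) (p m) y z) = sgn (ori (p u) (p M) y z)" if "y \<in> Z'" "z \<in> Z'" "y \<noteq> z" for y z
        using Z'(3)[OF that] agree[OF subsetD[OF Z'(1) that(1)] subsetD[OF Z'(1) that(2)] that(3)]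
          swap12[of "p u" "p m" y z]
        by (auto simp: sgn_if zero_less_mult_iff mult_less_0_iff)
      fix i assume i: "i \<in> F"
      show "i < K \<and> i \<noteq> j \<and> {u, m, M} \<inter> {4 * i + 1, 4 * i + 3} = {} \<and>
        position_sign u (4 * j + 2) m (4 * i + 2) = position_sign u (4 * j + 2) m M \<and>
        position_sign u (4 * j + 2) (4 * i + 2) M = position_sign u (4 * j + 2) m M"
        using F[OF i] position_sign_right[of m u "4 * j + 2" M "4 * i + 2"] pos(5-8) by fastforce
    qed (use j Z' pos in auto)
    then show ?thesis using Z' by blast
  qed
qed

lemma combine_clusters:
  assumes F: "finite F" "n \<le> card F * l" "F \<subseteq> {..<K}" and s: "(2 * n + 2 * l choose (2 * l)) < s"
    and Z: "\<And>j. j \<in> F \<Longrightarrow> \<exists>Z'\<subseteq>C j. card Z' = s \<and> (\<exists>q r. sees_one_sided X q r Z' (\<Union>i\<in>F - {j}. C i))"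
  shows "cut_off_points X n"
proof -
  have "\<forall>j\<in>F. \<exists>Z'. Z' \<subseteq> C j \<and> card Z' = s \<and> (\<exists>q r. sees_one_sided X q r Z' (\<Union>i\<in>F - {j}. C i))"
    using Z by blast
  then obtain Z' where Z': "\<And>j. j \<in> F \<Longrightarrow> Z' j \<subseteq> C j \<and> card (Z' j) = s \<and>
      (\<exists>q r. sees_one_sided X q r (Z' j) (\<Union>i\<in>F - {j}. C i))"
    by metis
  show ?thesis
  proof (rule combine_bulges[OF F(1,2), of Z'])
    fix j assume j: "j \<in> F"
    have sub: "Z' j \<subseteq> X" using Z'[OF j] C_subset_X F(3) j by blast
    have "(\<Union>i\<in>F - {j}. Z' i) \<subseteq> (\<Union>i\<in>F - {j}. C i)" using Z' by blast
    moreover obtain q r where "sees_one_sided X q r (Z' j) (\<Union>i\<in>F - {j}. C i)" using Z'[OF j] by blast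
    ultimately have "sees_one_sided X q r (Z' j) (\<Union>i\<in>F - {j}. Z' i)"
      by (rule sees_one_sided_mono[rotated])
    then show "Z' j \<subseteq> X \<and> finite (Z' j) \<and> (2 * n + 2 * l choose (2 * l)) < card (Z' j) \<and>
       (\<exists>q r. sees_one_sided X q r (Z' j) (\<Union>i\<in>F - {j}. Z' i))"
      using Z'[OF j] s sub finite_subset[OF sub finite_X] by auto
  qed
qed

text \<open>There are three ways to succeed, all instances of \<open>one_sided_subcluster\<close>,
  with \<open>(m, u, w, M)\<close> at the positions \<open>(0, 4*j+1, 4*j+3, 4*K)\<close>,
  \<open>(4*a, 4*j+1, 4*b, 4*K)\<close> or \<open>(0, 4*u, 4*j+3, 4*b)\<close>. The factor
  \<open>s * s\<close> is paid once for the first split and once in each of \<open>R\<close> rounds,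
  and \<open>s' * s'\<close> points must remain for the last way.\<close>

theorem cut_off_points_of_clusters:
  assumes K: "K = k * stage_size k R" "k > 0"
    and size: "\<And>j. j < K \<Longrightarrow> (s * s) * ((s * s) ^ R * (s' * s')) \<le> card (C j)"
    and s: "(2 * n + 2 * l choose (2 * l)) < s" "n \<le> k * l"
    and s': "(2 * n + 2 * l' choose (2 * l')) < s'" "n \<le> R * l'"
  shows "cut_off_points X n"
proof -
  let ?c = "s * s" and ?e = "s' * s'" and ?\<kappa> = "stage_size k R"
  have c: "?c > 0" using s by simp
  have \<kappa>: "?\<kappa> > 0" by (cases R) auto
  have K0: "0 < K" using K \<kappa> by simp
  have ne: "C 0 \<noteq> {}"
  proof -
    have "0 < ?c * (?c ^ R * ?e)" using s s' by simp
    then show ?thesis using size[OF K0] by auto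
  qed
  have sg: "single (4 * t)" if "t \<le> K" for t using that by (simp add: single_def)
  have sg1: "single (4 * j + 1)" "single (4 * j + 3)" if "j < K" for j
    using that by (simp_all add: single_def)
  have finC: "finite (C j)" if "j < K" for j using that finite_X C_subset_X finite_subset by blast
  define agr where "agr j Z \<longleftrightarrow> (\<forall>y\<in>Z. \<forall>z\<in>Z. y \<noteq> z \<longrightarrow>
     0 < ori (p (4*j+1)) (p (4*K)) y z * ori (p 0) (p (4*j+3)) y z)" for j Z
  define dis where "dis j Z \<longleftrightarrow> (\<forall>y\<in>Z. \<forall>z\<in>Z. y \<noteq> z \<longrightarrow>
     ori (p (4*j+1)) (p (4*K)) y z * ori (p 0) (p (4*j+3)) y z < 0)" for j Z
  \<comment> \<open>Grouping yields one success in each of \<open>k\<close> groups, or a block of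
    consecutive failures just long enough for the query game.\<close>
  define Q where "Q (i::nat) j \<longleftrightarrow> (\<exists>Z\<subseteq>C j. card Z = ?c \<and> agr j Z)" for i j
  consider (agree) f where "\<forall>i<k. 0 + i * ?\<kappa> \<le> f i \<and> f i < 0 + Suc i * ?\<kappa> \<and> Q i (f i)"
    | (disagree) i where "i < k" "\<forall>j. 0 + i * ?\<kappa> \<le> j \<longrightarrow> j < 0 + Suc i * ?\<kappa> \<longrightarrow> \<not> Q i j"
    using interval_groups[of k 0 ?\<kappa> Q] by blast
  then show ?thesis
  proof cases
    case agree
    have fK: "f i < K" if "i < k" for i
    proof -
      have "Suc i * ?\<kappa> \<le> k * ?\<kappa>" using that by (intro mult_le_mono1) auto
      moreover have "f i < Suc i * ?\<kappa>" using agree that by simp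
      ultimately show ?thesis using K by linarith
    qed
    have fmono: "f i < f i'" if "i < i'" "i' < k" for i i'
    proof -
      have "Suc i * ?\<kappa> \<le> i' * ?\<kappa>" using that by (intro mult_le_mono1) auto
      moreover have "f i < Suc i * ?\<kappa>" "i' * ?\<kappa> \<le> f i'" using agree that by simp_all
      ultimately show ?thesis by linarith
    qed
    have finj: "inj_on f {..<k}"
      by (rule inj_onI) (metis fmono lessThan_iff less_irrefl linorder_neqE_nat)
    show ?thesis
    proof (rule combine_clusters[where F = "f ` {..<k}" and l = l, OF _ _ _ s(1)])
      show "n \<le> card (f ` {..<k}) * l" using finj s(2) by (simp add: card_image)
      show "f ` {..<k} \<subseteq> {..<K}" using fK by auto
      fix j assume "j \<in> f ` {..<k}"
      then obtain i where i: "i < k" "j = f i" by auto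
      have jK: "j < K" using fK i by simp
      obtain Z where Z: "Z \<subseteq> C j" "card Z = ?c" "agr j Z"
        using agree i unfolding Q_def by blast
      have "\<exists>Z'\<subseteq>Z. card Z' = s \<and> (\<exists>q r. sees_one_sided X q r Z' (\<Union>i\<in>f ` {..<k} - {j}. C i))"
      proof (rule one_sided_subcluster[OF jK Z(1) ne _ _ sg1[OF jK] sg[of K]])
        show "0 < ori (p (4 * j + 1)) (p (4 * K)) y z * ori (p 0) (p (4 * j + 3)) y z"
          if "y \<in> Z" "z \<in> Z" "y \<noteq> z" for y z
          using Z(3) that unfolding agr_def by simp
        show "single 0" using sg[of 0] by simp
        fix i' assume i': "i' \<in> f ` {..<k} - {j}"
        then have "i' < K" "i' \<noteq> j" using fK by auto
        then show "i' < K \<and> i' \<noteq> j \<and> {0, 4 * j + 1, 4 * j + 3, 4 * K} \<inter> {4 * i' + 1, 4 * i' + 3} = {} \<and>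
          (0 < 4 * i' + 2 \<and> 4 * i' + 2 < 4 * j + 1 \<or> 4 * j + 3 < 4 * i' + 2 \<and> 4 * i' + 2 < 4 * K)"
          by auto
      qed (use jK Z(2) in auto)
      then show "\<exists>Z'\<subseteq>C j. card Z' = s \<and> (\<exists>q r. sees_one_sided X q r Z' (\<Union>i\<in>f ` {..<k} - {j}. C i))"
        using Z(1) by blast
    qed simp
  next
    case disagree
    define \<alpha> where "\<alpha> = i * ?\<kappa>"
    have \<alpha>K: "\<alpha> + ?\<kappa> \<le> K"
    proof -
      have "Suc i * ?\<kappa> \<le> k * ?\<kappa>" using disagree(1) by (intro mult_le_mono1) auto
      then show ?thesis using K by (simp add: \<alpha>_def)
    qed
    have "\<exists>Z\<subseteq>C j. card Z = ?c ^ R * ?e \<and> dis j Z" if j: "\<alpha> \<le> j" "j < \<alpha> + ?\<kappa>" for j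
    proof -
      have jK: "j < K" using j \<alpha>K by simp
      have "\<not> Q i j" using disagree(2) j by (auto simp: \<alpha>_def)
      moreover have "strict_axis_order (p (4*j+1)) (p (4*K)) (C j)" "strict_axis_order (p 0) (p (4*j+3)) (C j)"
        using strict_axis_order_cluster[OF jK _ _ _ ne] sg1[OF jK] sg[of K] sg[of 0] jK by auto
      ultimately show ?thesis
        using axis_orders_split[OF finC[OF jK] size[OF jK], of "p (4*j+1)" "p (4*K)" "p 0" "p (4*j+3)"]
        unfolding Q_def agr_def[symmetric] dis_def[symmetric] by blast
    qed
    then have "\<forall>j. \<exists>Z. \<alpha> \<le> j \<longrightarrow> j < \<alpha> + ?\<kappa> \<longrightarrow> Z \<subseteq> C j \<and> card Z = ?c ^ R * ?e \<and> dis j Z" by blast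
    then obtain Z where Z: "\<And>j. \<alpha> \<le> j \<Longrightarrow> j < \<alpha> + ?\<kappa> \<Longrightarrow> Z j \<subseteq> C j \<and> card (Z j) = ?c ^ R * ?e \<and> dis j (Z j)" by metis
    define Z0 where "Z0 j = (if \<alpha> \<le> j \<and> j < \<alpha> + ?\<kappa> then Z j else {})" for j
    have Z0C: "Z0 j \<subseteq> C j" for j using Z by (auto simp: Z0_def)
    have Z0neg: "ori (p (4*j+1)) (p (4*K)) y z * ori (p 0) (p (4*j+3)) y z < 0"
      if "y \<in> Z0 j" "z \<in> Z0 j" "y \<noteq> z" for j y z
      using Z[of j] that by (auto simp: Z0_def dis_def split: if_splits)
    \<comment> \<open>The wall axis from \<open>4*a\<close> to \<open>4*b\<close> is compared with
      two axes that are already opposite on \<open>Z0 j\<close>, so disagreeing with one means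
      agreeing with the other.\<close>
    define plus where "plus j a b W \<longleftrightarrow> (\<forall>y\<in>W. \<forall>z\<in>W. y \<noteq> z \<longrightarrow>
      0 < ori (p (4*a)) (p (4*b)) y z * ori (p 0) (p (4*j+3)) y z)" for j a b W
    define minus where "minus j a b W \<longleftrightarrow> (\<forall>y\<in>W. \<forall>z\<in>W. y \<noteq> z \<longrightarrow>
      0 < ori (p (4*a)) (p (4*b)) y z * ori (p (4*j+1)) (p (4*K)) y z)" for j a b W
    have "(\<exists>F a W. finite F \<and> card F = k \<and> (\<forall>j\<in>F. a \<le> j \<and> W j \<subseteq> Z0 j \<and> card (W j) = ?c \<and>
        (\<exists>b. j < b \<and> b \<le> K \<and> (\<forall>i\<in>F. j < i \<longrightarrow> b \<le> i) \<and> minus j a b (W j)))) \<or>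
    (\<exists>F W. F \<subseteq> {\<alpha>..<\<alpha> + ?\<kappa>} \<and> card F = Suc R \<and>
      (\<forall>j\<in>F. W j \<subseteq> Z j \<and> ?e \<le> card (W j) \<and>
        ((\<forall>i\<in>F. j \<le> i) \<or> (\<exists>u b. (\<forall>i\<in>F. i < j \<longrightarrow> i < u) \<and> u \<le> j \<and> (\<forall>i\<in>F. i < b) \<and> b \<le> K \<and> plus j u b (W j)))))"
    proof (rule query_game[OF _ c _ \<alpha>K])
      show "plus j a b Z'" if "plus j a b Z" "Z' \<subseteq> Z" for j a b Z Z'
        using that unfolding plus_def by blast
      show "Z j \<subseteq> Z0 j \<and> ?c ^ R * ?e \<le> card (Z j)" if "\<alpha> \<le> j" "j < \<alpha> + ?\<kappa>" for j
        using Z[OF that] that by (simp add: Z0_def)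
      fix j a b W t assume ab: "a \<le> j" "j < b" "b \<le> K" "W \<subseteq> Z0 j" "?c * t \<le> card W"
      have jK: "j < K" and WC: "W \<subseteq> C j" using ab Z0C by auto
      have ord: "strict_axis_order (p (4*a)) (p (4*b)) W" "strict_axis_order (p (4*j+1)) (p (4*K)) W"
        using strict_axis_order_cluster[OF jK _ _ _ ne] strict_axis_order_subset[OF _ WC]
          sg1[OF jK] sg[of K] sg[of a] sg[of b] ab by auto
      have finW: "finite W" using finC[OF jK] WC finite_subset by blast
      have pl: "plus j a b Z'" if Z': "Z' \<subseteq> W" "\<forall>y\<in>Z'. \<forall>z\<in>Z'. y \<noteq> z \<longrightarrow>
        ori (p (4*a)) (p (4*b)) y z * ori (p (4*j+1)) (p (4*K)) y z < 0" for Z'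
        unfolding plus_def
      proof (intro ballI impI)
        fix y z assume yz: "y \<in> Z'" "z \<in> Z'" "y \<noteq> z"
        have "ori (p (4*j+1)) (p (4*K)) y z * ori (p 0) (p (4*j+3)) y z < 0"
          using Z0neg[of y j z] yz Z'(1) ab(4) by blast
        moreover have "ori (p (4*a)) (p (4*b)) y z * ori (p (4*j+1)) (p (4*K)) y z < 0" using Z'(2) yz by blast
        ultimately show "0 < ori (p (4*a)) (p (4*b)) y z * ori (p 0) (p (4*j+3)) y z"
          by (auto simp: zero_less_mult_iff mult_less_0_iff)
      qed
      show "(\<exists>Z'\<subseteq>W. card Z' = ?c \<and> minus j a b Z') \<or> (\<exists>Z'\<subseteq>W. card Z' = t \<and> plus j a b Z')"
        using axis_orders_split[OF finW ab(5) ord] pl unfolding minus_def by blast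
    qed
    then show ?thesis
    proof
      assume "\<exists>F a W. finite F \<and> card F = k \<and> (\<forall>j\<in>F. a \<le> j \<and> W j \<subseteq> Z0 j \<and> card (W j) = ?c \<and>
        (\<exists>b. j < b \<and> b \<le> K \<and> (\<forall>i\<in>F. j < i \<longrightarrow> b \<le> i) \<and> minus j a b (W j)))"
      then obtain F a W where F: "finite F" "card F = k" and
        W: "\<forall>j\<in>F. a \<le> j \<and> W j \<subseteq> Z0 j \<and> card (W j) = ?c \<and>
        (\<exists>b. j < b \<and> b \<le> K \<and> (\<forall>i\<in>F. j < i \<longrightarrow> b \<le> i) \<and> minus j a b (W j))"
        by (elim exE conjE) (rule that)
      have FK: "j < K" "a \<le> j" if "j \<in> F" for j using W that by (meson order_less_le_trans)+
      show ?thesis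
      proof (rule combine_clusters[where F = F and l = l, OF F(1) _ _ s(1)])
        show "n \<le> card F * l" using F s(2) by simp
        show "F \<subseteq> {..<K}" using FK by auto
        fix j assume j: "j \<in> F"
        have jK: "j < K" and aj: "a \<le> j" using FK j by auto
        obtain b where b: "j < b" "b \<le> K" "\<forall>i\<in>F. j < i \<longrightarrow> b \<le> i" "minus j a b (W j)"
          using bspec[OF W j] by blast
        have Wj: "W j \<subseteq> C j" "card (W j) = ?c" using bspec[OF W j] Z0C by auto
        have "\<exists>Z'\<subseteq>W j. card Z' = s \<and> (\<exists>q r. sees_one_sided X q r Z' (\<Union>i\<in>F - {j}. C i))"
        proof (rule one_sided_subcluster[OF jK Wj(1) ne _ sg[of a] sg1(1)[OF jK] sg[of b] sg[of K]])
          show "0 < ori (p (4 * j + 1)) (p (4 * K)) y z * ori (p (4 * a)) (p (4 * b)) y z"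
            if "y \<in> W j" "z \<in> W j" "y \<noteq> z" for y z
            using b(4) that unfolding minus_def by (metis mult.commute)
          fix i' assume i': "i' \<in> F - {j}"
          have 1: "i' < K" "i' \<noteq> j" "a \<le> i'" using FK i' by auto
          have "i' < j \<or> b \<le> i'" using b(3) i' by force
          then show "i' < K \<and> i' \<noteq> j \<and> {4 * a, 4 * j + 1, 4 * b, 4 * K} \<inter> {4 * i' + 1, 4 * i' + 3} = {} \<and>
            (4 * a < 4 * i' + 2 \<and> 4 * i' + 2 < 4 * j + 1 \<or> 4 * b < 4 * i' + 2 \<and> 4 * i' + 2 < 4 * K)"
            using 1 by (intro conjI) (auto, presburger+)
        qed (use jK Wj(2) aj b in auto)
        then show "\<exists>Z'\<subseteq>C j. card Z' = s \<and> (\<exists>q r. sees_one_sided X q r Z' (\<Union>i\<in>F - {j}. C i))"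
          using Wj(1) by blast
      qed
    next
      assume "\<exists>F W. F \<subseteq> {\<alpha>..<\<alpha> + ?\<kappa>} \<and> card F = Suc R \<and>
      (\<forall>j\<in>F. W j \<subseteq> Z j \<and> ?e \<le> card (W j) \<and>
        ((\<forall>i\<in>F. j \<le> i) \<or> (\<exists>u b. (\<forall>i\<in>F. i < j \<longrightarrow> i < u) \<and> u \<le> j \<and> (\<forall>i\<in>F. i < b) \<and> b \<le> K \<and> plus j u b (W j))))"
      then obtain F0 W where F0: "F0 \<subseteq> {\<alpha>..<\<alpha> + ?\<kappa>}" "card F0 = Suc R" and
        W: "\<forall>j\<in>F0. W j \<subseteq> Z j \<and> ?e \<le> card (W j) \<and>
        ((\<forall>i\<in>F0. j \<le> i) \<or> (\<exists>u b. (\<forall>i\<in>F0. i < j \<longrightarrow> i < u) \<and> u \<le> j \<and> (\<forall>i\<in>F0. i < b) \<and> b \<le> K \<and> plus j u b (W j)))"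
        by (elim exE conjE) (rule that)
      have finF0: "finite F0" using F0(1) finite_subset by blast
      have F0ne: "F0 \<noteq> {}" using F0(2) by auto
      \<comment> \<open>The minimum carries no answer; this is why the game returns
        \<open>Suc R\<close> indices, of which \<open>R\<close> remain.\<close>
      define F where "F = F0 - {Min F0}"
      have F: "finite F" "card F = R" "F \<subseteq> F0" using finF0 F0 F0ne Min_in[OF finF0 F0ne] by (auto simp: F_def)
      have FK: "j < K" "\<alpha> \<le> j" "j < \<alpha> + ?\<kappa>" if "j \<in> F" for j using F(3) F0(1) \<alpha>K that by force+
      show ?thesis
      proof (rule combine_clusters[where F = F and l = l', OF F(1) _ _ s'(1)])
        show "n \<le> card F * l'" using F s'(2) by simp
        show "F \<subseteq> {..<K}" using FK by auto
        fix j assume j: "j \<in> F"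
        have jK: "j < K" using FK j by auto
        have j0: "j \<in> F0" "Min F0 \<in> F0" "Min F0 < j"
          using j F finF0 F0ne by (auto simp: F_def intro: le_neq_trans)
        then have "\<not> (\<forall>i\<in>F0. j \<le> i)" by force
        then obtain u b where ub: "\<forall>i\<in>F0. i < j \<longrightarrow> i < u" "u \<le> j" "\<forall>i\<in>F0. i < b" "b \<le> K" "plus j u b (W j)"
          using bspec[OF W j0(1)] by blast
        have u0: "0 < u" using ub(1) j0 by fastforce
        have jb: "j < b" using ub(3) j0 by blast
        have "W j \<subseteq> Z j" "?e \<le> card (W j)" using bspec[OF W j0(1)] by auto
        then have Wj: "W j \<subseteq> C j" "?e \<le> card (W j)" using Z[OF FK(2,3)[OF j]] by auto
        have "\<exists>Z'\<subseteq>W j. card Z' = s' \<and> (\<exists>q r. sees_one_sided X q r Z' (\<Union>i\<in>F - {j}. C i))"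
        proof (rule one_sided_subcluster[OF jK Wj(1) ne Wj(2) _ sg[of u] sg1(2)[OF jK] sg[of b]])
          show "0 < ori (p (4 * u)) (p (4 * b)) y z * ori (p 0) (p (4 * j + 3)) y z"
            if "y \<in> W j" "z \<in> W j" "y \<noteq> z" for y z
            using ub(5) that unfolding plus_def by blast
          show "single 0" using sg[of 0] by simp
          fix i' assume i': "i' \<in> F - {j}"
          have 1: "i' < K" "i' \<noteq> j" using FK i' by auto
          have "i' < u \<or> j < i'" "i' < b" using ub(1,3) i' F(3) by force+
          then show "i' < K \<and> i' \<noteq> j \<and> {0, 4 * u, 4 * j + 3, 4 * b} \<inter> {4 * i' + 1, 4 * i' + 3} = {} \<and>
            (0 < 4 * i' + 2 \<and> 4 * i' + 2 < 4 * u \<or> 4 * j + 3 < 4 * i' + 2 \<and> 4 * i' + 2 < 4 * b)"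
            using 1 by (intro conjI) (auto, presburger+)
        qed (use jK ub u0 jb in auto)
        then show "\<exists>Z'\<subseteq>C j. card Z' = s' \<and> (\<exists>q r. sees_one_sided X q r Z' (\<Union>i\<in>F - {j}. C i))"
          using Wj(1) by blast
      qed
    qed
  qed
qed

end

section \<open>Existence of clusters and subexponential bounds\<close>

text \<open>From \<open>(a choose b) * x ^ b \<le> (x + 1) ^ a\<close>: a small \<open>x\<close>
  makes the right side cheap, and then a large \<open>r\<close> makes \<open>b\<close> so small
  compared with \<open>n\<close> that dividing by \<open>x ^ b\<close> is cheap as well.\<close>

lemma binomial_subexponential:
  fixes \<mu> :: real
  assumes "\<mu> > 0"
  shows "\<exists>r>0. \<forall>\<^sub>F n in sequentially.
    real (2 * n + 2 * (n div r + 1) choose (2 * (n div r + 1))) < 2 powr (\<mu> * real n)"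
proof -
  \<comment> \<open>24 is 6 times 4: \<open>a \<le> 6 * n\<close>, and this term may use a quarter
    of the budget \<open>E\<close>. The two summands of \<open>b\<close> get a quarter each, one by
    the choice of \<open>r\<close>, the other by that of \<open>n0\<close>.\<close>
  define x where "x = min (1/2) (\<mu> * ln 2 / 24)"
  have x: "x > 0" "x < 1" "x \<le> \<mu> * ln 2 / 24" using assms by (auto simp: x_def)
  define c where "c = - ln x"
  have c: "c > 0" using x by (simp add: c_def ln_less_zero)
  obtain r0 :: nat where r0: "8 * c / (\<mu> * ln 2) < real r0" using reals_Archimedean2 by blast
  define r where "r = r0"
  have \<mu>2: "\<mu> * ln 2 > 0" using assms by simp
  have r: "r > 0" using r0 c \<mu>2 unfolding r_def by (metis divide_pos_pos gr0I mult_pos_pos not_less_iff_gr_or_eq of_nat_0 zero_less_numeral)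
  have rc: "8 * c \<le> \<mu> * ln 2 * r" using r0 \<mu>2 by (simp add: r_def field_simps)
  obtain n0 :: nat where n0: "8 * c / (\<mu> * ln 2) < real n0" using reals_Archimedean2 by blast
  have "real (2 * n + 2 * (n div r + 1) choose (2 * (n div r + 1))) < 2 powr (\<mu> * real n)"
    if n: "n \<ge> max n0 1" for n
  proof -
    define l where "l = n div r + 1"
    define a where "a = 2 * n + 2 * l"
    define b where "b = 2 * l"
    have ba: "b \<le> a" by (simp add: a_def b_def)
    have nc: "8 * c < \<mu> * ln 2 * n"
    proof -
      have "8 * c / (\<mu> * ln 2) < real n" using n0 n by linarith
      then show ?thesis using \<mu>2 by (simp add: field_simps)
    qed
    have "l \<le> n + 1" by (simp add: l_def)
    then have a6: "real a \<le> 6 * real n" using n by (simp add: a_def)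
    have "real (n div r) \<le> real n / real r" by (rule of_nat_div_le_of_nat)
    then have b': "real b \<le> 2 * real n / real r + 2" by (simp add: b_def l_def)
    have "real (a choose b) * x ^ b \<le> (\<Sum>k\<le>a. real (a choose k) * x ^ k)"
      using x ba by (intro member_le_sum[of b "{..a}" "\<lambda>k. real (a choose k) * x ^ k"]) auto
    also have "\<dots> = (x + 1) ^ a" by (simp add: binomial_ring)
    finally have "real (a choose b) \<le> (x + 1) ^ a / x ^ b"
      using x by (simp add: field_simps)
    also have "\<dots> = exp (real a * ln (x + 1) + real b * c)"
      using x by (simp add: c_def exp_add exp_of_nat_mult exp_minus exp_diff field_simps)
    also have "\<dots> < exp (\<mu> * real n * ln 2)"
    proof -
      define E where "E = real n * (\<mu> * ln 2)"
      have "real a * ln (x + 1) \<le> (6 * real n) * (\<mu> * ln 2 / 24)"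
        using a6 x ln_add_one_self_le_self[of x] by (intro mult_mono) (auto simp: add.commute)
      then have 1: "real a * ln (x + 1) \<le> E / 4" by (simp add: E_def mult_ac)
      have "real b * c \<le> (2 * real n / real r + 2) * c"
        using b' c by (intro mult_right_mono) auto
      then have 2: "real b * c \<le> (2 * real n / real r) * c + 2 * c" by (simp add: distrib_right)
      have "8 * c / r \<le> \<mu> * ln 2" using rc r by (simp add: field_simps)
      then have "real n * (8 * c / r) \<le> E" unfolding E_def by (intro mult_left_mono) auto
      then have 3: "(2 * real n / real r) * c \<le> E / 4" by (simp add: field_simps)
      have 4: "8 * c < E" using nc by (simp add: E_def mult_ac)
      have "real a * ln (x + 1) + real b * c < E" using 1 2 3 4 c by linarith
      then have "real a * ln (x + 1) + real b * c < \<mu> * real n * ln 2" by (simp add: E_def mult_ac)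
      then show ?thesis by simp
    qed
    also have "\<dots> = 2 powr (\<mu> * real n)" by (simp add: powr_def)
    finally show ?thesis by (simp add: a_def b_def l_def)
  qed
  then show ?thesis using r unfolding eventually_sequentially by blast
qed

section \<open>Ramsey extraction of clusters\<close>

lemma disjoint_parts_exist:
  assumes "finite X" "R * s \<le> card X"
  shows "\<exists>A. (\<forall>i<R. A i \<subseteq> X \<and> card (A i) = s) \<and> (\<forall>i<R. \<forall>j<R. i \<noteq> j \<longrightarrow> A i \<inter> A j = {})"
  using assms
proof (induction R arbitrary: X)
  case 0
  then show ?case by simp
next
  case (Suc R)
  have "s \<le> card X" using Suc.prems(2) by simp
  then obtain B where B: "B \<subseteq> X" "card B = s" by (meson obtain_subset_with_card_n)
  have "finite B" using B Suc.prems(1) finite_subset by blast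
  then have "R * s \<le> card (X - B)" using B Suc.prems by (simp add: card_Diff_subset)
  then obtain A where A: "\<forall>i<R. A i \<subseteq> X - B \<and> card (A i) = s" "\<forall>i<R. \<forall>j<R. i \<noteq> j \<longrightarrow> A i \<inter> A j = {}"
    using Suc.IH[of "X - B"] Suc.prems(1) by auto
  let ?A = "A(R := B)"
  have "\<forall>i<Suc R. ?A i \<subseteq> X \<and> card (?A i) = s" using A(1) B by (auto simp: less_Suc_eq)
  moreover have "?A i \<inter> ?A j = {}" if ij: "i < Suc R" "j < Suc R" "i \<noteq> j" for i j
  proof -
    consider "i = R" "j < R" | "j = R" "i < R" | "i < R" "j < R" using ij by linarith
    then show ?thesis
    proof cases
      case 1
      then show ?thesis using A(1) by fastforce
    next
      case 2
      then show ?thesis using A(1) by fastforce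
    next
      case 3
      then show ?thesis using A(2) ij(3) by simp
    qed
  qed
  ultimately show ?case by (intro exI[of _ ?A]) blast
qed

lemma PiE_disjoint_inj_on:
  assumes "f \<in> PiE I A" "\<forall>i\<in>I. \<forall>j\<in>I. i \<noteq> j \<longrightarrow> A i \<inter> A j = {}"
  shows "inj_on f I"
  using assms by (intro inj_onI) (metis PiE_mem disjoint_iff)

text \<open>The sign \<open>\<epsilon>\<close> depends on \<open>f\<close>. It becomes part of the
  type of a transversal, so that one sign serves a whole family of them, and is removed by rescaling
  at the end.\<close>

lemma (in chirotope) ramsey_oriented:
  shows "\<exists>R::nat. \<forall>f. (\<forall>a b c d. a < b \<longrightarrow> b < c \<longrightarrow> c < d \<longrightarrow> d < R \<longrightarrow> ori (f a) (f b) (f c) (f d) \<noteq> 0) \<longrightarrow>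
    (\<exists>H \<epsilon>. H \<subseteq> {..<R} \<and> card H = L \<and> \<epsilon> \<in> {1, -1} \<and>
      (\<forall>a\<in>H. \<forall>b\<in>H. \<forall>c\<in>H. \<forall>d\<in>H. a < b \<longrightarrow> b < c \<longrightarrow> c < d \<longrightarrow> 0 < \<epsilon> * ori (f a) (f b) (f c) (f d)))"
proof -
  obtain R :: nat where R: "partn_lst {..<R} [L, L] 4" using ramsey_full by blast
  have "\<exists>H \<epsilon>. H \<subseteq> {..<R} \<and> card H = L \<and> \<epsilon> \<in> {1, -1} \<and>
      (\<forall>a\<in>H. \<forall>b\<in>H. \<forall>c\<in>H. \<forall>d\<in>H. a < b \<longrightarrow> b < c \<longrightarrow> c < d \<longrightarrow> 0 < \<epsilon> * ori (f a) (f b) (f c) (f d))"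
    if nz: "\<And>a b c d. a < b \<Longrightarrow> b < c \<Longrightarrow> c < d \<Longrightarrow> d < R \<Longrightarrow> ori (f a) (f b) (f c) (f d) \<noteq> 0" for f
  proof -
    define col :: "nat set \<Rightarrow> nat" where "col S = (let l = sorted_list_of_set S in
      if ori (f (l ! 0)) (f (l ! 1)) (f (l ! 2)) (f (l ! 3)) > 0 then 0 else 1)" for S
    have col: "col {a, b, c, d} = (if ori (f a) (f b) (f c) (f d) > 0 then 0 else 1)"
      if "a < b" "b < c" "c < d" for a b c d
    proof -
      have "sorted_list_of_set (set [a, b, c, d]) = [a, b, c, d]"
        using that by (intro sorted_list_of_set.idem_if_sorted_distinct) auto
      then have "sorted_list_of_set {a, b, c, d} = [a, b, c, d]" by simp
      then show ?thesis by (simp add: col_def)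
    qed
    have "col \<in> nsets {..<R} 4 \<rightarrow> {..<2}" by (auto simp: col_def Let_def)
    moreover have "length [L, L] = 2" by simp
    ultimately obtain i H where i': "i < length [L, L]" and i: "H \<in> nsets {..<R} ([L, L] ! i)" "col ` nsets H 4 \<subseteq> {i}"
      using partn_lstE[OF R] by metis
    have H: "H \<subseteq> {..<R}" "card H = L" using i i' by (auto simp: nsets_def less_Suc_eq)
    have "0 < (if i = 0 then 1 else -1) * ori (f a) (f b) (f c) (f d)"
      if "a \<in> H" "b \<in> H" "c \<in> H" "d \<in> H" "a < b" "b < c" "c < d" for a b c d
    proof -
      have "{a, b, c, d} \<in> nsets H 4" using that by (auto simp: nsets_def)
      then have "col {a, b, c, d} = i" using i(2) by blast
      then show ?thesis using col[OF that(5-7)] nz[OF that(5-7)] H(1) that(4) by (auto split: if_splits)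
    qed
    then show ?thesis using H by (intro exI[of _ H] exI[of _ "if i = 0 then 1 else -1"]) auto
  qed
  then show ?thesis by blast
qed

lemma (in chirotope) chirotope_scale: "\<epsilon> \<in> {1, -1} \<Longrightarrow> chirotope (\<lambda>a b c d. \<epsilon> * ori a b c d)"
proof (unfold_locales, goal_cases)
  case (1 b a c d) then show ?case using swap12[of b a c d] by simp
next
  case (2 a c b d) then show ?case using swap23[of a c b d] by simp
next
  case (3 a b d c) then show ?case using swap34[of a b d c] by simp
next
  case (4 a b c d e f) then show ?case using grassmann_pluecker[of a b c d e f] by auto
qed

text \<open>In every transversal of \<open>R\<close> disjoint parts, Ramsey finds
  \<open>4 * K + 1\<close> homogeneous points. Index sets and signs are boundedly many, so freezing
  all but the \<open>K\<close> cluster positions leaves sets \<open>C j\<close> whose sizes have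
  product at least \<open>s ^ K / T\<close>; no size exceeds \<open>s\<close>, so each is at least
  \<open>s / T\<close>. Points of different clusters may stem from different transversals, hence
  only quadruples with at most one cluster point are controlled.\<close>

lemma (in chirotope) moment_clusters_exist:
  assumes K: "K > 0"
  shows "\<exists>R T. \<forall>X s. finite X \<longrightarrow> (\<forall>a b c d. {a, b, c, d} \<subseteq> X \<longrightarrow> distinct [a, b, c, d] \<longrightarrow> ori a b c d \<noteq> 0) \<longrightarrow>
    s > 0 \<longrightarrow> R * s \<le> card X \<longrightarrow>
    (\<exists>\<epsilon> p C. \<epsilon> \<in> {1, -1} \<and> moment_clusters (\<lambda>a b c d. \<epsilon> * ori a b c d) X K p C \<and> (\<forall>j<K. s \<le> T * card (C j)))"
proof -
  define L where "L = 4 * K + 1"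
  obtain R :: nat where R: "\<And>f. (\<forall>a b c d. a < b \<longrightarrow> b < c \<longrightarrow> c < d \<longrightarrow> d < R \<longrightarrow> ori (f a) (f b) (f c) (f d) \<noteq> 0) \<Longrightarrow>
    (\<exists>H \<epsilon>. H \<subseteq> {..<R} \<and> card H = L \<and> \<epsilon> \<in> {1, -1} \<and>
      (\<forall>a\<in>H. \<forall>b\<in>H. \<forall>c\<in>H. \<forall>d\<in>H. a < b \<longrightarrow> b < c \<longrightarrow> c < d \<longrightarrow> 0 < \<epsilon> * ori (f a) (f b) (f c) (f d)))"
    using ramsey_oriented[of L] by blast
  define T where "T = {H. H \<subseteq> {..<R} \<and> card H = L} \<times> {1, -1::real}"
  have finT: "finite T" unfolding T_def by (intro finite_cartesian_product) auto
  show ?thesis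
  proof (rule exI[of _ R], rule exI[of _ "card T"], intro allI impI)
    fix X s
    assume finX: "finite X" and nz: "\<forall>a b c d. {a, b, c, d} \<subseteq> X \<longrightarrow> distinct [a, b, c, d] \<longrightarrow> ori a b c d \<noteq> 0"
      and s: "s > 0" "R * s \<le> card X"
    obtain A where A: "\<forall>i<R. A i \<subseteq> X \<and> card (A i) = s" "\<forall>i<R. \<forall>j<R. i \<noteq> j \<longrightarrow> A i \<inter> A j = {}"
      using disjoint_parts_exist[OF finX s(2)] by blast
    let ?I = "{..<R}"
    define P where "P t f \<longleftrightarrow> (\<forall>a\<in>fst t. \<forall>b\<in>fst t. \<forall>c\<in>fst t. \<forall>d\<in>fst t. a < b \<longrightarrow> b < c \<longrightarrow> c < d \<longrightarrow>
      0 < snd t * ori (f a) (f b) (f c) (f d))" for t :: "nat set \<times> real" and f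
    define V where "V t = (\<lambda>j. enumerate (fst t) (4 * j + 2)) ` {..<K}" for t :: "nat set \<times> real"
    have finA: "finite (A i) \<and> card (A i) = s" if "i \<in> ?I" for i
      using A(1) that finX by (meson finite_subset lessThan_iff)
    have P: "\<exists>t\<in>T. P t f" if f: "f \<in> PiE ?I A" for f
    proof -
      have inj: "inj_on f ?I" using PiE_disjoint_inj_on[OF f] A(2) by auto
      have fX: "f i \<in> X" if "i < R" for i using PiE_mem[OF f, of i] A(1) that by auto
      have "ori (f a) (f b) (f c) (f d) \<noteq> 0" if "a < b" "b < c" "c < d" "d < R" for a b c d
      proof -
        have "f i \<noteq> f j" if "i < j" "j < R" for i j
          using inj_onD[OF inj, of i j] that by auto
        then have "distinct [f a, f b, f c, f d]" using that by auto
        then show ?thesis using nz fX that by simp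
      qed
      then obtain H \<epsilon> where "H \<subseteq> {..<R}" "card H = L" "\<epsilon> \<in> {1, -1}"
        "\<forall>a\<in>H. \<forall>b\<in>H. \<forall>c\<in>H. \<forall>d\<in>H. a < b \<longrightarrow> b < c \<longrightarrow> c < d \<longrightarrow> 0 < \<epsilon> * ori (f a) (f b) (f c) (f d)"
        using R[of f] by blast
      then have "(H, \<epsilon>) \<in> T" "P (H, \<epsilon>) f" by (auto simp: T_def P_def)
      then show ?thesis by blast
    qed
    have H: "finite (fst t)" "card (fst t) = L" "fst t \<subseteq> ?I" if "t \<in> T" for t
      using that finite_subset[OF _ finite_lessThan] by (auto simp: T_def)
    have V: "V t \<subseteq> ?I \<and> card (V t) = K" if t: "t \<in> T" for t
    proof
      have "enumerate (fst t) (4 * j + 2) \<in> fst t" if "j < K" for j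
        using that H[OF t] by (intro finite_enumerate_in_set) (auto simp: L_def)
      then show "V t \<subseteq> ?I" using H(3)[OF t] by (auto simp: V_def)
      have "inj_on (\<lambda>j. enumerate (fst t) (4 * j + 2)) {..<K}"
      proof (rule inj_onI)
        fix i j assume ij: "i \<in> {..<K}" "j \<in> {..<K}" "enumerate (fst t) (4 * i + 2) = enumerate (fst t) (4 * j + 2)"
        show "i = j"
          using finite_enumerate_mono_iff[OF H(1)[OF t], of "4*i+2" "4*j+2"]
            finite_enumerate_mono_iff[OF H(1)[OF t], of "4*j+2" "4*i+2"] ij H(2)[OF t]
          by (cases i j rule: linorder_cases) (auto simp: L_def)
      qed
      then show "card (V t) = K" by (simp add: V_def card_image)
    qed
    have "\<exists>t\<in>T. \<exists>g\<in>PiE (?I - V t) A. s ^ K \<le> card T *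
      (\<Prod>v\<in>V t. card {f v |f. f \<in> PiE ?I A \<and> P t f \<and> (\<forall>i\<in>?I - V t. f i = g i)})"
      by (rule product_pigeonhole[OF finite_lessThan _ s(1) finT]) (fact finA P V)+
    then obtain t g where tg: "t \<in> T" "g \<in> PiE (?I - V t) A" "s ^ K \<le> card T *
      (\<Prod>v\<in>V t. card {f v |f. f \<in> PiE ?I A \<and> P t f \<and> (\<forall>i\<in>?I - V t. f i = g i)})"
      by (elim bexE) (rule that)
    define B where "B v = {f v |f. f \<in> PiE ?I A \<and> P t f \<and> (\<forall>i\<in>?I - V t. f i = g i)}" for v
    define e where "e = enumerate (fst t)"
    note Ht = H[OF tg(1)]
    have e_in: "e i \<in> fst t" "e i < R" if "i \<le> 4 * K" for i
      using finite_enumerate_in_set[OF Ht(1), of i] Ht that by (auto simp: e_def L_def)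
    have e_mono: "e i < e j" if "i < j" "j \<le> 4 * K" for i j
      unfolding e_def using finite_enumerate_mono[OF that(1) Ht(1)] Ht(2) that by (auto simp: L_def)
    have e_eq: "i = j" if "e i = e j" "i \<le> 4 * K" "j \<le> 4 * K" for i j
      using e_mono[of i j] e_mono[of j i] that by (cases i j rule: linorder_cases) auto
    have e_V: "e i \<in> ?I - V t" if "i \<le> 4 * K" "i mod 4 \<noteq> 2" for i
    proof -
      have "e i \<noteq> e (4 * j + 2)" if "j < K" for j
        using e_eq[of i "4 * j + 2"] \<open>i \<le> 4 * K\<close> \<open>i mod 4 \<noteq> 2\<close> that by auto presburger
      then show ?thesis using e_in(2)[OF that(1)] by (auto simp: V_def e_def)
    qed
    define C where "C j = B (e (4 * j + 2))" for j
    have BA: "B v \<subseteq> A v" if "v < R" for v using that by (auto simp: B_def)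
    have CX: "C j \<subseteq> X" if "j < K" for j
      using BA[OF e_in(2)[of "4*j+2"]] A(1) e_in(2)[of "4*j+2"] that by (auto simp: C_def)
    have eps: "snd t \<in> {1, -1}" using tg(1) by (auto simp: T_def)
    interpret sc: chirotope "\<lambda>a b c d. snd t * ori a b c d" by (rule chirotope_scale[OF eps])
    have "moment_clusters (\<lambda>a b c d. snd t * ori a b c d) X K (g \<circ> e) C"
    proof (unfold_locales, goal_cases)
      case 1 then show ?case by (rule finX)
    next
      case (2 a b c d) then show ?case using nz eps by auto
    next
      case (3 i)
      have "e i \<in> ?I - V t" using e_V 3 by simp
      then have "g (e i) \<in> A (e i)" using PiE_mem[OF tg(2)] by blast
      then show ?case using A(1) e_in(2)[OF 3(1)] by auto
    next
      case (4 j) then show ?case by (rule CX)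
    next
      case (5 j y a b c d)
      \<comment> \<open>A transversal with \<open>y\<close> at its position and \<open>g\<close> at
        every frozen one; the sign of the quadruple is read off from it.\<close>
      obtain f where f: "f \<in> PiE ?I A" "P t f" "\<forall>i\<in>?I - V t. f i = g i" "y = f (e (4 * j + 2))"
        using 5(2) unfolding C_def B_def by blast
      have pe: "((g \<circ> e)(4 * j + 2 := y)) i = f (e i)" if "i \<in> {a, b, c, d}" for i
      proof (cases "i = 4 * j + 2")
        case False
        have "i \<le> 4 * K" using that 5 by auto
        then have "e i \<in> ?I - V t" using e_V[of i] 5(7) that False by blast
        then show ?thesis using f(3) False by simp
      qed (use f in simp)
      have "0 < snd t * ori (f (e a)) (f (e b)) (f (e c)) (f (e d))"
        using f(2) e_in(1)[of a] e_in(1)[of b] e_in(1)[of c] e_in(1)[of d]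
          e_mono[of a b] e_mono[of b c] e_mono[of c d] 5(3-6) unfolding P_def by auto
      then show ?case using pe[of a] pe[of b] pe[of c] pe[of d] by simp
    qed
    moreover have "s \<le> card T * card (C j)" if j: "j < K" for j
    proof -
      define v where "v = e (4 * j + 2)"
      have v: "v \<in> V t" using j by (auto simp: v_def V_def e_def)
      have Vt: "V t \<subseteq> ?I" "card (V t) = K" using V[OF tg(1)] by auto
      have finV: "finite (V t)" using Vt finite_subset by blast
      have "(\<Prod>w\<in>V t. card (B w)) = card (B v) * (\<Prod>w\<in>V t - {v}. card (B w))"
        using v finV by (simp add: prod.remove)
      also have "\<dots> \<le> card (B v) * (\<Prod>w\<in>V t - {v}. s)"
      proof (intro mult_le_mono2 prod_mono conjI)
        fix w assume "w \<in> V t - {v}"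
        then have "w < R" using Vt by auto
        then show "card (B w) \<le> s" using BA[of w] finA[of w] card_mono[of "A w" "B w"] by simp
      qed auto
      also have "\<dots> = card (B v) * s ^ (K - 1)" using v finV Vt by simp
      finally have "s ^ K \<le> card T * (card (B v) * s ^ (K - 1))"
        using tg(3) unfolding B_def[symmetric] by (meson le_trans mult_le_mono2)
      moreover have "s ^ K = s * s ^ (K - 1)" using K by (simp flip: power_Suc)
      ultimately have "s ^ (K - 1) * s \<le> s ^ (K - 1) * (card T * card (B v))" by (simp add: mult_ac)
      then show ?thesis using s(1) by (simp add: C_def v_def)
    qed
    ultimately show "\<exists>\<epsilon> p C. \<epsilon> \<in> {1, -1} \<and> moment_clusters (\<lambda>a b c d. \<epsilon> * ori a b c d) X K p C \<and> (\<forall>j<K. s \<le> card T * card (C j))"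
      using eps by blast
  qed
qed

text \<open>For \<open>\<epsilon> = -1\<close>, exchanging the supports \<open>a\<close> and
  \<open>b\<close> restores the sign.\<close>

lemma (in chirotope) cut_off_points_scale:
  assumes "\<epsilon> \<in> {1, -1}" "chirotope.cut_off_points (\<lambda>a b c d. \<epsilon> * ori a b c d) X n"
  shows "cut_off_points X n"
proof -
  interpret sc: chirotope "\<lambda>a b c d. \<epsilon> * ori a b c d" by (rule chirotope_scale[OF assms(1)])
  obtain v a b c where *: "\<forall>i<n. v i \<in> X \<and> a i \<in> X \<and> b i \<in> X \<and> c i \<in> X \<and>
     \<epsilon> * ori (a i) (b i) (c i) (v i) > 0 \<and> (\<forall>j<n. j \<noteq> i \<longrightarrow> \<epsilon> * ori (a i) (b i) (c i) (v j) < 0)"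
    using assms(2) unfolding sc.cut_off_points_def by blast
  show ?thesis
  proof (cases "\<epsilon> = 1")
    case True
    then show ?thesis using * unfolding cut_off_points_def by auto
  next
    case False
    then have e: "\<epsilon> = -1" using assms by simp
    have sw: "ori (b i) (a i) (c i) z = \<epsilon> * ori (a i) (b i) (c i) z" for i z
      using swap12[of "b i" "a i" "c i" z] e by simp
    have "\<forall>i<n. v i \<in> X \<and> b i \<in> X \<and> a i \<in> X \<and> c i \<in> X \<and>
     ori (b i) (a i) (c i) (v i) > 0 \<and> (\<forall>j<n. j \<noteq> i \<longrightarrow> ori (b i) (a i) (c i) (v j) < 0)"
      unfolding sw using * by simp
    then show ?thesis unfolding cut_off_points_def by (intro exI)
  qed
qed

theorem (in chirotope) cut_off_points_subexponential:
  fixes \<delta> :: real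
  assumes \<delta>: "\<delta> > 0"
  shows "\<forall>\<^sub>F n in sequentially. \<forall>X. finite X \<longrightarrow>
    (\<forall>a b c d. {a, b, c, d} \<subseteq> X \<longrightarrow> distinct [a, b, c, d] \<longrightarrow> ori a b c d \<noteq> 0) \<longrightarrow>
    2 powr (\<delta> * real n) \<le> real (card X) \<longrightarrow> cut_off_points X n"
proof -
  obtain R where R: "R > 0" "\<forall>\<^sub>F n in sequentially.
    real (2 * n + 2 * (n div R + 1) choose (2 * (n div R + 1))) < 2 powr (\<delta> / 24 * real n)"
    using binomial_subexponential[of "\<delta> / 24"] \<delta> by auto
  \<comment> \<open>The power of \<open>s\<close> needed per cluster: \<open>s ^ 2\<close> for the
    first split, \<open>s ^ (2 * R)\<close> for the rounds of the game, and \<open>s' ^ 2\<close>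
    with \<open>s' = s ^ R\<close>.\<close>
  define L where "L = 4 * R + 2"
  \<comment> \<open>Half of the exponent \<open>\<delta>\<close> pays for \<open>s ^ L\<close>, the
    other half for the constants \<open>R0\<close> and \<open>Suc T\<close>.\<close>
  define \<gamma> where "\<gamma> = \<delta> / (2 * real L)"
  have \<gamma>: "\<gamma> > 0" using \<delta> by (simp add: \<gamma>_def L_def)
  obtain k where k: "k > 0" "\<forall>\<^sub>F n in sequentially.
    real (2 * n + 2 * (n div k + 1) choose (2 * (n div k + 1))) < 2 powr (\<gamma> / 2 * real n)"
    using binomial_subexponential[of "\<gamma> / 2"] \<gamma> by auto
  define K where "K = k * stage_size k R"
  have "stage_size k R > 0" by (cases R) auto
  then have K: "K > 0" using k by (simp add: K_def)
  obtain R0 T where RT: "\<And>X s. finite X \<Longrightarrow> (\<forall>a b c d. {a, b, c, d} \<subseteq> X \<longrightarrow> distinct [a, b, c, d] \<longrightarrow> ori a b c d \<noteq> 0) \<Longrightarrow>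
    s > 0 \<Longrightarrow> R0 * s \<le> card X \<Longrightarrow>
    (\<exists>\<epsilon> p C. \<epsilon> \<in> {1, -1} \<and> moment_clusters (\<lambda>a b c d. \<epsilon> * ori a b c d) X K p C \<and> (\<forall>j<K. s \<le> T * card (C j)))"
    using moment_clusters_exist[OF K] by blast
  have lim: "filterlim (\<lambda>n. 2 powr (c * real n)) at_top sequentially" if "c > 0" for c :: real
    using that by real_asymp
  have ev1: "\<forall>\<^sub>F n in sequentially. 2 \<le> 2 powr (\<gamma> / 2 * real n)"
    using lim[of "\<gamma> / 2"] \<gamma> unfolding filterlim_at_top by auto
  have ev2: "\<forall>\<^sub>F n in sequentially. real (R0 * Suc T) \<le> 2 powr (\<delta> / 2 * real n)"
    using lim[of "\<delta> / 2"] \<delta> unfolding filterlim_at_top by auto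
  show ?thesis
    using R(2) k(2) ev1 ev2
  proof eventually_elim
    case (elim n)
    show ?case
    proof (intro allI impI)
      fix X
      assume X: "finite X" "\<forall>a b c d. {a, b, c, d} \<subseteq> X \<longrightarrow> distinct [a, b, c, d] \<longrightarrow> ori a b c d \<noteq> 0"
        "2 powr (\<delta> * real n) \<le> real (card X)"
      define s where "s = nat \<lfloor>2 powr (\<gamma> * real n)\<rfloor>"
      have s_le: "real s \<le> 2 powr (\<gamma> * real n)" by (simp add: s_def)
      have s_ge: "2 powr (\<gamma> / 2 * real n) \<le> real s"
      proof -
        let ?y = "2 powr (\<gamma> / 2 * real n)"
        have "?y * ?y = 2 powr (\<gamma> * real n)" by (simp flip: powr_add)
        moreover have "?y * 2 \<le> ?y * ?y" using elim(3) by (intro mult_left_mono) auto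
        moreover have "2 powr (\<gamma> * real n) - 1 < real s"
          unfolding s_def by (simp add: floor_less_iff of_nat_nat)
        ultimately show ?thesis using elim(3) by linarith
      qed
      have s0: "s > 0" using s_ge elim(3) by (cases "s = 0") auto
      have sL: "real (s ^ L) \<le> 2 powr (\<delta> / 2 * real n)"
      proof -
        have "real (s ^ L) \<le> (2 powr (\<gamma> * real n)) ^ L" using s_le by (simp add: power_mono)
        also have "\<dots> = 2 powr (\<gamma> * real L * real n)" by (simp add: powr_powr mult_ac flip: powr_realpow)
        also have "\<gamma> * real L = \<delta> / 2"
        proof -
          have "real L \<noteq> 0" by (simp add: L_def)
          then show ?thesis by (simp add: \<gamma>_def)
        qed
        finally show ?thesis .
      qed
      have sR: "2 powr (\<delta> / 24 * real n) \<le> real (s ^ R)"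
      proof -
        \<comment> \<open>Here \<open>\<gamma> / 2 * R\<close> equals
          \<open>\<delta> * R / (16 * R + 8)\<close>, which is smallest for \<open>R = 1\<close>.
          Thus the exponent of \<open>s'\<close> does not shrink as \<open>R\<close> grows; halving
          \<open>\<gamma>\<close> absorbs the rounding in \<open>s\<close>.\<close>
        have "\<delta> / 24 \<le> \<gamma> / 2 * real R"
          using \<delta> R(1) by (simp add: \<gamma>_def L_def field_simps)
        then have "2 powr (\<delta> / 24 * real n) \<le> 2 powr (\<gamma> / 2 * real n * real R)"
          using mult_right_mono[of "\<delta> / 24" "\<gamma> / 2 * real R" "real n"] by (intro powr_mono) (simp_all add: mult_ac)
        also have "\<dots> = (2 powr (\<gamma> / 2 * real n)) ^ R" by (simp add: powr_powr flip: powr_realpow)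
        also have "\<dots> \<le> real s ^ R" using s_ge by (intro power_mono) auto
        finally show ?thesis by simp
      qed
      have "R0 * (Suc T * s ^ L) \<le> card X"
      proof -
        have "real (R0 * (Suc T * s ^ L)) = real (R0 * Suc T) * real (s ^ L)" by (simp add: algebra_simps)
        also have "\<dots> \<le> 2 powr (\<delta> / 2 * real n) * 2 powr (\<delta> / 2 * real n)"
          using elim(4) sL by (intro mult_mono) auto
        also have "\<dots> = 2 powr (\<delta> * real n)" by (simp flip: powr_add)
        finally show ?thesis using X(3) by linarith
      qed
      \<comment> \<open>The factor \<open>Suc T\<close> keeps the part size positive and can be
        cancelled even if \<open>T = 0\<close>.\<close>
      then obtain \<epsilon> p C where C: "\<epsilon> \<in> {1, -1}" "moment_clusters (\<lambda>a b c d. \<epsilon> * ori a b c d) X K p C"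
        "\<forall>j<K. Suc T * s ^ L \<le> T * card (C j)"
        using RT[OF X(1,2), of "Suc T * s ^ L"] s0 by auto
      interpret mc: moment_clusters "\<lambda>a b c d. \<epsilon> * ori a b c d" X K p C by (rule C(2))
      have "mc.cut_off_points X n"
      proof (rule mc.cut_off_points_of_clusters[OF K_def k(1)])
        show "(s * s) * ((s * s) ^ R * (s ^ R * s ^ R)) \<le> card (C j)" if "j < K" for j
        proof -
          have "(s * s) * ((s * s) ^ R * (s ^ R * s ^ R)) = s ^ L"
          proof -
            have "L = R + R + R + R + 1 + 1" by (simp add: L_def)
            then show ?thesis by (simp only: power_add power_one_right power_mult_distrib mult_ac)
          qed
          moreover have "Suc T * s ^ L \<le> Suc T * card (C j)" 
            using C(3)[rule_format, OF that] by simp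
          ultimately show ?thesis by (simp only: Suc_mult_le_cancel1)
        qed
        show "(2 * n + 2 * (n div k + 1) choose (2 * (n div k + 1))) < s"
          using elim(2) s_ge by linarith
        show "(2 * n + 2 * (n div R + 1) choose (2 * (n div R + 1))) < s ^ R"
          using elim(1) sR by linarith
        show "n \<le> k * (n div k + 1)" "n \<le> R * (n div R + 1)"
          using k(1) R(1) by (simp_all add: less_imp_le dividend_less_times_div algebra_simps)
      qed
      then show "cut_off_points X n" by (rule cut_off_points_scale[OF C(1)])
    qed
  qed
qed

section \<open>Positive fractions in three dimensions\<close>

text \<open>The hypothesis is applied to transversals of \<open>S\<close> disjoint parts. A type
  records which indices are cut off by which; there are at most \<open>S ^ (4 * m)\<close> types, so
  freezing all other indices costs a factor \<open>S ^ 4\<close> per cut off point in the geometric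
  mean. Asking for twice as many points allows discarding the worse half, and the rest lose at most
  \<open>S ^ 8\<close> each.\<close>

lemma (in chirotope) positive_fraction_cut_off:
  assumes finX: "finite X" and S: "S > 0" "S \<le> card X"
    and cut: "\<And>Y. Y \<subseteq> X \<Longrightarrow> card Y = S \<Longrightarrow> cut_off_points Y (2 * n)"
  shows "\<exists>B a b c. \<forall>i<n. B i \<subseteq> X \<and> card X \<le> 2 * S ^ 9 * card (B i) \<and>
    (\<forall>x\<in>B i. ori (a i) (b i) (c i) x > 0) \<and> (\<forall>j<n. j \<noteq> i \<longrightarrow> (\<forall>x\<in>B j. ori (a i) (b i) (c i) x < 0))"
proof (cases "n = 0")
  case True
  then show ?thesis by simp
next
  case n0: False
  define m where "m = 2 * n"
  define s where "s = card X div S"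
  have s0: "s > 0" using S by (simp add: s_def div_greater_zero_iff)
  have "S * s \<le> card X" by (simp add: s_def)
  then obtain A where A: "\<forall>i<S. A i \<subseteq> X \<and> card (A i) = s" "\<forall>i<S. \<forall>j<S. i \<noteq> j \<longrightarrow> A i \<inter> A j = {}"
    using disjoint_parts_exist[OF finX] by blast
  let ?I = "{..<S}" and ?F = "PiE {..<m} (\<lambda>_. {..<S})"
  define T where "T = {t \<in> ?F \<times> ?F \<times> ?F \<times> ?F. case t of (v, a, b, c) \<Rightarrow> inj_on v {..<m} \<and>
     (\<forall>i<m. \<forall>j<m. v i \<noteq> a j \<and> v i \<noteq> b j \<and> v i \<noteq> c j)}"
  have cF: "finite ?F" "card ?F = S ^ m" by (auto intro: finite_PiE simp: card_PiE)
  have finFF: "finite (?F \<times> ?F \<times> ?F \<times> ?F)" using cF(1) by (intro finite_cartesian_product)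
  have finT: "finite T" unfolding T_def using finFF by (rule finite_subset[rotated]) blast
  have "card T \<le> card (?F \<times> ?F \<times> ?F \<times> ?F)" unfolding T_def by (intro card_mono finFF) blast
  also have "\<dots> = S ^ (4 * m)"
  proof -
    have "4 * m = m + (m + (m + m))" by simp
    then show ?thesis by (simp only: card_cartesian_product cF power_add)
  qed
  finally have cT: "card T \<le> S ^ (4 * m)" .
  define P where "P t f \<longleftrightarrow> (case t of (v, a, b, c) \<Rightarrow> \<forall>i<m. ori (f (a i)) (f (b i)) (f (c i)) (f (v i)) > 0 \<and>
     (\<forall>j<m. j \<noteq> i \<longrightarrow> ori (f (a i)) (f (b i)) (f (c i)) (f (v j)) < 0))"
    for t :: "(nat \<Rightarrow> nat) \<times> (nat \<Rightarrow> nat) \<times> (nat \<Rightarrow> nat) \<times> (nat \<Rightarrow> nat)" and f :: "nat \<Rightarrow> 'p"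
  define V where "V t = fst t ` {..<m}" for t :: "(nat \<Rightarrow> nat) \<times> (nat \<Rightarrow> nat) \<times> (nat \<Rightarrow> nat) \<times> (nat \<Rightarrow> nat)"
  have finA: "finite (A i) \<and> card (A i) = s" if "i \<in> ?I" for i
    using A(1) that finX by (meson finite_subset lessThan_iff)
  have ori0: "ori a b c a = 0" "ori a b c b = 0" "ori a b c c = 0" for a b c
  proof -
    show 3: "ori a b c c = 0" for a b c by simp
    show 2: "ori a b c b = 0" for a b c using swap23[of a c b b] 3[of a c b] by simp
    show "ori a b c a = 0" using swap12[of b a c a] 2[of b a c] by simp
  qed
  have P: "\<exists>t\<in>T. P t f" if f: "f \<in> PiE ?I A" for f
  proof -
    have inj: "inj_on f ?I" using PiE_disjoint_inj_on[OF f] A(2) by auto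
    have "f ` ?I \<subseteq> X" using PiE_mem[OF f] A(1) by fastforce
    moreover have "card (f ` ?I) = S" using inj by (simp add: card_image)
    ultimately have "cut_off_points (f ` ?I) m" unfolding m_def by (rule cut)
    then obtain v a b c where vabc: "\<And>i. i < m \<Longrightarrow> v i \<in> f ` ?I \<and> a i \<in> f ` ?I \<and> b i \<in> f ` ?I \<and> c i \<in> f ` ?I \<and>
       ori (a i) (b i) (c i) (v i) > 0 \<and> (\<forall>j<m. j \<noteq> i \<longrightarrow> ori (a i) (b i) (c i) (v j) < 0)"
      unfolding cut_off_points_def by blast
    define g where "g = the_inv_into ?I f"
    have fg: "f (g x) = x" "g x < S" if "x \<in> f ` ?I" for x
      using that inj f_the_inv_into_f[OF inj] the_inv_into_into[OF inj, of x ?I] by (auto simp: g_def)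
    let ?r = "\<lambda>h. restrict (g \<circ> h) {..<m}"
    have fr: "f (?r v i) = v i" "f (?r a i) = a i" "f (?r b i) = b i" "f (?r c i) = c i" if "i < m" for i
      using fg vabc[OF that] that by simp_all
    have neg: "ori (a i) (b i) (c i) (v j) \<noteq> 0" if "i < m" "j < m" for i j
      using vabc[OF that(1)] that by (cases "j = i") (auto simp: less_imp_neq)
    have ne: "v i \<noteq> a j \<and> v i \<noteq> b j \<and> v i \<noteq> c j" if "i < m" "j < m" for i j
      using neg[OF that(2,1)] ori0[where a = "a j" and b = "b j" and c = "c j"] by auto
    have vv: "v i \<noteq> v j" if "i < m" "j < m" "i \<noteq> j" for i j
      using vabc[OF that(1)] that by (metis less_asym)
    have "inj_on (?r v) {..<m}"
      by (rule inj_onI) (metis fr(1) lessThan_iff vv)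
    moreover have "\<forall>i<m. \<forall>j<m. ?r v i \<noteq> ?r a j \<and> ?r v i \<noteq> ?r b j \<and> ?r v i \<noteq> ?r c j"
      using fr ne by metis
    moreover have "?r v \<in> ?F" "?r a \<in> ?F" "?r b \<in> ?F" "?r c \<in> ?F"
      using fg(2) vabc by auto
    ultimately have "(?r v, ?r a, ?r b, ?r c) \<in> T" by (simp add: T_def)
    moreover have "P (?r v, ?r a, ?r b, ?r c) f"
      unfolding P_def prod.case using fr vabc by simp
    ultimately show ?thesis by blast
  qed
  have V: "V t \<subseteq> ?I \<and> card (V t) = m" if "t \<in> T" for t
  proof -
    obtain v a b c where t: "t = (v, a, b, c)" by (cases t)
    have v: "v \<in> ?F" "inj_on v {..<m}" using that unfolding T_def t by simp_all
    then have "v ` {..<m} \<subseteq> ?I" using PiE_mem[OF v(1)] by (intro image_subsetI)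
    then show ?thesis using v(2) by (simp add: V_def t card_image)
  qed
  have "\<exists>t\<in>T. \<exists>g\<in>PiE (?I - V t) A. s ^ m \<le> card T *
      (\<Prod>v\<in>V t. card {f v |f. f \<in> PiE ?I A \<and> P t f \<and> (\<forall>i\<in>?I - V t. f i = g i)})"
    by (rule product_pigeonhole[OF finite_lessThan _ s0 finT]) (fact finA P V)+
  then obtain t g where tg: "t \<in> T" "g \<in> PiE (?I - V t) A" "s ^ m \<le> card T *
      (\<Prod>v\<in>V t. card {f v |f. f \<in> PiE ?I A \<and> P t f \<and> (\<forall>i\<in>?I - V t. f i = g i)})"
    by (elim bexE) (rule that)
  obtain v a b c where t: "t = (v, a, b, c)" by (cases t) auto
  define B where "B i = {f (v i) |f. f \<in> PiE ?I A \<and> P t f \<and> (\<forall>i\<in>?I - V t. f i = g i)}" for i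
  have vT: "v i < S" "a i < S" "b i < S" "c i < S" if "i < m" for i
    using tg(1) that PiE_mem[of _ "{..<m}" "\<lambda>_. {..<S}" i] unfolding T_def t by auto
  have inj: "inj_on v {..<m}" and ne: "\<And>i j. i < m \<Longrightarrow> j < m \<Longrightarrow> v i \<noteq> a j \<and> v i \<noteq> b j \<and> v i \<noteq> c j"
    using tg(1) unfolding T_def t by auto
  have notV: "a i \<in> ?I - V t" "b i \<in> ?I - V t" "c i \<in> ?I - V t" if "i < m" for i
    using vT[OF that] ne[OF _ that] unfolding V_def t by fastforce+
  have prodB: "s ^ m \<le> S ^ (4 * m) * (\<Prod>i<m. card (B i))"
  proof -
    have e: "(\<Prod>w\<in>V t. card {f w |f. f \<in> PiE ?I A \<and> P t f \<and> (\<forall>i\<in>?I - V t. f i = g i)}) = (\<Prod>i<m. card (B i))"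
      unfolding V_def[of t] B_def using inj by (subst prod.reindex) (auto simp: t V_def)
    show ?thesis by (rule le_trans[OF tg(3)[unfolded e] mult_le_mono1[OF cT]])
  qed
  have BA: "B i \<subseteq> A (v i)" if "i < m" for i using vT(1)[OF that] by (auto simp: B_def)
  have Bs: "card (B i) \<le> s" if "i < m" for i
    using BA[OF that] finA[of "v i"] vT(1)[OF that] card_mono[of "A (v i)" "B i"] by simp
  \<comment> \<open>Each sign involves frozen supports and the single moving point \<open>x\<close>,
    so it holds whatever transversal \<open>x\<close> was taken from.\<close>
  have Bsep: "ori (g (a i)) (g (b i)) (g (c i)) x > 0 \<and>
      (\<forall>j<m. j \<noteq> i \<longrightarrow> ori (g (a j)) (g (b j)) (g (c j)) x < 0)" if i: "i < m" "x \<in> B i" for i x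
  proof -
    obtain f where f: "x = f (v i)" "P t f" "\<forall>i\<in>?I - V t. f i = g i" using i(2) unfolding B_def by blast
    have fg: "f (a j) = g (a j)" "f (b j) = g (b j)" "f (c j) = g (c j)" if "j < m" for j
      using f(3) notV[OF that] by blast+
    show ?thesis using f(2) i(1) fg unfolding P_def t prod.case f(1) by (metis (no_types, lifting))
  qed
  define G where "G = {i. i < m \<and> s \<le> S ^ 8 * card (B i)}"
  have finG: "finite G" "G \<subseteq> {..<m}" by (auto simp: G_def)
  have "n \<le> card G"
  proof (rule ccontr)
    assume "\<not> n \<le> card G"
    define N where "N = {..<m} - G"
    have N: "card N = m - card G" "finite N" using finG by (auto simp: N_def card_Diff_subset)
    have cN: "8 * card N \<ge> 4 * m" "card N > 0" using \<open>\<not> n \<le> card G\<close> N(1) by (auto simp: m_def)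
    obtain i0 where i0: "i0 \<in> N" using cN(2) by fastforce
    have lt: "S ^ 8 * card (B i) < s" if "i \<in> N" for i using that by (auto simp: N_def G_def)
    have "(\<Prod>i\<in>N. S ^ 8 * card (B i)) < (\<Prod>i\<in>N. s)"
      by (rule prod_mono_strict[OF i0 _ N(2)]) (use lt[OF i0] lt s0 in \<open>simp_all add: less_imp_le\<close>)
    then have 1: "S ^ (8 * card N) * (\<Prod>i\<in>N. card (B i)) < s ^ card N"
      by (simp add: prod.distrib power_mult)
    have 2: "(\<Prod>i\<in>G. card (B i)) \<le> s ^ card G"
    proof -
      have "(\<Prod>i\<in>G. card (B i)) \<le> (\<Prod>i\<in>G. s)" using finG(2) Bs by (intro prod_mono) auto
      then show ?thesis by simp
    qed
    have split: "(\<Prod>i<m. card (B i)) = (\<Prod>i\<in>N. card (B i)) * (\<Prod>i\<in>G. card (B i))"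
      unfolding N_def using finG by (intro prod.subset_diff) auto
    have "S ^ (4 * m) * (\<Prod>i<m. card (B i)) \<le> S ^ (8 * card N) * (\<Prod>i<m. card (B i))"
      using cN(1) S(1) by (intro mult_le_mono1 power_increasing) auto
    also have "\<dots> = (S ^ (8 * card N) * (\<Prod>i\<in>N. card (B i))) * (\<Prod>i\<in>G. card (B i))"
      by (simp add: split)
    also have "\<dots> \<le> (S ^ (8 * card N) * (\<Prod>i\<in>N. card (B i))) * s ^ card G"
      using 2 by (rule mult_le_mono2)
    also have "\<dots> < s ^ card N * s ^ card G" using 1 s0 by simp
    also have "\<dots> = s ^ m"
    proof -
      have "card N + card G = m" using N(1) card_mono[OF _ finG(2)] by simp
      then show ?thesis by (simp flip: power_add)
    qed
    finally show False using prodB by simp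
  qed
  then obtain G' where G': "G' \<subseteq> G" "card G' = n" by (meson obtain_subset_with_card_n)
  have finG': "finite G'" using G' finG finite_subset by blast
  obtain h where h: "bij_betw h {..<n} G'"
    using ex_bij_betw_nat_finite[OF finG'] G'(2) by (auto simp: atLeast0LessThan)
  have hG: "h i \<in> G" "h i < m" if "i < n" for i
    using h that G'(1) finG(2) by (auto simp: bij_betw_def)
  have hne: "h i \<noteq> h j" if "i < n" "j < n" "i \<noteq> j" for i j
    using h that by (auto simp: bij_betw_def inj_on_def)
  \<comment> \<open>The ninth factor \<open>S\<close> and the 2 come from passing from
    \<open>X\<close> to parts of size \<open>card X div S\<close>.\<close>
  have size: "card X \<le> 2 * S ^ 9 * card (B (h i))" if "i < n" for i
  proof -
    have "card X < S * (s + 1)" using S(1) dividend_less_times_div[of S "card X"] by (simp add: s_def algebra_simps)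
    also have "\<dots> \<le> S * (2 * s)" using s0 by (intro mult_le_mono2) simp
    also have "\<dots> \<le> S * (2 * (S ^ 8 * card (B (h i))))" using hG(1)[OF that] by (intro mult_le_mono2) (simp add: G_def)
    also have "\<dots> = 2 * S ^ 9 * card (B (h i))"
    proof -
      have "S ^ 9 = S * S ^ 8" by (simp add: eval_nat_numeral)
      then show ?thesis by (simp only: mult_ac)
    qed
    finally show ?thesis by simp
  qed
  have "\<forall>i<n. B (h i) \<subseteq> X \<and> card X \<le> 2 * S ^ 9 * card (B (h i)) \<and>
    (\<forall>x\<in>B (h i). ori (g (a (h i))) (g (b (h i))) (g (c (h i))) x > 0) \<and>
    (\<forall>j<n. j \<noteq> i \<longrightarrow> (\<forall>x\<in>B (h j). ori (g (a (h i))) (g (b (h i))) (g (c (h i))) x < 0))"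
  proof (intro allI impI conjI ballI)
    fix i assume i: "i < n"
    show "B (h i) \<subseteq> X" using BA[OF hG(2)[OF i]] A(1) vT(1)[OF hG(2)[OF i]] by blast
    show "card X \<le> 2 * S ^ 9 * card (B (h i))" by (rule size[OF i])
    show "ori (g (a (h i))) (g (b (h i))) (g (c (h i))) x > 0" if "x \<in> B (h i)" for x
      using Bsep[OF hG(2)[OF i] that] by blast
    show "ori (g (a (h i))) (g (b (h i))) (g (c (h i))) x < 0" if "j < n" "j \<noteq> i" "x \<in> B (h j)" for j x
      using Bsep[OF hG(2)[OF that(1)] that(3)] hG(2)[OF i] hne[OF i that(1)] that(2) by auto
  qed
  then show ?thesis
    by (intro exI[of _ "\<lambda>i. B (h i)"] exI[of _ "\<lambda>i. g (a (h i))"] exI[of _ "\<lambda>i. g (b (h i))"] exI[of _ "\<lambda>i. g (c (h i))"])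
qed

section \<open>Orientation by determinants in \<open>real ^ 3\<close>\<close>

definition triple_product :: "real ^ 3 \<Rightarrow> real ^ 3 \<Rightarrow> real ^ 3 \<Rightarrow> real" where
  "triple_product u v w = u $ 1 * (v $ 2 * w $ 3 - v $ 3 * w $ 2) - u $ 2 * (v $ 1 * w $ 3 - v $ 3 * w $ 1)
     + u $ 3 * (v $ 1 * w $ 2 - v $ 2 * w $ 1)"

definition orient3 :: "real ^ 3 \<Rightarrow> real ^ 3 \<Rightarrow> real ^ 3 \<Rightarrow> real ^ 3 \<Rightarrow> real" where
  "orient3 a b c d = triple_product (b - a) (c - a) (d - a)"

lemma triple_product_pluecker:
  "triple_product u c d * triple_product u e f - triple_product u c e * triple_product u d f +
     triple_product u c f * triple_product u d e = 0"
  unfolding triple_product_def by algebra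

interpretation orient3: chirotope orient3
proof
  show "orient3 b a c d = - orient3 a b c d" for a b c d
    unfolding orient3_def triple_product_def vector_minus_component by algebra
  show "orient3 a c b d = - orient3 a b c d" for a b c d
    unfolding orient3_def triple_product_def vector_minus_component by algebra
  show "orient3 a b d c = - orient3 a b c d" for a b c d
    unfolding orient3_def triple_product_def vector_minus_component by algebra
  show "orient3 a b c d * orient3 a b e f - orient3 a b c e * orient3 a b d f + orient3 a b c f * orient3 a b d e = 0"
    for a b c d e f unfolding orient3_def by (rule triple_product_pluecker)
qed

lemma orient3_affine:
  assumes "s + t = 1"
  shows "orient3 a b c (s *\<^sub>R x + t *\<^sub>R y) = s * orient3 a b c x + t * orient3 a b c y"
proof -
  have s: "s = 1 - t" using assms by simp
  show ?thesis unfolding s orient3_def triple_product_def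
    by (simp add: algebra_simps)
qed

lemma convex_orient3_pos: "convex {x. orient3 a b c x > 0}"
  by (auto simp: convex_def orient3_affine)
    (metis add_cancel_right_left add_pos_nonneg mult_eq_0_iff mult_nonneg_nonneg mult_pos_pos
      less_eq_real_def zero_neq_one)

lemma convex_orient3_neg: "convex {x. orient3 a b c x < 0}"
proof -
  have "{x. orient3 a b c x < 0} = {x. orient3 b a c x > 0}"
    using orient3.swap12[of a b c] by auto
  then show ?thesis using convex_orient3_pos by simp
qed

lemma triple_product_eq_0:
  assumes "triple_product u v w = 0"
  shows "\<exists>n. n \<noteq> 0 \<and> n \<bullet> u = 0 \<and> n \<bullet> v = 0 \<and> n \<bullet> w = 0"
proof -
  define A :: "real ^ 3 ^ 3" where "A = vector [u, v, w]"
  have "det A = 0" using assms by (simp add: A_def det_3 triple_product_def algebra_simps)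
  then have "\<not> invertible A" by (simp add: invertible_det_nz)
  then have "\<not> (\<forall>x. A *v x = 0 \<longrightarrow> x = 0)"
    using invertible_left_inverse matrix_left_invertible_ker by blast
  then obtain n where n: "A *v n = 0" "n \<noteq> 0" by blast
  have "(A *v n) $ i = A $ i \<bullet> n" for i by (simp add: matrix_mult_dot)
  then have "A $ 1 \<bullet> n = 0" "A $ 2 \<bullet> n = 0" "A $ 3 \<bullet> n = 0" using n by auto
  then show ?thesis using n by (intro exI[of _ n]) (auto simp: A_def inner_commute)
qed

lemma orient3_general_position:
  assumes "general_position (X :: (real ^ 3) set)" "{a, b, c, d} \<subseteq> X" "distinct [a, b, c, d]"
  shows "orient3 a b c d \<noteq> 0"
proof
  assume "orient3 a b c d = 0"
  then obtain n where n: "n \<noteq> 0" "n \<bullet> (b - a) = 0" "n \<bullet> (c - a) = 0" "n \<bullet> (d - a) = 0"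
    unfolding orient3_def using triple_product_eq_0 by blast
  then have "{a, b, c, d} \<subseteq> {x. n \<bullet> x = n \<bullet> a}" by (auto simp: inner_diff_right)
  moreover have "card {a, b, c, d} = DIM(real ^ 3) + 1" using assms(3) by auto
  ultimately show False using assms(1,2) n(1) unfolding general_position_def by blast
qed

text \<open>A single exponent \<open>t\<close> is both size threshold and fraction, so the best one
  for each \<open>n\<close> can be chosen by \<open>LEAST\<close>; smaller sets are left to
  singletons.\<close>

definition positive_fraction3 :: "nat \<Rightarrow> nat \<Rightarrow> bool" where
  "positive_fraction3 n t \<longleftrightarrow> (\<forall>X :: (real ^ 3) set. finite X \<longrightarrow> general_position X \<longrightarrow> 2 ^ t \<le> card X \<longrightarrow>
     (\<exists>B. (\<forall>i<n. B i \<subseteq> X \<and> card X \<le> 2 ^ t * card (B i)) \<and> family_convex_position {..<n} B))"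

lemma family_convex_position_subset:
  "family_convex_position I X \<Longrightarrow> J \<subseteq> I \<Longrightarrow> family_convex_position J X"
  unfolding family_convex_position_def
proof (intro ballI)
  fix i assume *: "\<forall>i\<in>I. convex hull X i \<inter> convex hull \<Union> (X ` (I - {i})) = {}" "J \<subseteq> I" "i \<in> J"
  have "convex hull \<Union> (X ` (J - {i})) \<subseteq> convex hull \<Union> (X ` (I - {i}))"
    using *(2) by (intro hull_mono) blast
  moreover have "convex hull X i \<inter> convex hull \<Union> (X ` (I - {i})) = {}" using * by blast
  ultimately show "convex hull X i \<inter> convex hull \<Union> (X ` (J - {i})) = {}" by blast
qed

lemma positive_fraction3_mono: "positive_fraction3 n' t \<Longrightarrow> n \<le> n' \<Longrightarrow> positive_fraction3 n t"
  unfolding positive_fraction3_def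
  by (meson family_convex_position_subset lessThan_subset_iff order_less_le_trans)

lemma positive_fraction3_eventually:
  fixes \<delta> :: real
  assumes \<delta>: "\<delta> > 0"
  shows "\<forall>\<^sub>F n in sequentially. \<exists>t. real t \<le> \<delta> * real n \<and> positive_fraction3 n t"
proof -
  \<comment> \<open>With \<open>S = 2 ^ \<sigma>\<close> and \<open>\<sigma>\<close> below
    \<open>2 * \<eta> * n + 1\<close>, the loss \<open>2 * S ^ 9\<close> gives \<open>t\<close>
    below \<open>18 * \<eta> * n + 10\<close>, that is, \<open>\<delta> * n / 2 + 10\<close>. The 10
    is absorbed by \<open>n1\<close>.\<close>
  define \<eta> where "\<eta> = \<delta> / 36"
  have \<eta>: "\<eta> > 0" using \<delta> by (simp add: \<eta>_def)
  have "\<forall>\<^sub>F n in sequentially. \<forall>X. finite X \<longrightarrow>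
    (\<forall>a b c d. {a, b, c, d} \<subseteq> X \<longrightarrow> distinct [a, b, c, d] \<longrightarrow> orient3 a b c d \<noteq> 0) \<longrightarrow>
    2 powr (\<eta> * real n) \<le> real (card X) \<longrightarrow> orient3.cut_off_points X n"
    by (rule orient3.cut_off_points_subexponential[OF \<eta>])
  then obtain n0 where "\<forall>n\<ge>n0. \<forall>X. finite X \<longrightarrow>
    (\<forall>a b c d. {a, b, c, d} \<subseteq> X \<longrightarrow> distinct [a, b, c, d] \<longrightarrow> orient3 a b c d \<noteq> 0) \<longrightarrow>
    2 powr (\<eta> * real n) \<le> real (card X) \<longrightarrow> orient3.cut_off_points X n"
    unfolding eventually_sequentially by (elim exE) (rule that)
  note n0 = this[THEN spec, THEN mp, THEN spec, THEN mp, THEN mp, THEN mp]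
  obtain n1 :: nat where n1: "20 / \<delta> < real n1" using reals_Archimedean2 by blast
  have "\<exists>t. real t \<le> \<delta> * real n \<and> positive_fraction3 n t" if n: "n \<ge> max n0 n1" for n
  proof -
    define \<sigma> where "\<sigma> = nat \<lceil>\<eta> * real (2 * n)\<rceil>"
    have \<sigma>: "\<eta> * real (2 * n) \<le> real \<sigma>" "real \<sigma> < \<eta> * real (2 * n) + 1"
      using \<eta> unfolding \<sigma>_def by (auto simp: of_nat_nat ceiling_less_iff) linarith
    define t where "t = 9 * \<sigma> + 1"
    have "20 / \<delta> < real n" using n1 n by linarith
    then have "20 < \<delta> * real n" using \<delta> by (simp add: field_simps)
    then have "real t \<le> \<delta> * real n" using \<sigma>(2) by (simp add: t_def \<eta>_def)
    moreover have "positive_fraction3 n t"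
      unfolding positive_fraction3_def
    proof (intro allI impI)
      fix X :: "(real ^ 3) set"
      assume X: "finite X" "general_position X" "2 ^ t \<le> card X"
      have "\<sigma> \<le> t" by (simp add: t_def)
      then have "(2::nat) ^ \<sigma> \<le> 2 ^ t" by (intro power_increasing) auto
      then have S: "2 ^ \<sigma> \<le> card X" using X(3) by linarith
      have cut: "orient3.cut_off_points Y (2 * n)" if Y: "Y \<subseteq> X" "card Y = 2 ^ \<sigma>" for Y
      proof (rule n0)
        show "2 * n \<ge> n0" using n by simp
        show "finite Y" using Y(1) X(1) finite_subset by blast
        show "\<forall>a b c d. {a, b, c, d} \<subseteq> Y \<longrightarrow> distinct [a, b, c, d] \<longrightarrow> orient3 a b c d \<noteq> 0"
          using orient3_general_position[OF X(2)] Y(1) by (meson order_trans)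
        have "2 powr (\<eta> * real (2 * n)) \<le> 2 powr real \<sigma>" using \<sigma>(1) by (intro powr_mono) auto
        then show "2 powr (\<eta> * real (2 * n)) \<le> real (card Y)" using Y(2) by (simp add: powr_realpow)
      qed
      have "\<exists>B a b c. \<forall>i<n. B i \<subseteq> X \<and> card X \<le> 2 * (2 ^ \<sigma>) ^ 9 * card (B i) \<and>
        (\<forall>x\<in>B i. orient3 (a i) (b i) (c i) x > 0) \<and>
        (\<forall>j<n. j \<noteq> i \<longrightarrow> (\<forall>x\<in>B j. orient3 (a i) (b i) (c i) x < 0))"
        by (rule orient3.positive_fraction_cut_off[OF X(1) _ S cut]) simp_all
      then obtain B a b c where B: "\<forall>i<n. B i \<subseteq> X \<and> card X \<le> 2 * (2 ^ \<sigma>) ^ 9 * card (B i) \<and>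
        (\<forall>x\<in>B i. orient3 (a i) (b i) (c i) x > 0) \<and>
        (\<forall>j<n. j \<noteq> i \<longrightarrow> (\<forall>x\<in>B j. orient3 (a i) (b i) (c i) x < 0))"
        by (elim exE) (rule that)
      have "2 * (2 ^ \<sigma>) ^ 9 = (2::nat) ^ t" by (simp add: t_def power_mult[symmetric] mult.commute)
      then have "\<forall>i<n. B i \<subseteq> X \<and> card X \<le> 2 ^ t * card (B i)" using B by simp
      moreover have "family_convex_position {..<n} B"
        unfolding family_convex_position_def
      proof
        fix i assume i: "i \<in> {..<n}"
        have "convex hull B i \<subseteq> {x. orient3 (a i) (b i) (c i) x > 0}"
          using B i by (intro hull_minimal convex_orient3_pos) auto
        moreover have "convex hull (\<Union>j\<in>{..<n} - {i}. B j) \<subseteq> {x. orient3 (a i) (b i) (c i) x < 0}"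
          using B i by (intro hull_minimal convex_orient3_neg) auto
        ultimately show "convex hull B i \<inter> convex hull (\<Union>j\<in>{..<n} - {i}. B j) = {}" by force
      qed
      ultimately show "\<exists>B. (\<forall>i<n. B i \<subseteq> X \<and> card X \<le> 2 ^ t * card (B i)) \<and> family_convex_position {..<n} B"
        by blast
    qed
    ultimately show ?thesis by blast
  qed
  then show ?thesis unfolding eventually_sequentially by blast
qed

text \<open>For small \<open>n\<close>, members of a larger family are dropped.\<close>

lemma positive_fraction3_exists: "\<exists>t. positive_fraction3 n t"
proof -
  obtain N where "\<And>m. m \<ge> N \<Longrightarrow> \<exists>t. real t \<le> 1 * real m \<and> positive_fraction3 m t"
    using positive_fraction3_eventually[of 1] unfolding eventually_sequentially by auto
  then obtain t where "positive_fraction3 (max n N) t" using max.cobounded2 by blast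
  then show ?thesis using positive_fraction3_mono by (meson max.cobounded1)
qed

section \<open>Generic projections and the Erdos-Szekeres number\<close>

lemma convex_position_of_independent:
  assumes "finite P" "\<And>x. x \<in> P \<Longrightarrow> x \<notin> convex hull (P - {x})"
  shows "convex_position P"
proof -
  have "{x. x extreme_point_of (convex hull P)} = P"
  proof (rule extreme_points_of_convex_hull_eq)
    show "compact P" using assms(1) by (rule finite_imp_compact)
    fix T assume T: "T \<subset> P"
    then obtain x where x: "x \<in> P" "x \<notin> T" by blast
    have "convex hull T \<subseteq> convex hull (P - {x})" using T x by (intro hull_mono) blast
    then have "x \<notin> convex hull T" using assms(2)[OF x(1)] by blast
    moreover have "x \<in> convex hull P" using x(1) hull_inc by metis
    ultimately show "convex hull T \<noteq> convex hull P" by blast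
  qed
  moreover have "polytope (convex hull P)" using assms(1) unfolding polytope_def by blast
  ultimately show ?thesis unfolding convex_position_def by blast
qed

lemma convex_position_imp_independent:
  assumes "convex_position P" "x \<in> P" "Q \<subseteq> P - {x}"
  shows "x \<notin> convex hull Q"
proof -
  obtain K where K: "polytope K" "P = {v. v extreme_point_of K}"
    using assms(1) unfolding convex_position_def by blast
  have cK: "convex K" using K(1) polytope_imp_convex by blast
  have "x extreme_point_of K" using assms(2) K(2) by blast
  then have "convex (K - {x})" using extreme_point_of_stillconvex[OF cK] by blast
  moreover have "Q \<subseteq> K - {x}" using assms(3) K(2) by (auto simp: extreme_point_of_def)
  ultimately have "convex hull Q \<subseteq> K - {x}" by (intro hull_minimal)
  then show ?thesis by blast
qed

text \<open>A common point of two hulls would map to a common point of the image hulls.\<close>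

lemma family_convex_position_linear_image:
  assumes "linear f" "family_convex_position I (\<lambda>i. f ` X i)"
  shows "family_convex_position I X"
  unfolding family_convex_position_def
proof (intro ballI equals0I)
  fix i z assume i: "i \<in> I" and z: "z \<in> convex hull X i \<inter> convex hull (\<Union>j\<in>I - {i}. X j)"
  have "f z \<in> f ` (convex hull X i)" "f z \<in> f ` (convex hull (\<Union>j\<in>I - {i}. X j))" using z by auto
  then have "f z \<in> convex hull (f ` X i)" "f z \<in> convex hull (\<Union>j\<in>I - {i}. f ` X j)"
    using assms(1) by (simp_all add: convex_hull_linear_image image_UN)
  then show False using assms(2) i unfolding family_convex_position_def by blast
qed

section \<open>Generic linear projection to three dimensions\<close>

lemma general_position_subset:
  fixes X :: "'a::euclidean_space set"
  assumes "general_position X" "Y \<subseteq> X" "DIM('a) + 1 \<le> card Y"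
  shows "general_position Y"
  using assms unfolding general_position_def by (meson order_trans)

lemma avoid_lowdim_sets:
  fixes \<S> :: "'a::euclidean_space set set"
  assumes "finite \<S>" "\<And>S. S \<in> \<S> \<Longrightarrow> dim S < DIM('a)"
  shows "\<exists>r. \<forall>S\<in>\<S>. r \<notin> S"
proof -
  have "negligible (\<Union>\<S>)" using assms by (intro negligible_Union negligible_lowdim)
  then have "\<Union>\<S> \<noteq> UNIV" using non_negligible_UNIV by metis
  then show ?thesis by blast
qed

text \<open>By the size condition in general position, \<open>Q\<close> extends to
  \<open>DIM('a) + 1\<close> points of \<open>X\<close>. If the differences of these failed to span
  the space, the points would share a hyperplane.\<close>

lemma general_position_dim_differences:
  fixes X :: "'a::euclidean_space set"
  assumes X: "finite X" "general_position X" and Q: "Q \<subseteq> X" "q \<in> Q" "card Q \<le> DIM('a) + 1"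
  shows "dim ((\<lambda>x. x - q) ` (Q - {q})) = card Q - 1"
proof -
  have finQ: "finite Q" using X(1) Q(1) finite_subset by blast
  have "DIM('a) + 1 \<le> card X" using X unfolding general_position_def by blast
  then obtain S where S: "Q \<subseteq> S" "S \<subseteq> X" "card S = DIM('a) + 1"
    using exists_subset_between[OF Q(3) _ Q(1) X(1)] by blast
  have finS: "finite S" using X(1) S(2) finite_subset by blast
  let ?D = "(\<lambda>x. x - q) ` (S - {q})"
  have inj: "inj_on (\<lambda>x. x - q) A" for A by (simp add: inj_on_def)
  have qS: "q \<in> S" using S(1) Q(2) by blast
  have cD: "card ?D = DIM('a)" using inj S(3) finS qS by (simp add: card_image)
  have "\<not> dim ?D < DIM('a)"
  proof
    assume "dim ?D < DIM('a)"
    then obtain a where a: "a \<noteq> 0" "span ?D \<subseteq> {x. a \<bullet> x = 0}"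
      using lowdim_subset_hyperplane by blast
    have "a \<bullet> x = a \<bullet> q" if "x \<in> S" for x
    proof (cases "x = q")
      case False
      then have "x - q \<in> span ?D" using that by (intro span_base) blast
      then show ?thesis using a(2) by (auto simp: inner_diff_right)
    qed simp
    then have "S \<subseteq> {x. a \<bullet> x = a \<bullet> q}" by blast
    then show False using X(2) S a(1) unfolding general_position_def by blast
  qed
  then have "dim ?D = DIM('a)" using dim_subset_UNIV[of ?D] by linarith
  then have "independent ?D"
    using finS cD by (intro card_le_dim_spanning[of ?D ?D]) (auto intro: span_base)
  then have "independent ((\<lambda>x. x - q) ` (Q - {q}))"
    using S(1) by (elim independent_mono) blast
  then have "dim ((\<lambda>x. x - q) ` (Q - {q})) = card ((\<lambda>x. x - q) ` (Q - {q}))"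
    by (rule dim_eq_card_independent)
  also have "\<dots> = card Q - 1" using inj Q(2) finQ by (simp add: card_image)
  finally show ?thesis .
qed

text \<open>Four image points lie on a plane with normal \<open>a\<close> exactly if the combination
  of the rows \<open>r1\<close>, \<open>r2\<close>, \<open>r3\<close> with coefficients
  \<open>a\<close> is orthogonal to all differences of the preimages, that is, lies in
  \<open>U Q\<close>. As \<open>U Q\<close> has codimension at least 3, the rows can be chosen one
  by one, outside finitely many proper subspaces, to be independent modulo every \<open>U Q\<close>;
  \<open>r1\<close> also separates the points of \<open>X\<close>.\<close>

lemma generic_projection:
  fixes X :: "'a::euclidean_space set"
  assumes d: "DIM('a) \<ge> 3" and X: "finite X" "general_position X"
  shows "\<exists>f :: 'a \<Rightarrow> real ^ 3. linear f \<and> inj_on f X \<and> general_position (f ` X)"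
proof -
  define \<Q> where "\<Q> = {Q. Q \<subseteq> X \<and> card Q = 4}"
  have fin\<Q>: "finite \<Q>" using X(1) by (simp add: \<Q>_def)
  define U where "U Q = {z. \<forall>x\<in>Q. \<forall>y\<in>Q. z \<bullet> (x - y) = 0}" for Q :: "'a set"
  have dimU: "dim (U Q) + 3 \<le> DIM('a)" if Q: "Q \<in> \<Q>" for Q
  proof -
    have Q4: "Q \<subseteq> X" "card Q = 4" using Q by (auto simp: \<Q>_def)
    then obtain q where q: "q \<in> Q" by fastforce
    let ?W = "span ((\<lambda>x. x - q) ` (Q - {q}))"
    have "dim ?W = 3" using general_position_dim_differences[OF X Q4(1) q] Q4(2) d by (simp add: dim_span)
    moreover have "dim {y \<in> UNIV. \<forall>x \<in> ?W. orthogonal x y} + dim ?W = dim (UNIV :: 'a set)"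
      by (rule dim_subspace_orthogonal_to_vectors) auto
    moreover have "U Q \<subseteq> {y \<in> UNIV. \<forall>x \<in> ?W. orthogonal x y}"
    proof
      fix z assume z: "z \<in> U Q"
      have "orthogonal z x" if "x \<in> ?W" for x
        using z q by (intro orthogonal_to_span[OF that]) (auto simp: U_def orthogonal_def)
      then show "z \<in> {y \<in> UNIV. \<forall>x \<in> ?W. orthogonal x y}" by (auto simp: orthogonal_commute)
    qed
    then have "dim (U Q) \<le> dim {y \<in> UNIV. \<forall>x \<in> ?W. orthogonal x y}" by (rule dim_subset)
    ultimately show ?thesis by simp
  qed
  have subU: "subspace (U Q)" for Q
    unfolding U_def subspace_def by (auto simp: inner_add_left)
  have dim_ins: "dim (insert r S) \<le> dim S + 1" for r :: 'a and S by (simp add: dim_insert)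
  have "\<exists>r. \<forall>S\<in>U ` \<Q> \<union> (\<lambda>(x, y). {z. (x - y) \<bullet> z = 0}) ` {(x, y). x \<in> X \<and> y \<in> X \<and> x \<noteq> y}. r \<notin> S"
  proof (rule avoid_lowdim_sets)
    have "finite {(x, y). x \<in> X \<and> y \<in> X \<and> x \<noteq> y}"
      by (rule finite_subset[of _ "X \<times> X"]) (use X(1) in auto)
    then show "finite (U ` \<Q> \<union> (\<lambda>(x, y). {z. (x - y) \<bullet> z = 0}) ` {(x, y). x \<in> X \<and> y \<in> X \<and> x \<noteq> y})"
      using fin\<Q> by blast
    fix S assume "S \<in> U ` \<Q> \<union> (\<lambda>(x, y). {z. (x - y) \<bullet> z = 0}) ` {(x, y). x \<in> X \<and> y \<in> X \<and> x \<noteq> y}"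
    then consider Q where "Q \<in> \<Q>" "S = U Q" | x y where "x \<noteq> y" "S = {z. (x - y) \<bullet> z = 0}" by auto
    then show "dim S < DIM('a)"
    proof cases
      case 1
      then show ?thesis using dimU[of Q] by simp
    next
      case 2
      then show ?thesis using dim_hyperplane[of "x - y"] d by simp
    qed
  qed
  then obtain r1 where avoid: "\<forall>S\<in>U ` \<Q> \<union> (\<lambda>(x, y). {z. (x - y) \<bullet> z = 0}) `
      {(x, y). x \<in> X \<and> y \<in> X \<and> x \<noteq> y}. r1 \<notin> S" by (elim exE)
  have r1: "r1 \<notin> U Q" if "Q \<in> \<Q>" for Q
    by (rule bspec[OF avoid]) (intro UnI1 imageI that)
  have r1': "(x - y) \<bullet> r1 \<noteq> 0" if "x \<in> X" "y \<in> X" "x \<noteq> y" for x y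
  proof -
    have "r1 \<notin> (\<lambda>(x, y). {z. (x - y) \<bullet> z = 0}) (x, y)"
      by (rule bspec[OF avoid], intro UnI2 imageI) (use that in simp)
    then show ?thesis by simp
  qed
  have "\<exists>r. \<forall>S\<in>(\<lambda>Q. span (insert r1 (U Q))) ` \<Q>. r \<notin> S"
  proof (rule avoid_lowdim_sets)
    fix S assume "S \<in> (\<lambda>Q. span (insert r1 (U Q))) ` \<Q>"
    then obtain Q where "Q \<in> \<Q>" "S = span (insert r1 (U Q))" by blast
    then show "dim S < DIM('a)" using dimU[of Q] dim_ins[of r1 "U Q"] by (simp add: dim_span)
  qed (use fin\<Q> in blast)
  then obtain r2 where r2: "\<And>Q. Q \<in> \<Q> \<Longrightarrow> r2 \<notin> span (insert r1 (U Q))" by blast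
  have "\<exists>r. \<forall>S\<in>(\<lambda>Q. span (insert r2 (insert r1 (U Q)))) ` \<Q>. r \<notin> S"
  proof (rule avoid_lowdim_sets)
    fix S assume "S \<in> (\<lambda>Q. span (insert r2 (insert r1 (U Q)))) ` \<Q>"
    then obtain Q where "Q \<in> \<Q>" "S = span (insert r2 (insert r1 (U Q)))" by blast
    then show "dim S < DIM('a)"
      using dimU[of Q] dim_ins[of r1 "U Q"] dim_ins[of r2 "insert r1 (U Q)"] by (simp add: dim_span)
  qed (use fin\<Q> in blast)
  then obtain r3 where r3: "\<And>Q. Q \<in> \<Q> \<Longrightarrow> r3 \<notin> span (insert r2 (insert r1 (U Q)))" by blast
  define f :: "'a \<Rightarrow> real ^ 3" where "f x = vector [r1 \<bullet> x, r2 \<bullet> x, r3 \<bullet> x]" for x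
  have f_nth: "f x $ 1 = r1 \<bullet> x" "f x $ 2 = r2 \<bullet> x" "f x $ 3 = r3 \<bullet> x" for x by (simp_all add: f_def)
  have lin: "linear f"
    by (rule linearI) (simp_all add: vec_eq_iff forall_3 f_nth inner_add_right)
  have inj: "inj_on f X"
  proof (rule inj_onI, rule ccontr)
    fix x y assume xy: "x \<in> X" "y \<in> X" "f x = f y" "x \<noteq> y"
    have "r1 \<bullet> x = r1 \<bullet> y" using xy(3) f_nth(1) by metis
    then show False using r1'[OF xy(1,2,4)] by (simp add: inner_diff_right inner_commute[of _ r1])
  qed
  have span_solve: "r \<in> span T" if "a \<noteq> 0" "a *\<^sub>R r + w \<in> span T" "w \<in> span T" for a and r w :: 'a and T
  proof -
    have "a *\<^sub>R r \<in> span T" using span_diff[OF that(2,3)] by simp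
    then have "inverse a *\<^sub>R a *\<^sub>R r \<in> span T" by (rule span_scale)
    then show ?thesis using that(1) by simp
  qed
  have "general_position (f ` X)"
    unfolding general_position_def
  proof (intro conjI impI notI)
    have "DIM('a) + 1 \<le> card X" using X unfolding general_position_def by blast
    then show "DIM(real ^ 3) + 1 \<le> card (f ` X)" using inj d by (simp add: card_image)
    assume "\<exists>S a b. S \<subseteq> f ` X \<and> card S = DIM(real ^ 3) + 1 \<and> a \<noteq> 0 \<and> S \<subseteq> {x. a \<bullet> x = b}"
    then obtain S a b where S: "S \<subseteq> f ` X" "card S = 4" "a \<noteq> 0" "S \<subseteq> {x. a \<bullet> x = b}" by auto
    then obtain Q where Q: "Q \<subseteq> X" "inj_on f Q" "S = f ` Q" by (meson subset_image_inj)
    have Q\<Q>: "Q \<in> \<Q>" using Q S(2) by (auto simp: \<Q>_def card_image)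
    let ?w = "a $ 3 *\<^sub>R r3 + (a $ 2 *\<^sub>R r2 + a $ 1 *\<^sub>R r1)"
    have af: "a \<bullet> f x = ?w \<bullet> x" for x
      by (simp add: inner_vec_def sum_3 f_nth inner_add_left)
    have "?w \<in> U Q"
      unfolding U_def
    proof (intro CollectI ballI)
      fix x y assume "x \<in> Q" "y \<in> Q"
      then have "a \<bullet> f x = b" "a \<bullet> f y = b" using S(4) Q(3) by auto
      then show "?w \<bullet> (x - y) = 0" unfolding af by (simp add: inner_diff_right)
    qed
    then have w: "?w \<in> span (insert r2 (insert r1 (U Q)))" "?w \<in> span (insert r1 (U Q))" "?w \<in> span (U Q)"
      by (auto intro: span_base)
    \<comment> \<open>The coefficients vanish from the last to the first, since each row avoids the
      span of \<open>U Q\<close> and the earlier rows.\<close>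
    have a3: "a $ 3 = 0"
    proof (rule ccontr)
      assume "a $ 3 \<noteq> 0"
      moreover have "a $ 2 *\<^sub>R r2 + a $ 1 *\<^sub>R r1 \<in> span (insert r2 (insert r1 (U Q)))"
        by (intro span_add span_scale span_base) auto
      ultimately show False using span_solve[OF _ w(1)] r3[OF Q\<Q>] by blast
    qed
    have a2: "a $ 2 = 0"
    proof (rule ccontr)
      assume "a $ 2 \<noteq> 0"
      moreover have "a $ 2 *\<^sub>R r2 + a $ 1 *\<^sub>R r1 \<in> span (insert r1 (U Q))" using w(2) a3 by simp
      moreover have "a $ 1 *\<^sub>R r1 \<in> span (insert r1 (U Q))" by (intro span_scale span_base) auto
      ultimately show False using span_solve r2[OF Q\<Q>] by blast
    qed
    have a1: "a $ 1 = 0"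
    proof (rule ccontr)
      assume "a $ 1 \<noteq> 0"
      moreover have "a $ 1 *\<^sub>R r1 + 0 \<in> span (U Q)" using w(3) a3 a2 by simp
      ultimately have "r1 \<in> span (U Q)" using span_solve span_0 by blast
      then show False using r1[OF Q\<Q>] subU[of Q] by (simp add: span_eq_iff[THEN iffD2])
    qed
    show False using S(3) a1 a2 a3 by (simp add: vec_eq_iff forall_3)
  qed
  then show ?thesis using lin inj by blast
qed

text \<open>\<open>LEAST\<close> is meaningful only if some \<open>N\<close> qualifies.
  \<open>4 + 2 ^ t\<close> does: take one point from each member of a family in convex position. The
  4 meets the size requirement in \<open>ES\<close>.\<close>

lemma ES3_property:
  fixes n :: nat
  defines "N \<equiv> ES TYPE(real ^ 3) n"
  shows "N \<ge> 4 \<and> (\<forall>X :: (real ^ 3) set. finite X \<and> card X = N \<and> general_position X \<longrightarrow>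
    (\<exists>P\<subseteq>X. card P = n \<and> convex_position P))"
proof -
  let ?R = "\<lambda>N. N \<ge> DIM(real ^ 3) + 1 \<and> (\<forall>X :: (real ^ 3) set. finite X \<and> card X = N \<and> general_position X \<longrightarrow>
    (\<exists>P\<subseteq>X. card P = n \<and> convex_position P))"
  obtain t where t: "positive_fraction3 n t" using positive_fraction3_exists by blast
  have "?R (4 + 2 ^ t)"
  proof (intro conjI allI impI)
    fix X :: "(real ^ 3) set" assume X: "finite X \<and> card X = 4 + 2 ^ t \<and> general_position X"
    then have "2 ^ t \<le> card X" by simp
    then obtain B where B: "\<forall>i<n. B i \<subseteq> X \<and> card X \<le> 2 ^ t * card (B i)" "family_convex_position {..<n} B"
      using t X unfolding positive_fraction3_def by blast
    have "\<exists>x. x \<in> B i" if "i < n" for i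
    proof -
      have "card X \<le> 2 ^ t * card (B i)" using B(1) that by blast
      then have "card (B i) \<noteq> 0" using X by (cases "card (B i) = 0") auto
      then show ?thesis by (metis card.empty ex_in_conv)
    qed
    then obtain x where x: "\<And>i. i < n \<Longrightarrow> x i \<in> B i" by metis
    have sep: "x i \<notin> convex hull (x ` ({..<n} - {i}))" if "i < n" for i
    proof -
      have "x ` ({..<n} - {i}) \<subseteq> (\<Union>j\<in>{..<n} - {i}. B j)" using x by blast
      then have "convex hull (x ` ({..<n} - {i})) \<subseteq> convex hull (\<Union>j\<in>{..<n} - {i}. B j)" by (rule hull_mono)
      moreover have "x i \<in> convex hull (B i)" using x[OF that] hull_inc by metis
      moreover have "convex hull (B i) \<inter> convex hull (\<Union>j\<in>{..<n} - {i}. B j) = {}"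
        using B(2) that unfolding family_convex_position_def by blast
      ultimately show ?thesis by blast
    qed
    have inj: "inj_on x {..<n}"
    proof (rule inj_onI, rule ccontr)
      fix i j assume ij: "i \<in> {..<n}" "j \<in> {..<n}" "x i = x j" "i \<noteq> j"
      then have "x i \<in> x ` ({..<n} - {i})" by auto
      then show False using sep[of i] ij(1) hull_inc by (metis lessThan_iff)
    qed
    have "convex_position (x ` {..<n})"
    proof (rule convex_position_of_independent)
      fix y assume "y \<in> x ` {..<n}"
      then obtain i where i: "i < n" "y = x i" by blast
      have "x ` {..<n} - {y} = x ` ({..<n} - {i})" using inj i by (auto simp: inj_on_def)
      then show "y \<notin> convex hull (x ` {..<n} - {y})" using sep i by simp
    qed simp
    moreover have "x ` {..<n} \<subseteq> X" using x B(1) by blast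
    moreover have "card (x ` {..<n}) = n" using inj by (simp add: card_image)
    ultimately show "\<exists>P\<subseteq>X. card P = n \<and> convex_position P" by blast
  qed simp
  then have least: "?R (LEAST N. ?R N)" by (rule LeastI)
  have "N = (LEAST N. ?R N)" unfolding N_def ES_def by (rule refl)
  then have "?R N" using least by (rule ssubst[where P = ?R])
  moreover have d: "DIM(real ^ 3) + 1 = 4" by simp
  ultimately show ?thesis unfolding d by (intro conjI) (elim conjE, assumption)+
qed

lemma singletons_in_convex_position:
  fixes X :: "'a::euclidean_space set" and f :: "'a \<Rightarrow> real ^ 3"
  assumes f: "linear f" "inj_on f X" "general_position (f ` X)" and X: "finite X" "ES TYPE(real ^ 3) m \<le> card X"
    and n: "n \<le> m"
  shows "\<exists>Y. (\<forall>i\<in>{1..n}. Y i \<subseteq> X \<and> card (Y i) = 1) \<and> family_convex_position {1..n} Y"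
proof -
  let ?N = "ES TYPE(real ^ 3) m"
  have "?N \<le> card (f ` X)" using X(2) f(2) by (simp add: card_image)
  \<comment> \<open>\<open>ES\<close> speaks of sets of exactly \<open>?N\<close> points;
    \<open>?N \<ge> 4\<close> keeps such a subset in general position.\<close>
  then obtain Z where Z: "Z \<subseteq> f ` X" "card Z = ?N" by (meson obtain_subset_with_card_n)
  have finZ: "finite Z" using Z(1) X(1) finite_subset by blast
  have "general_position Z" using ES3_property[of m] Z by (intro general_position_subset[OF f(3) Z(1)]) simp
  then obtain P where P: "P \<subseteq> Z" "card P = m" "convex_position P" using ES3_property[of m] finZ Z(2) by blast
  obtain P' where P': "P' \<subseteq> P" "card P' = n" using n P(2) by (metis obtain_subset_with_card_n)
  have finP': "finite P'" using P' P finZ finite_subset by metis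
  obtain e where e: "bij_betw e {1..n} P'" using finite_same_card_bij[OF _ finP', of "{1..n}"] P'(2) by auto
  define g where "g = inv_into X f"
  have fg: "f (g y) = y" "g y \<in> X" if "y \<in> P'" for y
  proof -
    have "y \<in> f ` X" using that P'(1) P(1) Z(1) by blast
    then show "f (g y) = y" "g y \<in> X" by (simp_all add: g_def f_inv_into_f inv_into_into)
  qed
  have eP: "e i \<in> P'" if "i \<in> {1..n}" for i using e that by (auto simp: bij_betw_def)
  have "family_convex_position {1..n} (\<lambda>i. f ` {g (e i)})"
    unfolding family_convex_position_def
  proof
    fix i assume i: "i \<in> {1..n}"
    have "(\<Union>j\<in>{1..n} - {i}. f ` {g (e j)}) \<subseteq> P - {e i}"
    proof (rule UN_least)
      fix j assume j: "j \<in> {1..n} - {i}"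
      then have "e j \<noteq> e i" using inj_onD[of e "{1..n}" j i] e i unfolding bij_betw_def by blast
      moreover have "e j \<in> P'" using eP j by blast
      ultimately show "f ` {g (e j)} \<subseteq> P - {e i}" using fg(1) P'(1) by auto
    qed
    then have "e i \<notin> convex hull (\<Union>j\<in>{1..n} - {i}. f ` {g (e j)})"
      using convex_position_imp_independent[OF P(3)] eP[OF i] P'(1) by blast
    then show "convex hull (f ` {g (e i)}) \<inter> convex hull (\<Union>j\<in>{1..n} - {i}. f ` {g (e j)}) = {}"
      using fg(1)[OF eP[OF i]] by simp
  qed
  then have "family_convex_position {1..n} (\<lambda>i. {g (e i)})" by (rule family_convex_position_linear_image[OF f(1)])
  then show ?thesis using fg(2) eP by (intro exI[of _ "\<lambda>i. {g (e i)}"]) auto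
qed

lemma positive_fraction_pullback:
  fixes X :: "'a::euclidean_space set" and f :: "'a \<Rightarrow> real ^ 3"
  assumes f: "linear f" "inj_on f X" "general_position (f ` X)" and X: "finite X" "2 ^ t \<le> card X"
    and t: "positive_fraction3 n t"
  shows "\<exists>Y. (\<forall>i\<in>{1..n}. Y i \<subseteq> X \<and> card X \<le> 2 ^ t * card (Y i)) \<and> family_convex_position {1..n} Y"
proof -
  have cX: "card (f ` X) = card X" using f(2) by (rule card_image)
  then obtain B where B: "\<forall>i<n. B i \<subseteq> f ` X \<and> card X \<le> 2 ^ t * card (B i)" "family_convex_position {..<n} B"
    using t f(3) X unfolding positive_fraction3_def by (metis finite_imageI)
  \<comment> \<open>The members are numbered from 0 in \<open>B\<close> and from 1 in the
    conclusion.\<close>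
  define Y where "Y i = {x \<in> X. f x \<in> B (i - 1)}" for i
  have Y: "f ` Y i = B (i - 1)" if "i \<in> {1..n}" for i
  proof -
    have "i - 1 < n" using that by auto
    then have "B (i - 1) \<subseteq> f ` X" using B(1) by blast
    then show ?thesis by (auto simp: Y_def)
  qed
  have YX: "Y i \<subseteq> X" for i by (auto simp: Y_def)
  have "card X \<le> 2 ^ t * card (Y i)" if "i \<in> {1..n}" for i
  proof -
    have "card (B (i - 1)) = card (Y i)"
      using Y[OF that] card_image[OF inj_on_subset[OF f(2) YX[of i]]] by simp
    moreover have "i - 1 < n" using that by auto
    ultimately show ?thesis using B(1) by metis
  qed
  moreover have "family_convex_position {1..n} (\<lambda>i. f ` Y i)"
    unfolding family_convex_position_def
  proof
    fix i assume i: "i \<in> {1..n}"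
    have "(\<Union>j\<in>{1..n} - {i}. f ` Y j) \<subseteq> (\<Union>j\<in>{..<n} - {i - 1}. B j)"
    proof (rule UN_least)
      fix j assume "j \<in> {1..n} - {i}"
      then have "j - 1 \<in> {..<n} - {i - 1}" "f ` Y j = B (j - 1)" using Y[of j] i by auto
      then show "f ` Y j \<subseteq> (\<Union>j\<in>{..<n} - {i - 1}. B j)" by blast
    qed
    then have sub: "convex hull (\<Union>j\<in>{1..n} - {i}. f ` Y j) \<subseteq> convex hull (\<Union>j\<in>{..<n} - {i - 1}. B j)"
      by (rule hull_mono)
    have disj: "convex hull (B (i - 1)) \<inter> convex hull (\<Union>j\<in>{..<n} - {i - 1}. B j) = {}"
      using B(2) i unfolding family_convex_position_def by auto
    show "convex hull (f ` Y i) \<inter> convex hull (\<Union>j\<in>{1..n} - {i}. f ` Y j) = {}"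
      unfolding Y[OF i] using Int_mono[OF order_refl sub] disj by (metis subset_empty)
  qed
  then have "family_convex_position {1..n} Y" by (rule family_convex_position_linear_image[OF f(1)])
  ultimately show ?thesis using YX by blast
qed

theorem theorem1p3:
  assumes "CARD('d::finite) \<ge> 3"
  shows "\<exists>\<epsilon>::nat \<Rightarrow> real.
    (\<forall>n\<ge>3. \<epsilon> n > 0) \<and>
    (\<lambda>n. log 2 (1 / \<epsilon> n)) \<in> o(\<lambda>n. real n) \<and>
    (\<forall>n\<ge>3. \<forall>\<X>::(real ^ 'd) set.
       finite \<X> \<and> general_position \<X> \<and> card \<X> \<ge> ES TYPE(real ^ 3) (8 * n) \<longrightarrow>
       (\<exists>X::nat \<Rightarrow> (real ^ 'd) set.
          (\<forall>i\<in>{1..n}. X i \<subseteq> \<X>) \<and>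
          family_convex_position {1..n} X \<and>
          (\<forall>i\<in>{1..n}. real (card (X i)) \<ge> \<epsilon> n * real (card \<X>))))"
proof -
  \<comment> \<open>With the least exponent for every \<open>n\<close>, the eventual bounds for all
    \<open>\<delta>\<close> apply to one and the same sequence.\<close>
  define T where "T n = (LEAST t. positive_fraction3 n t)" for n
  have T: "positive_fraction3 n (T n)" for n
    unfolding T_def using positive_fraction3_exists by (rule LeastI_ex)
  define \<epsilon> :: "nat \<Rightarrow> real" where "\<epsilon> n = 1 / 2 ^ T n" for n
  have log: "log 2 (1 / \<epsilon> n) = real (T n)" for n by (simp add: \<epsilon>_def log_nat_power)
  have "(\<lambda>n. log 2 (1 / \<epsilon> n)) \<in> o(\<lambda>n. real n)"
  proof (rule landau_o.smallI)
    fix c :: real assume "c > 0"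
    from positive_fraction3_eventually[OF this]
    show "\<forall>\<^sub>F n in sequentially. norm (log 2 (1 / \<epsilon> n)) \<le> c * norm (real n)"
    proof eventually_elim
      case (elim n)
      then obtain t where t: "real t \<le> c * real n" "positive_fraction3 n t" by blast
      have "T n \<le> t" unfolding T_def using t(2) by (rule Least_le)
      then show ?case using t(1) by (simp add: log)
    qed
  qed
  moreover have "\<exists>X::nat \<Rightarrow> (real ^ 'd) set. (\<forall>i\<in>{1..n}. X i \<subseteq> \<X>) \<and> family_convex_position {1..n} X \<and>
      (\<forall>i\<in>{1..n}. real (card (X i)) \<ge> \<epsilon> n * real (card \<X>))"
    if X: "finite \<X>" "general_position \<X>" "card \<X> \<ge> ES TYPE(real ^ 3) (8 * n)"
    for n and \<X> :: "(real ^ 'd) set"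
  proof -
    obtain f :: "real ^ 'd \<Rightarrow> real ^ 3" where f: "linear f" "inj_on f \<X>" "general_position (f ` \<X>)"
      using generic_projection[OF _ X(1,2)] assms by auto
    show ?thesis
    proof (cases "2 ^ T n \<le> card \<X>")
      case True
      then obtain Y where Y: "\<forall>i\<in>{1..n}. Y i \<subseteq> \<X> \<and> card \<X> \<le> 2 ^ T n * card (Y i)"
        "family_convex_position {1..n} Y"
        using positive_fraction_pullback[OF f X(1) _ T] by blast
      have "\<epsilon> n * real (card \<X>) \<le> real (card (Y i))" if "i \<in> {1..n}" for i
      proof -
        have "real (card \<X>) \<le> real (2 ^ T n * card (Y i))" using Y(1) that of_nat_le_iff by blast
        then show ?thesis by (simp add: \<epsilon>_def field_simps)
      qed
      then show ?thesis using Y by blast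
    next
      case False
      \<comment> \<open>Fewer than \<open>2 ^ T n\<close> points: the required size is below one, so
        singletons suffice.\<close>
      obtain Y where Y: "\<forall>i\<in>{1..n}. Y i \<subseteq> \<X> \<and> card (Y i) = 1" "family_convex_position {1..n} Y"
        using singletons_in_convex_position[OF f X(1,3), of n] by auto
      have "real (card \<X>) < 2 ^ T n" using False by (metis not_le of_nat_less_numeral_power_cancel_iff)
      then have "\<epsilon> n * real (card \<X>) \<le> 1" by (simp add: \<epsilon>_def)
      then have "\<forall>i\<in>{1..n}. \<epsilon> n * real (card \<X>) \<le> real (card (Y i))" using Y(1) by simp
      then show ?thesis using Y by blast
    qed
  qed
  moreover have "\<forall>n\<ge>3. \<epsilon> n > 0" by (simp add: \<epsilon>_def)
  ultimately show ?thesis by blast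
qed

end
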